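(* Let $\mathcal F$ be a foliation of degree $d\ge1$ on $\mathbb P^2_{\mathbb C}$ having an invariant line $L$. Suppose that all the singularities of $\mathcal F$ on $L$ are non-degenerate. Then there exists a homogeneous foliation $\mathcal H$ of degree $d$ on $\mathbb P^2_{\mathbb C}$ with the following properties: (1) $\mathcal H\in\overline{\mathcal O(\mathcal F)}$; (2) $L$ is invariant by $\mathcal H$; (3) $\mathrm{Sing}\,\mathcal H\cap L=\mathrm{Sing}\,\mathcal F\cap L$; (4) for every $s\in\mathrm{Sing}\,\mathcal H\cap L$ one has $\mu(\mathcal H,s)=1$ and $\mathrm{CS}(\mathcal H,L,s)=\mathrm{CS}(\mathcal F,L,s)$. If moreover $\mathrm{Leg}\,\mathcal F$ is flat, then $\mathrm{Leg}\,\mathcal H$ is also flat.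
   Context: Foliations. A foliation $\mathcal F$ of degree $d$ on $\mathbb P^2_{\mathbb C}$ is given in homogeneous coordinates $[x:y:z]$, up to a nonzero scalar, by a $1$-form $a\,\mathrm dx+b\,\mathrm dy+c\,\mathrm dz$ with $a,b,c$ homogeneous polynomials of degree $d+1$ without common factor satisfying $xa+yb+zc=0$; in the affine chart $z=1$ it is described by a polynomial $1$-form $A\,\mathrm dx+B\,\mathrm dy$ with $\gcd(A,B)=1$. $\mathrm{Sing}\,\mathcal F$ is the (finite) set of zeros of the defining form. $\mathcal F$ is homogeneous if in some affine chart $(x,y)$ it is invariant under all homotheties $(x,y)\mapsto\lambda(x,y)$, $\lambda\in\mathbb C^*$. The set $\mathbf F(d)$ of foliations of degree $d$ is a Zariski open subset of $\mathbb P_{\mathbb C}^{(d+2)^2-2}$ on which $\mathrm{PGL}_3(\mathbb C)=\mathrm{Aut}(\mathbb P^2_{\mathbb C})$ acts; $\mathcal O(\mathcal F)$ is the orbit of $\mathcal F$ and $\overline{\mathcal O(\mathcal F)}$ its closure in $\mathbf F(d)$. Local invariants. If $\mathcal F$ is defined near $s$ by a vector field $\mathrm X=f\partial_u+g\partial_v$ with isolated zeros, the Milnor number is $\mu(\mathcal F,s)=\dim_{\mathbb C}\mathcal O(\mathbb C^2,s)/\langle f,g\rangle$. The singularity $s$ is non-degenerate if $\mu(\mathcal F,s)=1$, i.e. the linear part of $\mathrm X$ at $s$ has two nonzero eigenvalues. If $s$ is a non-degenerate singularity lying on an invariant line $L$, the Camacho-Sad index is $\mathrm{CS}(\mathcal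 F,L,s)=\beta/\alpha$, where $\alpha$ is the eigenvalue of the linear part of $\mathrm X$ at $s$ in the tangent direction of $L$ and $\beta$ the other eigenvalue (induced on the normal direction to $L$). Webs and Legendre transform. A $k$-web on a complex surface is given locally by a $k$-symmetric holomorphic $1$-form with isolated zeros (well defined up to units, compatible on overlaps) which at a generic point factors as a product of $k$ pairwise non-collinear linear forms. The set where this fails is the discriminant $\Delta(\mathcal W)$. The Legendre transform $\mathrm{Leg}\,\mathcal F$ of a degree $d$ foliation is the $d$-web on the dual plane $\check{\mathbb P}^2_{\mathbb C}$ whose leaves are the families of tangent lines to the leaves of $\mathcal F$. If $\mathcal F$ is described by $A\,\mathrm dx+B\,\mathrm dy$ and $(p,q)$ is the affine chart of $\check{\mathbb P}^2_{\mathbb C}$ corresponding to the line $\{y=px-q\}$, then $\mathrm{Leg}\,\mathcal F$ is given by $A(x,px-q)+pB(x,px-q)=0$ with $x=\frac{\mathrm dq}{\mathrm dp}$. Curvature. For a germ of web $\mathcal W=\mathcal F_1\boxtimes\cdots\boxtimes\mathcal F_k$ superposed from foliations defined by $1$-forms $\theta_i$ in coordinates $(u,v)$, write $\theta_i\wedge\theta_j=\delta_{ij}\,\mathrm du\wedge\mathrm dv$. For $r<s<t$ let $\eta_{rst}$ be the unique meromorphic $1$-form with $\mathrm d(\delta_{st}\theta_r)=\eta_{rst}\wedge\delta_{st}\theta_r$, $\mathrm d(\delta_{tr}\theta_s)=\eta_{rst}\wedge\delta_{tr}\theta_s$, $\mathrm d(\delta_{rs}\theta_t)=\eta_{rst}\wedge\delta_{rs}\theta_t$.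 The curvature $K(\mathcal W)=\mathrm d(\sum_{r<s<t}\eta_{rst})$ does not depend on choices (it is $0$ if $k<3$). For a general web these local forms glue to a global meromorphic $2$-form with poles in $\Delta(\mathcal W)$. The web is flat if $K(\mathcal W)\equiv0$. *)

theory Defs
  imports "HOL-Analysis.Analysis" "HOL-Library.Extended_Nat"
begin

text \<open>
  Points of the projective plane are represented by non-zero vectors of homogeneous coordinates
  \<^term>\<open>v :: complex^3\<close>, so a subset of the plane is a set of non-zero vectors stable under
  non-zero scaling.  A foliation is represented by one of its defining forms
  \<open>a dx + b dy + c dz\<close>, encoded as the map \<^term>\<open>\<omega> :: complex^3 \<Rightarrow> complex^3\<close> with
  components \<open>(a, b, c)\<close>; two forms that differ by a non-zero scalar represent the same foliation,
  and every notion below only depends on the foliation.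
  As the field is infinite, polynomials are identified with polynomial functions.
\<close>

definition dot :: "complex^3 \<Rightarrow> complex^3 \<Rightarrow> complex"
  where "dot l v = (\<Sum>i\<in>UNIV. l $ i * v $ i)"

definition poly3 :: "(complex^3 \<Rightarrow> complex) \<Rightarrow> bool"
  where "poly3 f \<longleftrightarrow> (\<exists>N c. \<forall>v. f v =
     (\<Sum>i\<le>N. \<Sum>j\<le>N. \<Sum>k\<le>N. c i j k * (v $ 1) ^ i * (v $ 2) ^ j * (v $ 3) ^ k))"

definition homog_poly3 :: "nat \<Rightarrow> (complex^3 \<Rightarrow> complex) \<Rightarrow> bool"
  where "homog_poly3 n f \<longleftrightarrow> (\<exists>c. \<forall>v. f v =
     (\<Sum>i\<le>n. \<Sum>j\<le>n - i. c i j * (v $ 1) ^ i * (v $ 2) ^ j * (v $ 3) ^ (n - i - j)))"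

definition no_common_factor :: "(complex^3 \<Rightarrow> complex^3) \<Rightarrow> bool"
  where "no_common_factor \<omega> \<longleftrightarrow>
     (\<forall>f \<rho>. poly3 f \<and> (\<forall>i. poly3 (\<lambda>v. \<rho> v $ i)) \<and> (\<forall>v. \<omega> v = f v *s \<rho> v)
        \<longrightarrow> (\<exists>c. \<forall>v. f v = c))"

definition foliation_form :: "nat \<Rightarrow> (complex^3 \<Rightarrow> complex^3) \<Rightarrow> bool"
  where "foliation_form d \<omega> \<longleftrightarrow>
     (\<forall>i. homog_poly3 (d + 1) (\<lambda>v. \<omega> v $ i)) \<and> (\<forall>v. dot v (\<omega> v) = 0) \<and> no_common_factor \<omega>"

definition sing :: "(complex^3 \<Rightarrow> complex^3) \<Rightarrow> (complex^3) set"
  where "sing \<omega> = {v. v \<noteq> 0 \<and> \<omega> v = 0}"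

text \<open>The line with equation \<open>dot l v = 0\<close>, for \<open>l \<noteq> 0\<close>.\<close>

definition pline :: "complex^3 \<Rightarrow> (complex^3) set"
  where "pline l = {v. v \<noteq> 0 \<and> dot l v = 0}"

text \<open>A line is invariant if the defining form restricts to zero on it.\<close>

definition invariant_line :: "(complex^3 \<Rightarrow> complex^3) \<Rightarrow> complex^3 \<Rightarrow> bool"
  where "invariant_line \<omega> l \<longleftrightarrow> (\<forall>v w. dot l v = 0 \<and> dot l w = 0 \<longrightarrow> dot (\<omega> v) w = 0)"

text \<open>
  The pull-back of \<^term>\<open>\<omega>\<close> under the linear map \<^term>\<open>g\<close>: the same foliation written in the
  homogeneous coordinates \<open>w\<close> with \<open>v = g w\<close>, or the image of the foliation under the
  automorphism induced by the inverse of \<^term>\<open>g\<close>.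
\<close>

definition pullback :: "complex^3^3 \<Rightarrow> (complex^3 \<Rightarrow> complex^3) \<Rightarrow> complex^3 \<Rightarrow> complex^3"
  where "pullback g \<omega> v = transpose g *v \<omega> (g *v v)"

text \<open>The homothety \<open>(x, y) \<mapsto> t (x, y)\<close> of the chart \<open>z = 1\<close>, in homogeneous coordinates.\<close>

definition homothety :: "complex \<Rightarrow> complex^3^3"
  where "homothety t = (\<chi> i j. if i \<noteq> j then 0 else if i = 3 then 1 else t)"

definition homogeneous_foliation :: "(complex^3 \<Rightarrow> complex^3) \<Rightarrow> bool"
  where "homogeneous_foliation \<omega> \<longleftrightarrow> (\<exists>g. invertible g \<and>
     (\<forall>t. t \<noteq> 0 \<longrightarrow> (\<exists>c. c \<noteq> 0 \<and>
        (\<forall>v. pullback (homothety t) (pullback g \<omega>) v = c *s pullback g \<omega> v))))"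

definition orbit_forms :: "(complex^3 \<Rightarrow> complex^3) \<Rightarrow> (complex^3 \<Rightarrow> complex^3) set"
  where "orbit_forms \<omega> = {\<lambda>v. c *s pullback g \<omega> v |c g. c \<noteq> 0 \<and> invertible g}"

text \<open>
  All defining forms of the foliations of degree \<^term>\<open>d\<close> in the closure of the orbit.
  The closure is taken for the topology of pointwise convergence, which on the
  finite-dimensional space of triples of homogeneous polynomials of degree \<open>d + 1\<close> is the usual
  topology of the coefficient space.  As the projection from the non-zero forms onto the
  projective space of forms is open, a foliation lies in the closure of the orbit iff its
  defining forms lie in the closure of the cone \<^const>\<open>orbit_forms\<close> over the orbit.
\<close>

definition orbit_closure :: "nat \<Rightarrow> (complex^3 \<Rightarrow> complex^3) \<Rightarrow> (complex^3 \<Rightarrow> complex^3) set"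
  where "orbit_closure d \<omega> = closure (orbit_forms \<omega>) \<inter> {\<zeta>. foliation_form d \<zeta>}"

definition holomorphic2_on :: "(complex \<times> complex \<Rightarrow> complex) \<Rightarrow> (complex \<times> complex) set \<Rightarrow> bool"
  where "holomorphic2_on f U \<longleftrightarrow>
     (\<forall>z\<in>U. \<exists>a b. (f has_derivative (\<lambda>h. a * fst h + b * snd h)) (at z))"

text \<open>
  Elements of the local ring at \<^term>\<open>s\<close> are represented by functions that are holomorphic near
  \<^term>\<open>s\<close>; two such functions define the same germ if they agree near \<^term>\<open>s\<close>.
\<close>

definition germ_at :: "complex \<times> complex \<Rightarrow> (complex \<times> complex \<Rightarrow> complex) \<Rightarrow> bool"
  where "germ_at s f \<longleftrightarrow> (\<exists>U. open U \<and> s \<in> U \<and> holomorphic2_on f U)"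

definition local_ideal ::
    "complex \<times> complex \<Rightarrow> (complex \<times> complex \<Rightarrow> complex) \<Rightarrow> (complex \<times> complex \<Rightarrow> complex)
       \<Rightarrow> (complex \<times> complex \<Rightarrow> complex) set"
  where "local_ideal s f g = {h. germ_at s h \<and>
     (\<exists>a b. germ_at s a \<and> germ_at s b \<and> (\<forall>\<^sub>F z in nhds s. h z = a z * f z + b z * g z))}"

text \<open>
  The dimension of the local ring at \<^term>\<open>s\<close> modulo the ideal generated by \<^term>\<open>f\<close> and
  \<^term>\<open>g\<close>: the supremum of the sizes of the families that are linearly independent in the
  quotient.
\<close>

definition local_codim ::
    "complex \<times> complex \<Rightarrow> (complex \<times> complex \<Rightarrow> complex) \<Rightarrow> (complex \<times> complex \<Rightarrow> complex) \<Rightarrow> enat"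
  where "local_codim s f g = Sup {enat n |n. \<exists>e. (\<forall>i<n. germ_at s (e i)) \<and>
     (\<forall>c. (\<lambda>z. \<Sum>i<n. c i * e i z) \<in> local_ideal s f g \<longrightarrow> (\<forall>i<n. c i = 0))}"

text \<open>
  Homogeneous coordinates in which \<^term>\<open>s\<close> becomes \<open>[0:0:1]\<close>, the origin of the chart
  \<open>z = 1\<close>.  The invariants below do not depend on this choice.
\<close>

definition chart_at :: "complex^3 \<Rightarrow> complex^3^3"
  where "chart_at s = (SOME g. invertible g \<and> g *v axis 3 1 = s)"

text \<open>The coefficients of the affine form \<open>A dx + B dy\<close> in the chart \<open>z = 1\<close>.\<close>

definition affA :: "(complex^3 \<Rightarrow> complex^3) \<Rightarrow> complex \<times> complex \<Rightarrow> complex"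
  where "affA \<omega> z = \<omega> (vector [fst z, snd z, 1]) $ 1"

definition affB :: "(complex^3 \<Rightarrow> complex^3) \<Rightarrow> complex \<times> complex \<Rightarrow> complex"
  where "affB \<omega> z = \<omega> (vector [fst z, snd z, 1]) $ 2"

text \<open>The vector field \<open>B \<partial>x - A \<partial>y\<close>, which spans the kernel of \<open>A dx + B dy\<close>.\<close>

definition vfield :: "(complex^3 \<Rightarrow> complex^3) \<Rightarrow> complex \<times> complex \<Rightarrow> complex \<times> complex"
  where "vfield \<omega> z = (affB \<omega> z, - affA \<omega> z)"

definition milnor :: "(complex^3 \<Rightarrow> complex^3) \<Rightarrow> complex^3 \<Rightarrow> enat"
  where "milnor \<omega> s = (let X = vfield (pullback (chart_at s) \<omega>)
     in local_codim (0, 0) (\<lambda>z. fst (X z)) (\<lambda>z. snd (X z)))"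

definition nondegenerate_sing :: "(complex^3 \<Rightarrow> complex^3) \<Rightarrow> complex^3 \<Rightarrow> bool"
  where "nondegenerate_sing \<omega> s \<longleftrightarrow> milnor \<omega> s = 1"

definition linear_part :: "(complex^3 \<Rightarrow> complex^3) \<Rightarrow> complex^3 \<Rightarrow> complex \<times> complex \<Rightarrow> complex \<times> complex"
  where "linear_part \<omega> s = frechet_derivative (vfield (pullback (chart_at s) \<omega>)) (at (0, 0))"

text \<open>
  For \<^term>\<open>s\<close> on the line given by \<^term>\<open>l\<close>, the conormal form of the line in the chart at
  \<^term>\<open>s\<close>; its kernel is the tangent direction of the line.
\<close>

definition conormal :: "complex^3 \<Rightarrow> complex^3 \<Rightarrow> complex \<times> complex \<Rightarrow> complex"
  where "conormal l s w = dot l (chart_at s *v vector [fst w, snd w, 0])"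

definition tangent_eigenvalue :: "(complex^3 \<Rightarrow> complex^3) \<Rightarrow> complex^3 \<Rightarrow> complex^3 \<Rightarrow> complex"
  where "tangent_eigenvalue \<omega> l s = (THE \<alpha>. \<forall>w. conormal l s w = 0
     \<longrightarrow> linear_part \<omega> s w = (\<alpha> * fst w, \<alpha> * snd w))"

definition normal_eigenvalue :: "(complex^3 \<Rightarrow> complex^3) \<Rightarrow> complex^3 \<Rightarrow> complex^3 \<Rightarrow> complex"
  where "normal_eigenvalue \<omega> l s = (THE \<beta>. \<forall>w.
     conormal l s (linear_part \<omega> s w) = \<beta> * conormal l s w)"

definition camacho_sad :: "(complex^3 \<Rightarrow> complex^3) \<Rightarrow> complex^3 \<Rightarrow> complex^3 \<Rightarrow> complex"
  where "camacho_sad \<omega> l s = normal_eigenvalue \<omega> l s / tangent_eigenvalue \<omega> l s"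

text \<open>
  In coordinates \<open>(u, v)\<close>, a 1-form \<open>a du + b dv\<close> is encoded by \<open>(a, b)\<close>, and a 2-form
  by its coefficient with respect to \<open>du \<and> dv\<close>.
\<close>

type_synonym form1 = "complex \<times> complex \<Rightarrow> complex \<times> complex"

definition wedge :: "complex \<times> complex \<Rightarrow> complex \<times> complex \<Rightarrow> complex"
  where "wedge \<alpha> \<beta> = fst \<alpha> * snd \<beta> - snd \<alpha> * fst \<beta>"

definition fscale :: "(complex \<times> complex \<Rightarrow> complex) \<Rightarrow> form1 \<Rightarrow> form1"
  where "fscale f \<theta> z = (f z * fst (\<theta> z), f z * snd (\<theta> z))"

definition ext_deriv :: "form1 \<Rightarrow> complex \<times> complex \<Rightarrow> complex"
  where "ext_deriv \<theta> z =
     deriv (\<lambda>u. snd (\<theta> (u, snd z))) (fst z) - deriv (\<lambda>v. fst (\<theta> (fst z, v))) (snd z)"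

definition wdelta :: "form1 \<Rightarrow> form1 \<Rightarrow> complex \<times> complex \<Rightarrow> complex"
  where "wdelta \<theta> \<theta>' z = wedge (\<theta> z) (\<theta>' z)"

text \<open>
  The three forms below add up to zero, and any two of them are independent where the three
  foliations are pairwise transverse; there the covector \<open>w\<close> exists and is unique.
\<close>

definition web_eta :: "form1 \<Rightarrow> form1 \<Rightarrow> form1 \<Rightarrow> form1"
  where "web_eta \<theta>r \<theta>s \<theta>t z = (THE w.
     ext_deriv (fscale (wdelta \<theta>s \<theta>t) \<theta>r) z = wedge w (fscale (wdelta \<theta>s \<theta>t) \<theta>r z) \<and>
     ext_deriv (fscale (wdelta \<theta>t \<theta>r) \<theta>s) z = wedge w (fscale (wdelta \<theta>t \<theta>r) \<theta>s z) \<and>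
     ext_deriv (fscale (wdelta \<theta>r \<theta>s) \<theta>t) z = wedge w (fscale (wdelta \<theta>r \<theta>s) \<theta>t z))"

definition web_curvature :: "nat \<Rightarrow> (nat \<Rightarrow> form1) \<Rightarrow> complex \<times> complex \<Rightarrow> complex"
  where "web_curvature k \<theta> = ext_deriv (\<lambda>z.
     \<Sum>(r, s, t) \<in> {(r, s, t). r < s \<and> s < t \<and> t < k}. web_eta (\<theta> r) (\<theta> s) (\<theta> t) z)"

text \<open>
  A \<open>k\<close>-symmetric form \<^term>\<open>S\<close> is given by its values \<open>S z \<xi>\<close> at a point \<open>z\<close> on a tangent
  vector \<open>\<xi>\<close>.  A splitting over an open set \<^term>\<open>U\<close> exhibits the web defined by \<^term>\<open>S\<close> there as
  a superposition of \<open>k\<close> foliations which are pairwise transverse; such an open set is disjoint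
  from the discriminant, and each point off the discriminant has a neighbourhood with a splitting.
\<close>

definition web_splitting ::
    "nat \<Rightarrow> (complex \<times> complex \<Rightarrow> complex \<times> complex \<Rightarrow> complex) \<Rightarrow> (complex \<times> complex) set
       \<Rightarrow> (nat \<Rightarrow> form1) \<Rightarrow> bool"
  where "web_splitting k S U \<theta> \<longleftrightarrow> open U \<and>
     (\<forall>i<k. holomorphic2_on (\<lambda>z. fst (\<theta> i z)) U \<and> holomorphic2_on (\<lambda>z. snd (\<theta> i z)) U) \<and>
     (\<forall>z\<in>U. \<forall>i<k. \<forall>j<k. i \<noteq> j \<longrightarrow> wdelta (\<theta> i) (\<theta> j) z \<noteq> 0) \<and>
     (\<forall>z\<in>U. \<forall>\<xi>. S z \<xi> = (\<Prod>i<k. fst (\<theta> i z) * fst \<xi> + snd (\<theta> i z) * snd \<xi>))"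

text \<open>
  The poles of the curvature lie in the discriminant, so it vanishes identically iff it vanishes
  off the discriminant.
\<close>

definition flat_web :: "nat \<Rightarrow> (complex \<times> complex \<Rightarrow> complex \<times> complex \<Rightarrow> complex) \<Rightarrow> bool"
  where "flat_web k S \<longleftrightarrow>
     (\<forall>U \<theta>. web_splitting k S U \<theta> \<longrightarrow> (\<forall>z\<in>U. web_curvature k \<theta> z = 0))"

text \<open>
  The Legendre transform in the dual chart \<open>(p, q)\<close> of lines \<open>y = p x - q\<close>: the polynomial
  \<open>A(x, p x - q) + p B(x, p x - q)\<close> in \<open>x\<close>, which has degree at most \<^term>\<open>d\<close>, turned into a
  \<open>d\<close>-symmetric form by substituting \<open>x = dq / dp\<close> and multiplying by the \<open>d\<close>-th power of \<open>dp\<close>.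
\<close>

definition legendre_poly :: "(complex^3 \<Rightarrow> complex^3) \<Rightarrow> complex \<Rightarrow> complex \<Rightarrow> complex poly"
  where "legendre_poly \<omega> p q = (THE P. \<forall>x.
     poly P x = affA \<omega> (x, p * x - q) + p * affB \<omega> (x, p * x - q))"

definition legendre ::
    "nat \<Rightarrow> (complex^3 \<Rightarrow> complex^3) \<Rightarrow> complex \<times> complex \<Rightarrow> complex \<times> complex \<Rightarrow> complex"
  where "legendre d \<omega> z \<xi> =
     (\<Sum>j\<le>d. coeff (legendre_poly \<omega> (fst z) (snd z)) j * fst \<xi> ^ (d - j) * snd \<xi> ^ j)"

text \<open>
  The Legendre transform is a web on the whole dual plane, which is covered by the charts
  \<open>(p, q)\<close> attached to the various systems of homogeneous coordinates.
\<close>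

definition flat_legendre :: "nat \<Rightarrow> (complex^3 \<Rightarrow> complex^3) \<Rightarrow> bool"
  where "flat_legendre d \<omega> \<longleftrightarrow> (\<forall>g. invertible g \<longrightarrow> flat_web d (legendre d (pullback g \<omega>)))"

end

theory Submission
  imports Defs "HOL-Complex_Analysis.Cauchy_Integral_Formula"
    "HOL-Computational_Algebra.Fundamental_Theorem_Algebra"
begin

text \<open>
  In coordinates in which the invariant line \<open>L\<close> is \<open>z = 0\<close>, let \<open>\<omega>\<close> define \<open>F\<close> and let
  \<open>D e = diag (1, 1, e)\<close>.  The pull-back of \<open>\<omega>\<close> by \<open>D e\<close> is a polynomial
  \<open>\<Sum>k. e\<^sup>k G\<^sub>k\<close> in \<open>e\<close>, where \<open>G\<^sub>k\<close> collects the terms of weight \<open>k\<close>.  Invariance of \<open>L\<close>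
  says that \<open>D 0\<close> pulls \<open>\<omega>\<close> back to zero, that is \<open>G\<^sub>0 = 0\<close>.  After division by \<open>e\<close> the
  pull-backs therefore tend to \<open>G\<^sub>1\<close> as \<open>e \<rightarrow> 0\<close>, and \<open>H = G\<^sub>1\<close> is the required foliation: it
  lies in the closure of the orbit, and having a pure weight it is invariant under homotheties
  (\<open>degeneration_normalised\<close>, \<open>pullback_fweight_scaled\<close>).

  The terms of weight at least two are so small along \<open>L\<close> that \<open>\<omega> - H\<close> equals \<open>\<kappa> z dz\<close> up to
  second order in \<open>z\<close>.  At a point of \<open>L\<close> this changes the linear part of the vector field only by
  a map that kills the tangent direction of \<open>L\<close> and takes its values in it.  So \<open>F\<close> and \<open>H\<close> have the
  same singular points on \<open>L\<close>, and there the same tangent and normal eigenvalues and the same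
  determinant of the linear part (\<open>conormal_contact_same_invariants\<close>).  That the Milnor number
  is one exactly when this determinant is non-zero is \<open>local_codim_eq_1_iff\<close>; it rests on the
  division of a germ vanishing at the origin by the two coordinates (\<open>hadamard_division\<close>).

  Because \<open>H\<close> has pure weight, a zero of \<open>H\<close> off \<open>L\<close> and outside the axis \<open>x = y = 0\<close> produces a
  whole line of zeros through a point of \<open>L\<close>, and a line \<open>L\<close> consisting of zeros does the same;
  both contradict non-degeneracy.  Hence the zeros of \<open>H\<close> have codimension two and \<open>H\<close> has no
  common factor (\<open>constant_of_small_zero_set\<close>).

  For flatness, the Legendre transform is linear in the form, so the coefficients of the webs
  in the degenerating family depend polynomially on the parameter.  Near a point off the
  discriminant of the limit web, the factors of the limit web are simple roots of a polynomial; they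
  persist for small values of the parameter, holomorphic in the point and continuous in the
  parameter (\<open>simple_roots_holo_family\<close>).  By Cauchy's formula all derivatives in the point are
  then continuous in the parameter as well (\<open>holo_family_partial1\<close>), hence so is the curvature.  It
  vanishes for non-zero parameters, therefore also in the limit (\<open>flat_web_limit\<close>).
\<close>

section \<open>Holomorphic functions of two variables\<close>

text \<open>
  Cauchy's formula with the circle parametrised explicitly, so that continuity and
  differentiability in parameters can be read off from theorems on integrals over intervals.
\<close>

lemma Cauchy_deriv_as_integral:
  assumes "f holomorphic_on W" "cball c r \<subseteq> W" "u \<in> ball c r"
  shows "deriv f u = 1 / (2 * of_real pi * \<i>) * integral (cbox 0 1)
    (\<lambda>x::real. f (c + r * exp (2 * of_real pi * \<i> * x)) / (c + r * exp (2 * of_real pi * \<i> * x) - u)^2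
        * (2 * pi * \<i> * r * exp (2 * of_real pi * \<i> * x)))"
proof -
  have "f holomorphic_on cball c r"
    using assms holomorphic_on_subset by blast
  then have "continuous_on (cball c r) f" "f holomorphic_on ball c r"
    using holomorphic_on_imp_continuous_on holomorphic_on_subset ball_subset_cball by blast+
  from Cauchy_derivative_integral_circlepath(2)[OF this assms(3)]
  have "deriv f u = 1 / (2 * of_real pi * \<i>) * contour_integral (circlepath c r) (\<lambda>x. f x / (x - u)\<^sup>2)"
    by (rule DERIV_imp_deriv)
  then show ?thesis
    unfolding contour_integral_integral vector_derivative_circlepath
    by (simp add: circlepath)
qed

lemma circle_in_cball:
  fixes c :: complex
  assumes "0 \<le> r"
  shows "c + r * exp (2 * of_real pi * \<i> * of_real x) \<in> cball c r"
proof -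
  have "norm (r * exp (\<i> * of_real (2 * pi * x))) = r"
    using assms by (simp only: norm_mult norm_exp_i_times) simp
  then show ?thesis
    by (simp add: dist_norm algebra_simps)
qed

lemma circle_avoids_ball:
  fixes c u :: complex
  assumes "u \<in> ball c r" "0 < r"
  shows "c + r * exp (2 * of_real pi * \<i> * of_real x) - u \<noteq> 0"
proof
  assume "c + r * exp (2 * of_real pi * \<i> * of_real x) - u = 0"
  then have "u - c = r * exp (\<i> * of_real (2 * pi * x))"
    by (simp add: algebra_simps)
  then have "norm (u - c) = r"
    using assms(2) by (simp only: norm_mult norm_exp_i_times) simp
  with assms show False
    by (simp add: dist_norm norm_minus_commute)
qed

text \<open>
  In Cauchy's formula the variable and the parameter occur only in the integrand, which is jointly
  continuous on a fixed circle.
\<close>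

lemma continuous_on_deriv_param:
  fixes f :: "'a::t2_space \<Rightarrow> complex \<Rightarrow> complex"
  assumes cont: "continuous_on (T \<times> W) (\<lambda>(t, u). f t u)" and "open W"
    and hol: "\<And>t. t \<in> T \<Longrightarrow> f t holomorphic_on W"
  shows "continuous_on (T \<times> W) (\<lambda>(t, u). deriv (f t) u)"
  unfolding continuous_on_eq_continuous_within
proof clarify
  fix t0 c assume t0: "t0 \<in> T" and c: "c \<in> W"
  obtain r where r: "r > 0" "cball c r \<subseteq> W"
    using \<open>open W\<close> c open_contains_cball by blast
  define \<gamma> where "\<gamma> x = c + r * exp (2 * of_real pi * \<i> * of_real x)" for x :: real
  have \<gamma>W: "\<gamma> x \<in> W" for x
    using r circle_in_cball[of r c x] by (auto simp: \<gamma>_def)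
  have ne: "\<gamma> x \<notin> ball c r" for x
    using circle_avoids_ball[OF _ r(1), of "\<gamma> x" c x] by (auto simp: \<gamma>_def)
  have cf: "continuous_on A (\<lambda>p. f (a p) (b p))"
    if "continuous_on A a" "continuous_on A b" "\<And>p. p \<in> A \<Longrightarrow> a p \<in> T" "\<And>p. p \<in> A \<Longrightarrow> b p \<in> W"
    for A :: "(('a \<times> complex) \<times> real) set" and a b
    using continuous_on_compose2[OF cont continuous_on_Pair[OF that(1,2)]] that(3,4)
    by (simp add: image_subset_iff)
  have "continuous_on (T \<times> ball c r) (\<lambda>p. integral (cbox 0 1)
      (\<lambda>x. f (fst p) (\<gamma> x) / (\<gamma> x - snd p)^2 * (2 * pi * \<i> * r * exp (2 * of_real pi * \<i> * x))))"
    by (rule integral_continuous_on_param)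
      (auto simp: split_beta \<gamma>W ne[simplified] intro!: continuous_intros cf, auto simp: \<gamma>_def intro!: continuous_intros)
  then have "continuous_on (T \<times> ball c r) (\<lambda>p. 1 / (2 * of_real pi * \<i>) * integral (cbox 0 1)
      (\<lambda>x. f (fst p) (\<gamma> x) / (\<gamma> x - snd p)^2 * (2 * pi * \<i> * r * exp (2 * of_real pi * \<i> * x))))"
    by (intro continuous_intros)
  then have "continuous_on (T \<times> ball c r) (\<lambda>(t, u). deriv (f t) u)"
    by (rule continuous_on_eq)
      (use Cauchy_deriv_as_integral[OF hol r(2)] in \<open>auto simp: \<gamma>_def\<close>)
  then have "continuous (at (t0, c) within T \<times> ball c r) (\<lambda>(t, u). deriv (f t) u)"
    using t0 r(1) by (simp add: continuous_on_eq_continuous_within)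
  moreover have "at (t0, c) within T \<times> ball c r = at (t0, c) within T \<times> W"
    by (rule at_within_nhd[where S = "UNIV \<times> ball c r"])
      (use r in \<open>auto intro!: open_Times\<close>)
  ultimately show "continuous (at (t0, c) within T \<times> W) (\<lambda>(t, u). deriv (f t) u)"
    by simp
qed

lemma holomorphic2_on_subset: "holomorphic2_on f U \<Longrightarrow> V \<subseteq> U \<Longrightarrow> holomorphic2_on f V"
  by (auto simp: holomorphic2_on_def)

lemma holomorphic2_on_cong:
  assumes "open U" "\<And>z. z \<in> U \<Longrightarrow> f z = g z" "holomorphic2_on f U"
  shows "holomorphic2_on g U"
  unfolding holomorphic2_on_def
proof
  fix z assume z: "z \<in> U"
  then obtain a b where "(f has_derivative (\<lambda>h. a * fst h + b * snd h)) (at z)"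
    using assms(3) unfolding holomorphic2_on_def by blast
  from has_derivative_transform_within_open[OF this assms(1) z assms(2)]
  show "\<exists>a b. (g has_derivative (\<lambda>h. a * fst h + b * snd h)) (at z)"
    by blast
qed

lemma holomorphic2_on_imp_continuous_on: "holomorphic2_on f U \<Longrightarrow> continuous_on U f"
  unfolding holomorphic2_on_def
  by (meson continuous_at_imp_continuous_on has_derivative_continuous)

lemma holomorphic2_on_slice1:
  assumes "holomorphic2_on f U" "\<And>u. u \<in> A \<Longrightarrow> (u, v) \<in> U"
  shows "(\<lambda>u. f (u, v)) holomorphic_on A"
  unfolding holomorphic_on_def
proof
  fix u assume "u \<in> A"
  then obtain a b where der: "(f has_derivative (\<lambda>h. a * fst h + b * snd h)) (at (u, v))"
    using assms unfolding holomorphic2_on_def by blast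
  have pair: "((\<lambda>u. (u, v)) has_derivative (\<lambda>h. (h, 0))) (at u within A)"
    by (auto intro!: derivative_eq_intros)
  have "((\<lambda>u. f (u, v)) has_derivative (\<lambda>h. a * h)) (at u within A)"
    using has_derivative_compose[OF pair der] by simp
  then show "(\<lambda>u. f (u, v)) field_differentiable (at u within A)"
    unfolding field_differentiable_def has_field_derivative_def by blast
qed

lemma holomorphic2_on_slice2:
  assumes "holomorphic2_on f U" "\<And>v. v \<in> A \<Longrightarrow> (u, v) \<in> U"
  shows "(\<lambda>v. f (u, v)) holomorphic_on A"
  unfolding holomorphic_on_def
proof
  fix v assume "v \<in> A"
  then obtain a b where der: "(f has_derivative (\<lambda>h. a * fst h + b * snd h)) (at (u, v))"
    using assms unfolding holomorphic2_on_def by blast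
  have pair: "((\<lambda>v. (u, v)) has_derivative (\<lambda>h. (0, h))) (at v within A)"
    by (auto intro!: derivative_eq_intros)
  have "((\<lambda>v. f (u, v)) has_derivative (\<lambda>h. b * h)) (at v within A)"
    using has_derivative_compose[OF pair der] by simp
  then show "(\<lambda>v. f (u, v)) field_differentiable (at v within A)"
    unfolding field_differentiable_def has_field_derivative_def by blast
qed

text \<open>
  Osgood's lemma.  By Cauchy's formula the partial derivative in the second variable is jointly
  continuous, and this is enough for total differentiability.
\<close>

lemma osgood_polydisc:
  assumes "open A" "open B" "convex B" and cont: "continuous_on (A \<times> B) f"
    and h1: "\<And>v. v \<in> B \<Longrightarrow> (\<lambda>u. f (u, v)) holomorphic_on A"
    and h2: "\<And>u. u \<in> A \<Longrightarrow> (\<lambda>v. f (u, v)) holomorphic_on B"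
  shows "holomorphic2_on f (A \<times> B)"
  unfolding holomorphic2_on_def
proof clarify
  fix u v assume uv: "u \<in> A" "v \<in> B"
  define D where "D u v = deriv (\<lambda>v. f (u, v)) v" for u v
  have "continuous_on (A \<times> B) (\<lambda>(u, v). D u v)"
    unfolding D_def using cont \<open>open B\<close> h2 by (intro continuous_on_deriv_param) (auto simp: split_beta)
  then have "continuous_on (A \<times> B) (\<lambda>(u, v). blinfun_mult_right (D u v))"
    by (auto simp: split_beta intro!: continuous_intros bounded_linear.continuous_on[OF bounded_linear_blinfun_mult_right])
  then have 1: "continuous (at (u, v) within A \<times> B) (\<lambda>(u, v). blinfun_mult_right (D u v))"
    using uv by (simp add: continuous_on_eq_continuous_within)
  have 2: "((\<lambda>u. f (u, v)) has_derivative (\<lambda>h. deriv (\<lambda>u. f (u, v)) u * h)) (at u within A)"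
    using holomorphic_derivI[OF h1[OF uv(2)] \<open>open A\<close> uv(1)]
    by (simp add: has_field_derivative_def has_derivative_at_withinI)
  have 3: "((\<lambda>y. f (x, y)) has_derivative blinfun_apply (blinfun_mult_right (D x y))) (at y within B)"
    if "x \<in> A" "y \<in> B" for x y
    using holomorphic_derivI[OF h2[OF that(1)] \<open>open B\<close> that(2)]
    by (simp add: D_def has_field_derivative_def has_derivative_at_withinI)
  have "((\<lambda>(x, y). f (x, y)) has_derivative
     (\<lambda>(tx, ty). deriv (\<lambda>u. f (u, v)) u * tx + blinfun_mult_right (D u v) ty)) (at (u, v) within A \<times> B)"
    by (rule has_derivative_partialsI[OF 2 3 1 uv(2) \<open>convex B\<close>])
  moreover have "at (u, v) within A \<times> B = at (u, v)"
    using uv assms by (intro at_within_open) (auto intro: open_Times)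
  ultimately have "(f has_derivative (\<lambda>h. deriv (\<lambda>u. f (u, v)) u * fst h + D u v * snd h)) (at (u, v))"
    by (simp add: case_prod_unfold)
  then show "\<exists>a b. (f has_derivative (\<lambda>h. a * fst h + b * snd h)) (at (u, v))"
    by blast
qed

lemma open_contains_polydisc:
  fixes U :: "(complex \<times> complex) set"
  assumes "open U" "(u, v) \<in> U"
  obtains r where "r > 0" "cball u r \<times> cball v r \<subseteq> U"
proof -
  obtain A B where AB: "open A" "open B" "(u, v) \<in> A \<times> B" "A \<times> B \<subseteq> U"
    using open_prod_elim[OF assms] by blast
  obtain r1 r2 where "r1 > 0" "cball u r1 \<subseteq> A" "r2 > 0" "cball v r2 \<subseteq> B"
    using AB open_contains_cball by (metis mem_Sigma_iff)
  then show ?thesis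
    using AB by (intro that[of "min r1 r2"]) (auto simp: subset_iff)
qed

lemma holomorphic2_on_local:
  assumes "\<And>z. z \<in> U \<Longrightarrow> \<exists>V. z \<in> V \<and> holomorphic2_on f V"
  shows "holomorphic2_on f U"
  using assms unfolding holomorphic2_on_def by blast

text \<open>
  Leibniz' rule; the continuity of the derivative that it asks for is \<open>continuous_on_deriv_param\<close>.
\<close>

lemma holomorphic_on_integral_param:
  fixes K :: "real \<Rightarrow> complex \<Rightarrow> complex"
  assumes S: "open S" "convex S" and cont: "continuous_on ({0..1} \<times> S) (\<lambda>(t, u). K t u)"
    and hol: "\<And>t. t \<in> {0..1} \<Longrightarrow> K t holomorphic_on S"
  shows "(\<lambda>u. integral (cbox 0 1) (\<lambda>t. K t u)) holomorphic_on S"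
proof (rule leibniz_rule_holomorphic[where fx = "\<lambda>u t. deriv (K t) u"])
  fix x :: complex and t :: real assume "x \<in> S" "t \<in> cbox 0 1"
  then show "((\<lambda>u. K t u) has_field_derivative deriv (K t) x) (at x within S)"
    using holomorphic_derivI[OF hol S(1)] has_field_derivative_at_within by auto
next
  fix x assume "x \<in> S"
  then show "(\<lambda>t. K t x) integrable_on cbox 0 1"
    using continuous_on_compose2[OF cont continuous_on_Pair[OF continuous_on_id continuous_on_const[of _ x]]]
    by (intro integrable_continuous) (simp add: image_subset_iff)
next
  show "continuous_on (S \<times> cbox 0 1) (\<lambda>(x, t). deriv (K t) x)"
    using continuous_on_swap_args[OF continuous_on_deriv_param[OF cont S(1) hol]] by simp
qed (rule S)

text \<open>
  The integral is continuous and holomorphic in each variable separately, so Osgood's lemma applies.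
\<close>

lemma holomorphic2_on_integral:
  fixes G :: "real \<Rightarrow> complex \<times> complex \<Rightarrow> complex"
  assumes "open U" and cont: "continuous_on (U \<times> {0..1}) (\<lambda>(z, t). G t z)"
    and hol: "\<And>t. t \<in> {0..1} \<Longrightarrow> holomorphic2_on (G t) U"
  shows "holomorphic2_on (\<lambda>z. integral {0..1} (\<lambda>t. G t z)) U"
proof (rule holomorphic2_on_local)
  fix z assume "z \<in> U"
  obtain u v where z: "z = (u, v)" by fastforce
  obtain r where r: "r > 0" "cball u r \<times> cball v r \<subseteq> U"
    using open_contains_polydisc \<open>open U\<close> \<open>z \<in> U\<close> z by blast
  define A B where "A = ball u r" and "B = ball v r"
  have AB: "open A" "open B" "convex A" "convex B" "A \<times> B \<subseteq> U"
    using r ball_subset_cball by (auto simp: A_def B_def)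
  have cG: "continuous_on S (\<lambda>p. G (a p) (b p))"
    if "continuous_on S a" "continuous_on S b" "\<And>p. p \<in> S \<Longrightarrow> a p \<in> {0..1}" "\<And>p. p \<in> S \<Longrightarrow> b p \<in> U"
    for S :: "'b::topological_space set" and a b
    using continuous_on_compose2[OF cont continuous_on_Pair[OF that(2,1)]] that(3,4) by fastforce
  have h1: "(\<lambda>u. integral (cbox 0 1) (\<lambda>t. G t (u, v))) holomorphic_on A" if "v \<in> B" for v
    using AB that by (intro holomorphic_on_integral_param holomorphic2_on_slice1[OF hol])
      (auto simp: split_beta intro!: cG continuous_intros)
  have h2: "(\<lambda>v. integral (cbox 0 1) (\<lambda>t. G t (u, v))) holomorphic_on B" if "u \<in> A" for u
    using AB that by (intro holomorphic_on_integral_param holomorphic2_on_slice2[OF hol])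
      (auto simp: split_beta intro!: cG continuous_intros)
  have "continuous_on (A \<times> B) (\<lambda>z. integral (cbox 0 1) (\<lambda>t. G t z))"
    using AB by (intro integral_continuous_on_param continuous_on_subset[OF cont]) auto
  then have "holomorphic2_on (\<lambda>z. integral (cbox 0 1) (\<lambda>t. G t z)) (A \<times> B)"
    using AB h1 h2 by (intro osgood_polydisc) auto
  moreover have "z \<in> A \<times> B"
    using r by (auto simp: z A_def B_def)
  ultimately show "\<exists>V. z \<in> V \<and> holomorphic2_on (\<lambda>z. integral {0..1} (\<lambda>t. G t z)) V"
    by auto
qed

lemma holomorphic2_on_compose_affine:
  assumes "holomorphic2_on f U"
  shows "holomorphic2_on (\<lambda>z. f (p + a * fst z + b * snd z, q + c * fst z + d * snd z))
    {z. (p + a * fst z + b * snd z, q + c * fst z + d * snd z) \<in> U}"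
  unfolding holomorphic2_on_def
proof
  fix z assume "z \<in> {z. (p + a * fst z + b * snd z, q + c * fst z + d * snd z) \<in> U}"
  then obtain x y where der: "(f has_derivative (\<lambda>h. x * fst h + y * snd h))
      (at (p + a * fst z + b * snd z, q + c * fst z + d * snd z))"
    using assms unfolding holomorphic2_on_def by blast
  have "((\<lambda>z. (p + a * fst z + b * snd z, q + c * fst z + d * snd z)) has_derivative
      (\<lambda>h. (a * fst h + b * snd h, c * fst h + d * snd h))) (at z)"
    by (auto intro!: derivative_eq_intros)
  from has_derivative_compose[OF this der]
  have "((\<lambda>z. f (p + a * fst z + b * snd z, q + c * fst z + d * snd z)) has_derivative
      (\<lambda>h. (x * a + y * c) * fst h + (x * b + y * d) * snd h)) (at z)"
    by (simp add: algebra_simps)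
  then show "\<exists>x y. ((\<lambda>z. f (p + a * fst z + b * snd z, q + c * fst z + d * snd z)) has_derivative
      (\<lambda>h. x * fst h + y * snd h)) (at z)"
    by blast
qed

lemma holomorphic2_on_swap:
  "holomorphic2_on f U \<Longrightarrow> holomorphic2_on (\<lambda>z. f (snd z, fst z)) {z. (snd z, fst z) \<in> U}"
  using holomorphic2_on_compose_affine[of f U 0 0 1 0 1 0] by simp

lemma holomorphic2_on_const: "holomorphic2_on (\<lambda>z. c) U"
proof -
  have "((\<lambda>z. c) has_derivative (\<lambda>h. 0 * fst h + 0 * snd h)) (at z)" for z :: "complex \<times> complex"
    by simp
  then show ?thesis
    unfolding holomorphic2_on_def by blast
qed

lemma holomorphic2_on_fst: "holomorphic2_on fst U"
proof -
  have "(fst has_derivative (\<lambda>h. 1 * fst h + 0 * snd h)) (at z)" for z :: "complex \<times> complex"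
    by (auto intro!: derivative_eq_intros)
  then show ?thesis
    unfolding holomorphic2_on_def by blast
qed

lemma holomorphic2_on_snd: "holomorphic2_on snd U"
proof -
  have "(snd has_derivative (\<lambda>h. 0 * fst h + 1 * snd h)) (at z)" for z :: "complex \<times> complex"
    by (auto intro!: derivative_eq_intros)
  then show ?thesis
    unfolding holomorphic2_on_def by blast
qed

lemma holomorphic2_on_add:
  assumes "holomorphic2_on f U" "holomorphic2_on g U"
  shows "holomorphic2_on (\<lambda>z. f z + g z) U"
  unfolding holomorphic2_on_def
proof
  fix z assume "z \<in> U"
  then obtain a b c d where
    "(f has_derivative (\<lambda>h. a * fst h + b * snd h)) (at z)"
    "(g has_derivative (\<lambda>h. c * fst h + d * snd h)) (at z)"
    using assms unfolding holomorphic2_on_def by blast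
  from has_derivative_add[OF this]
  have "((\<lambda>z. f z + g z) has_derivative (\<lambda>h. (a + c) * fst h + (b + d) * snd h)) (at z)"
    by (simp add: algebra_simps)
  then show "\<exists>a b. ((\<lambda>z. f z + g z) has_derivative (\<lambda>h. a * fst h + b * snd h)) (at z)"
    by blast
qed

lemma holomorphic2_on_mult:
  assumes "holomorphic2_on f U" "holomorphic2_on g U"
  shows "holomorphic2_on (\<lambda>z. f z * g z) U"
  unfolding holomorphic2_on_def
proof
  fix z assume "z \<in> U"
  then obtain a b c d where
    "(f has_derivative (\<lambda>h. a * fst h + b * snd h)) (at z)"
    "(g has_derivative (\<lambda>h. c * fst h + d * snd h)) (at z)"
    using assms unfolding holomorphic2_on_def by blast
  from has_derivative_mult[OF this]
  have "((\<lambda>z. f z * g z) has_derivative (\<lambda>h. (f z * c + a * g z) * fst h + (f z * d + b * g z) * snd h)) (at z)"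
    by (simp add: algebra_simps)
  then show "\<exists>a b. ((\<lambda>z. f z * g z) has_derivative (\<lambda>h. a * fst h + b * snd h)) (at z)"
    by blast
qed

lemma holomorphic2_on_inverse:
  assumes "holomorphic2_on f U" "\<And>z. z \<in> U \<Longrightarrow> f z \<noteq> 0"
  shows "holomorphic2_on (\<lambda>z. inverse (f z)) U"
  unfolding holomorphic2_on_def
proof
  fix z assume z: "z \<in> U"
  then obtain a b where "(f has_derivative (\<lambda>h. a * fst h + b * snd h)) (at z)"
    using assms unfolding holomorphic2_on_def by blast
  from Deriv.has_derivative_inverse[OF assms(2)[OF z] this]
  have "((\<lambda>z. inverse (f z)) has_derivative
      (\<lambda>h. (- (inverse (f z) * a * inverse (f z))) * fst h + (- (inverse (f z) * b * inverse (f z))) * snd h)) (at z)"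
    by (simp add: algebra_simps)
  then show "\<exists>a b. ((\<lambda>z. inverse (f z)) has_derivative (\<lambda>h. a * fst h + b * snd h)) (at z)"
    by blast
qed

lemma holomorphic2_on_uminus: "holomorphic2_on f U \<Longrightarrow> holomorphic2_on (\<lambda>z. - f z) U"
  using holomorphic2_on_mult[OF holomorphic2_on_const[of "-1"]] by simp

lemma holomorphic2_on_diff:
  "holomorphic2_on f U \<Longrightarrow> holomorphic2_on g U \<Longrightarrow> holomorphic2_on (\<lambda>z. f z - g z) U"
  using holomorphic2_on_add[OF _ holomorphic2_on_uminus] by simp

lemma holomorphic2_on_divide:
  "holomorphic2_on f U \<Longrightarrow> holomorphic2_on g U \<Longrightarrow> (\<And>z. z \<in> U \<Longrightarrow> g z \<noteq> 0) \<Longrightarrow>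
    holomorphic2_on (\<lambda>z. f z / g z) U"
  using holomorphic2_on_mult[OF _ holomorphic2_on_inverse] by (simp add: divide_inverse)

lemma holomorphic2_on_sum:
  "(\<And>i. i \<in> I \<Longrightarrow> holomorphic2_on (f i) U) \<Longrightarrow> holomorphic2_on (\<lambda>z. \<Sum>i\<in>I. f i z) U"
  by (induction I rule: infinite_finite_induct) (auto intro: holomorphic2_on_const holomorphic2_on_add)

lemma holomorphic2_on_power: "holomorphic2_on f U \<Longrightarrow> holomorphic2_on (\<lambda>z. f z ^ n) U"
  by (induction n) (auto intro: holomorphic2_on_const holomorphic2_on_mult)

lemmas holomorphic2_intros = holomorphic2_on_const holomorphic2_on_fst holomorphic2_on_snd
  holomorphic2_on_add holomorphic2_on_mult holomorphic2_on_uminus holomorphic2_on_diff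
  holomorphic2_on_divide holomorphic2_on_sum holomorphic2_on_power

lemma holomorphic2_on_compose_fst:
  assumes "f holomorphic_on A" "open A" "\<And>z. z \<in> U \<Longrightarrow> fst z \<in> A"
  shows "holomorphic2_on (\<lambda>z. f (fst z)) U"
  unfolding holomorphic2_on_def
proof
  fix z :: "complex \<times> complex" assume "z \<in> U"
  then have "(f has_field_derivative deriv f (fst z)) (at (fst z))"
    using assms holomorphic_derivI by blast
  then have "(f has_derivative (*) (deriv f (fst z))) (at (fst z))"
    by (simp add: has_field_derivative_def)
  moreover have "(fst has_derivative fst) (at z)"
    by (auto intro!: derivative_eq_intros)
  ultimately have "((\<lambda>z. f (fst z)) has_derivative (\<lambda>h. deriv f (fst z) * fst h + 0 * snd h)) (at z)"
    using has_derivative_compose by fastforce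
  then show "\<exists>a b. ((\<lambda>z. f (fst z)) has_derivative (\<lambda>h. a * fst h + b * snd h)) (at z)"
    by blast
qed

text \<open>
  Locally the partial derivative is a Cauchy integral whose integrand is holomorphic in both
  variables.
\<close>

lemma holomorphic2_on_partial1:
  assumes "open U" "holomorphic2_on f U"
  shows "holomorphic2_on (\<lambda>z. deriv (\<lambda>u. f (u, snd z)) (fst z)) U"
proof (rule holomorphic2_on_local)
  fix z assume "z \<in> U"
  obtain c d where z: "z = (c, d)" by fastforce
  obtain r where r: "r > 0" "cball c r \<times> cball d r \<subseteq> U"
    using open_contains_polydisc assms(1) \<open>z \<in> U\<close> z by blast
  define V where "V = ball c r \<times> ball d r"
  have V: "open V" "z \<in> V"
    using r(1) by (auto simp: V_def z open_Times)
  define \<gamma> where "\<gamma> x = c + r * exp (2 * of_real pi * \<i> * of_real x)" for x :: real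
  have \<gamma>c: "\<gamma> x \<in> cball c r" for x
    unfolding \<gamma>_def using r(1) by (intro circle_in_cball) simp
  have ne: "\<gamma> x \<notin> ball c r" for x
    using circle_avoids_ball[OF _ r(1), of "\<gamma> x" c x] by (auto simp: \<gamma>_def)
  have in_U: "(\<gamma> x, v) \<in> U" if "v \<in> ball d r" for x v
    using r(2) \<gamma>c[of x] that by auto
  define G where "G x z = f (\<gamma> x, snd z) / (\<gamma> x - fst z)^2 * (2 * pi * \<i> * r * exp (2 * of_real pi * \<i> * of_real x))"
    for x :: real and z
  have "holomorphic2_on (\<lambda>z. integral {0..1} (\<lambda>x. G x z)) V"
  proof (rule holomorphic2_on_integral[OF V(1)])
    show "continuous_on (V \<times> {0..1}) (\<lambda>(z, t). G t z)"
      unfolding G_def split_beta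
      by (intro continuous_intros continuous_on_compose2[OF holomorphic2_on_imp_continuous_on[OF assms(2)]])
        (auto simp: V_def \<gamma>_def in_U[unfolded \<gamma>_def, simplified] ne[unfolded \<gamma>_def, simplified]
          intro!: continuous_intros)
    fix t :: real
    have "holomorphic2_on (\<lambda>z. f (\<gamma> t, snd z)) {z. (\<gamma> t, snd z) \<in> U}"
      using holomorphic2_on_compose_affine[OF assms(2), of "\<gamma> t" 0 0 0 0 1] by simp
    then have "holomorphic2_on (\<lambda>z. f (\<gamma> t, snd z)) V"
      by (rule holomorphic2_on_subset) (auto simp: V_def in_U)
    then show "holomorphic2_on (G t) V"
      unfolding G_def by (intro holomorphic2_intros) (use ne[of t] in \<open>auto simp: V_def\<close>)
  qed
  then have "holomorphic2_on (\<lambda>z. 1 / (2 * of_real pi * \<i>) * integral {0..1} (\<lambda>x. G x z)) V"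
    by (intro holomorphic2_on_mult holomorphic2_on_const)
  then have "holomorphic2_on (\<lambda>z. deriv (\<lambda>u. f (u, snd z)) (fst z)) V"
  proof (rule holomorphic2_on_cong[OF V(1), rotated])
    fix w assume w: "w \<in> V"
    then have "(\<lambda>u. f (u, snd w)) holomorphic_on cball c r"
      using r by (intro holomorphic2_on_slice1[OF assms(2)]) (auto simp: V_def)
    then show "1 / (2 * of_real pi * \<i>) * integral {0..1} (\<lambda>x. G x w) = deriv (\<lambda>u. f (u, snd w)) (fst w)"
      using Cauchy_deriv_as_integral[of "\<lambda>u. f (u, snd w)" "cball c r" c r "fst w"] w
      by (auto simp: V_def G_def \<gamma>_def)
  qed
  with V(2) show "\<exists>V. z \<in> V \<and> holomorphic2_on (\<lambda>z. deriv (\<lambda>u. f (u, snd z)) (fst z)) V"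
    by blast
qed

text \<open>
  The difference \<open>f (u, v) - f (0, v)\<close> is \<open>u\<close> times the mean of the partial derivative of \<open>f\<close>
  over the segment from \<open>(0, v)\<close> to \<open>(u, v)\<close>, and such a mean is holomorphic.  Dividing by one
  variable after the other gives the coefficients.
\<close>

lemma hadamard_division:
  assumes r: "r > 0" and hol: "holomorphic2_on f (ball 0 r \<times> ball 0 r)"
  obtains a b where "holomorphic2_on a (ball 0 r \<times> ball 0 r)" "holomorphic2_on b (ball 0 r \<times> ball 0 r)"
    "\<And>z. z \<in> ball 0 r \<times> ball 0 r \<Longrightarrow> f z = f (0, 0) + a z * fst z + b z * snd z"
proof -
  define V :: "(complex \<times> complex) set" where "V = ball 0 r \<times> ball 0 r"
  have V: "open V" by (auto simp: V_def open_Times)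
  have div: "\<exists>a. holomorphic2_on a V \<and> (\<forall>z\<in>V. f z = f (0, snd z) + a z * fst z)"
    if f: "holomorphic2_on f V" for f
  proof -
    define D where "D z = deriv (\<lambda>u. f (u, snd z)) (fst z)" for z
    have D: "holomorphic2_on D V"
      unfolding D_def by (rule holomorphic2_on_partial1[OF V f])
    have scV: "(of_real t * fst z, snd z) \<in> V" if "z \<in> V" "t \<in> {0..1}" for t :: real and z
    proof -
      have "\<bar>t\<bar> * norm (fst z) \<le> 1 * norm (fst z)"
        using that by (intro mult_right_mono) auto
      with that show ?thesis
        by (auto simp: V_def norm_mult)
    qed
    have "holomorphic2_on (\<lambda>z. integral {0..1} (\<lambda>t. D (of_real t * fst z, snd z))) V"
    proof (rule holomorphic2_on_integral[OF V])
      show "continuous_on (V \<times> {0..1}) (\<lambda>(z, t). D (of_real t * fst z, snd z))"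
        unfolding split_beta
        by (intro continuous_intros continuous_on_compose2[OF holomorphic2_on_imp_continuous_on[OF D]])
          (use scV in auto)
      fix t :: real assume t: "t \<in> {0..1}"
      show "holomorphic2_on (\<lambda>z. D (of_real t * fst z, snd z)) V"
      proof (rule holomorphic2_on_subset)
        show "holomorphic2_on (\<lambda>z. D (of_real t * fst z, snd z)) {z. (of_real t * fst z, snd z) \<in> V}"
          using holomorphic2_on_compose_affine[OF D, of 0 "of_real t" 0 0 0 1] by simp
      qed (use scV t in auto)
    qed
    moreover have "f z = f (0, snd z) + integral {0..1} (\<lambda>t. D (of_real t * fst z, snd z)) * fst z"
      if z: "z \<in> V" for z
    proof -
      have hol: "(\<lambda>u. f (u, snd z)) holomorphic_on ball 0 r"
        using z by (intro holomorphic2_on_slice1[OF f]) (auto simp: V_def)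
      have "((\<lambda>t. f (of_real t * fst z, snd z)) has_vector_derivative
          D (of_real t * fst z, snd z) * fst z) (at t within {0..1})" if t: "t \<in> {0..1}" for t
      proof -
        have d1: "((\<lambda>u. f (u, snd z)) has_field_derivative D (of_real t * fst z, snd z)) (at (of_real t * fst z))"
          using holomorphic_derivI[OF hol] scV[OF z t] by (auto simp: D_def V_def)
        have d2: "((\<lambda>t. of_real t * fst z) has_vector_derivative fst z) (at t within {0..1})"
          by (auto intro!: derivative_eq_intros)
        show ?thesis
          using field_vector_diff_chain_within[OF d2 has_field_derivative_at_within[OF d1]]
          by (simp add: o_def mult.commute)
      qed
      then have I: "((\<lambda>t. D (of_real t * fst z, snd z) * fst z) has_integral
          f (of_real 1 * fst z, snd z) - f (of_real 0 * fst z, snd z)) {0..1}"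
        by (intro fundamental_theorem_of_calculus) auto
      have "f (of_real 1 * fst z, snd z) - f (of_real 0 * fst z, snd z) = f z - f (0, snd z)"
        by simp
      from trans[OF integral_unique[OF I] this]
      have "integral {0..1} (\<lambda>t. D (of_real t * fst z, snd z) * fst z) = f z - f (0, snd z)" .
      then show ?thesis
        by (simp add: algebra_simps)
    qed
    ultimately show ?thesis by blast
  qed
  obtain a where a: "holomorphic2_on a V" "\<And>z. z \<in> V \<Longrightarrow> f z = f (0, snd z) + a z * fst z"
    using div[of f] hol by (auto simp: V_def)
  have V0: "(\<lambda>z. (fst z, 0)) z \<in> V" if "z \<in> V" for z
    using that r by (auto simp: V_def)
  have sw: "{z. (snd z, fst z) \<in> V} = V"
    by (auto simp: V_def)
  have sl: "holomorphic2_on (\<lambda>z. f (0, fst z)) V"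
  proof (rule holomorphic2_on_compose_fst[where A = "ball 0 r" and f = "\<lambda>v. f (0, v)"])
    show "(\<lambda>v. f (0, v)) holomorphic_on ball 0 r"
      using r by (intro holomorphic2_on_slice2[OF hol]) auto
  qed (auto simp: V_def)
  from div[OF this] obtain b where b: "holomorphic2_on b V" "\<And>z. z \<in> V \<Longrightarrow> f (0, fst z) = f (0, 0) + b z * fst z"
    by auto
  have "holomorphic2_on (\<lambda>z. b (snd z, fst z)) V"
    using holomorphic2_on_swap[OF b(1)] sw by simp
  moreover have "f z = f (0, 0) + a z * fst z + b (snd z, fst z) * snd z" if "z \<in> V" for z
    using a(2)[OF that] b(2)[of "(snd z, fst z)"] that by (auto simp: V_def)
  ultimately show ?thesis
    using that[of a "\<lambda>z. b (snd z, fst z)"] a(1) by (auto simp: V_def)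
qed

section \<open>Germs and Milnor number one\<close>

lemma holomorphic2_partials_germ:
  assumes "germ_at s f"
  obtains a b where "(f has_derivative (\<lambda>h. a * fst h + b * snd h)) (at s)"
  using assms unfolding germ_at_def holomorphic2_on_def by blast

lemma germ_atI: "open U \<Longrightarrow> s \<in> U \<Longrightarrow> holomorphic2_on f U \<Longrightarrow> germ_at s f"
  by (auto simp: germ_at_def)

lemma germ_at_const: "germ_at s (\<lambda>z. c)"
  by (rule germ_atI[of UNIV]) (auto intro: holomorphic2_intros)

lemma germ_at_linear: "germ_at s (\<lambda>z. p * fst z + q * snd z)"
  by (rule germ_atI[of UNIV]) (auto intro!: holomorphic2_intros)

lemma germ_at_add:
  assumes "germ_at s f" "germ_at s g" shows "germ_at s (\<lambda>z. f z + g z)"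
proof -
  obtain U V where "open U" "s \<in> U" "holomorphic2_on f U" "open V" "s \<in> V" "holomorphic2_on g V"
    using assms unfolding germ_at_def by blast
  then show ?thesis
    by (intro germ_atI[of "U \<inter> V"] holomorphic2_on_add) (auto intro: holomorphic2_on_subset)
qed

lemma germ_at_mult:
  assumes "germ_at s f" "germ_at s g" shows "germ_at s (\<lambda>z. f z * g z)"
proof -
  obtain U V where "open U" "s \<in> U" "holomorphic2_on f U" "open V" "s \<in> V" "holomorphic2_on g V"
    using assms unfolding germ_at_def by blast
  then show ?thesis
    by (intro germ_atI[of "U \<inter> V"] holomorphic2_on_mult) (auto intro: holomorphic2_on_subset)
qed

lemma germ_at_sum: "(\<And>i. i \<in> I \<Longrightarrow> germ_at s (f i)) \<Longrightarrow> germ_at s (\<lambda>z. \<Sum>i\<in>I. f i z)"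
  by (induction I rule: infinite_finite_induct) (auto intro: germ_at_const germ_at_add)

lemma germ_at_diff: "germ_at s f \<Longrightarrow> germ_at s g \<Longrightarrow> germ_at s (\<lambda>z. f z - g z)"
  using germ_at_add[of s f "\<lambda>z. -1 * g z"] germ_at_mult[OF germ_at_const[of s "-1"], of g] by simp

lemma germ_at_isCont: "germ_at s f \<Longrightarrow> isCont f s"
  unfolding germ_at_def using holomorphic2_on_imp_continuous_on continuous_on_eq_continuous_at by blast

lemma germ_at_inverse:
  assumes "germ_at s f" "f s \<noteq> 0" shows "germ_at s (\<lambda>z. inverse (f z))"
proof -
  obtain U where U: "open U" "s \<in> U" "holomorphic2_on f U"
    using assms unfolding germ_at_def by blast
  then obtain V where V: "open V" "s \<in> V" "\<And>z. z \<in> V \<Longrightarrow> f z \<noteq> 0"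
    using continuous_at_avoid[OF germ_at_isCont[OF assms(1)] assms(2)]
    by (metis centre_in_ball dist_commute mem_ball open_ball)
  show ?thesis
    using U V by (intro germ_atI[of "U \<inter> V"] holomorphic2_on_inverse) (auto intro: holomorphic2_on_subset)
qed

lemma hadamard_germ:
  assumes "germ_at (0, 0) f" "f (0, 0) = 0"
  obtains a b where "germ_at (0, 0) a" "germ_at (0, 0) b"
    "\<forall>\<^sub>F z in nhds (0, 0). f z = a z * fst z + b z * snd z"
proof -
  obtain U where U: "open U" "(0, 0) \<in> U" "holomorphic2_on f U"
    using assms unfolding germ_at_def by blast
  obtain r where r: "r > 0" "cball 0 r \<times> cball 0 r \<subseteq> U"
    using open_contains_polydisc[OF U(1,2)] by blast
  define V :: "(complex \<times> complex) set" where "V = ball 0 r \<times> ball 0 r"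
  have V: "open V" "(0, 0) \<in> V" "V \<subseteq> U"
    using r by (auto simp: V_def open_Times)
  obtain a b where ab: "holomorphic2_on a V" "holomorphic2_on b V"
    "\<And>z. z \<in> V \<Longrightarrow> f z = f (0, 0) + a z * fst z + b z * snd z"
    using hadamard_division[OF r(1), of f] holomorphic2_on_subset[OF U(3) V(3)] unfolding V_def by blast
  show ?thesis
  proof (rule that)
    show "germ_at (0, 0) a" "germ_at (0, 0) b"
      using V ab by (auto intro: germ_atI)
    show "\<forall>\<^sub>F z in nhds (0, 0). f z = a z * fst z + b z * snd z"
      unfolding eventually_nhds using V ab(3) assms(2) by auto
  qed
qed

text \<open>
  A relation \<open>k = p f + q g\<close> between germs, where \<open>f\<close> and \<open>g\<close> vanish at the point, is a linear relation
  between differentials whose coefficients are the values of \<open>p\<close> and \<open>q\<close>.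
\<close>

lemma derivative_at_combination:
  assumes f: "f s = 0" "(f has_derivative (\<lambda>h. a * fst h + b * snd h)) (at s)"
    and g: "g s = 0" "(g has_derivative (\<lambda>h. c * fst h + d * snd h)) (at s)"
    and pq: "germ_at s p" "germ_at s q"
    and ev: "\<forall>\<^sub>F z in nhds s. k z = p z * f z + q z * g z"
    and k: "(k has_derivative (\<lambda>h. x * fst h + y * snd h)) (at s)"
  shows "x = p s * a + q s * c" "y = p s * b + q s * d"
proof -
  obtain p1 p2 where p: "(p has_derivative (\<lambda>h. p1 * fst h + p2 * snd h)) (at s)"
    using holomorphic2_partials_germ[OF pq(1)] .
  obtain q1 q2 where q: "(q has_derivative (\<lambda>h. q1 * fst h + q2 * snd h)) (at s)"
    using holomorphic2_partials_germ[OF pq(2)] .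
  obtain S where S: "open S" "s \<in> S" "\<And>z. z \<in> S \<Longrightarrow> k z = p z * f z + q z * g z"
    using ev unfolding eventually_nhds by blast
  have "((\<lambda>z. p z * f z + q z * g z) has_derivative (\<lambda>h. x * fst h + y * snd h)) (at s)"
    by (rule has_derivative_transform_within_open[OF k S(1,2)]) (use S in auto)
  moreover have "((\<lambda>z. p z * f z + q z * g z) has_derivative
      (\<lambda>h. (p s * a + q s * c) * fst h + (p s * b + q s * d) * snd h)) (at s)"
    using has_derivative_add[OF has_derivative_mult[OF p f(2)] has_derivative_mult[OF q g(2)]]
    by (simp add: f g algebra_simps)
  ultimately have *: "(\<lambda>h. x * fst h + y * snd h) = (\<lambda>h. (p s * a + q s * c) * fst h + (p s * b + q s * d) * snd h)"
    by (rule has_derivative_unique)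
  show "x = p s * a + q s * c"
    using fun_cong[OF *, of "(1, 0)"] by simp
  show "y = p s * b + q s * d"
    using fun_cong[OF *, of "(0, 1)"] by simp
qed

text \<open>
  Write \<open>f\<close> and \<open>g\<close> as combinations of the two coordinates.  The determinant of the coefficients is
  a unit near the origin because its value there is the Jacobian, so Cramer's rule expresses the
  coordinates, and with them every germ vanishing at the origin, through \<open>f\<close> and \<open>g\<close>.
\<close>

lemma maximal_ideal_generated:
  assumes f: "germ_at (0, 0) f" "f (0, 0) = 0" "(f has_derivative (\<lambda>h. a * fst h + b * snd h)) (at (0, 0))"
    and g: "germ_at (0, 0) g" "g (0, 0) = 0" "(g has_derivative (\<lambda>h. c * fst h + d * snd h)) (at (0, 0))"
    and det: "a * d - b * c \<noteq> 0"
    and k: "germ_at (0, 0) k" "k (0, 0) = 0"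
  shows "k \<in> local_ideal (0, 0) f g"
proof -
  obtain f1 f2 where F: "germ_at (0, 0) f1" "germ_at (0, 0) f2"
    "\<forall>\<^sub>F z in nhds (0, 0). f z = f1 z * fst z + f2 z * snd z"
    using hadamard_germ[OF f(1,2)] by blast
  obtain g1 g2 where G: "germ_at (0, 0) g1" "germ_at (0, 0) g2"
    "\<forall>\<^sub>F z in nhds (0, 0). g z = g1 z * fst z + g2 z * snd z"
    using hadamard_germ[OF g(1,2)] by blast
  obtain k1 k2 where K: "germ_at (0, 0) k1" "germ_at (0, 0) k2"
    "\<forall>\<^sub>F z in nhds (0, 0). k z = k1 z * fst z + k2 z * snd z"
    using hadamard_germ[OF k] by blast
  have coords: "(fst has_derivative (\<lambda>h. 1 * fst h + 0 * snd h)) (at (0 :: complex, 0 :: complex))"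
    "(snd has_derivative (\<lambda>h. 0 * fst h + 1 * snd h)) (at (0 :: complex, 0 :: complex))"
    by (auto intro!: derivative_eq_intros)
  have "a = f1 (0, 0)" "b = f2 (0, 0)"
    using derivative_at_combination[OF _ coords(1) _ coords(2) F f(3)] by auto
  moreover have "c = g1 (0, 0)" "d = g2 (0, 0)"
    using derivative_at_combination[OF _ coords(1) _ coords(2) G g(3)] by auto
  define D where "D z = f1 z * g2 z - f2 z * g1 z" for z
  ultimately have D0: "D (0, 0) \<noteq> 0"
    using det \<open>c = g1 (0, 0)\<close> \<open>d = g2 (0, 0)\<close> by (simp add: D_def)
  have germD: "germ_at (0, 0) D"
    unfolding D_def by (intro germ_at_diff germ_at_mult F G)
  have "\<forall>\<^sub>F z in nhds (0, 0). D z \<noteq> 0"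
  proof -
    have "(D \<longlongrightarrow> D (0, 0)) (nhds (0, 0))"
      using germ_at_isCont[OF germD] by (simp add: isCont_def tendsto_at_iff_tendsto_nhds)
    then show ?thesis
      using D0 tendsto_imp_eventually_ne by blast
  qed
  with F(3) G(3) K(3)
  have "\<forall>\<^sub>F z in nhds (0, 0). k z =
     ((k1 z * g2 z - k2 z * g1 z) * inverse (D z)) * f z + ((k2 z * f1 z - k1 z * f2 z) * inverse (D z)) * g z"
  proof eventually_elim
    case (elim z)
    have "(k1 z * g2 z - k2 z * g1 z) * f z + (k2 z * f1 z - k1 z * f2 z) * g z = D z * k z"
      unfolding elim D_def by (simp add: algebra_simps)
    then have "k z = inverse (D z) * ((k1 z * g2 z - k2 z * g1 z) * f z + (k2 z * f1 z - k1 z * f2 z) * g z)"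
      using elim(4) by simp
    then show ?case
      by (simp add: algebra_simps)
  qed
  moreover have "germ_at (0, 0) (\<lambda>z. (k1 z * g2 z - k2 z * g1 z) * inverse (D z))"
    "germ_at (0, 0) (\<lambda>z. (k2 z * f1 z - k1 z * f2 z) * inverse (D z))"
    by (intro germ_at_diff germ_at_mult germ_at_inverse[of _ D] germD D0 F G K)+
  ultimately show ?thesis
    unfolding local_ideal_def using k(1) by blast
qed

lemma local_ideal_vanishes:
  assumes "k \<in> local_ideal s f g" "f s = 0" "g s = 0"
  shows "k s = 0"
  using assms eventually_nhds_x_imp_x unfolding local_ideal_def by fastforce

definition independent_mod_ideal ::
    "complex \<times> complex \<Rightarrow> (complex \<times> complex \<Rightarrow> complex) \<Rightarrow> (complex \<times> complex \<Rightarrow> complex)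
       \<Rightarrow> nat \<Rightarrow> (nat \<Rightarrow> complex \<times> complex \<Rightarrow> complex) \<Rightarrow> bool" where
  "independent_mod_ideal s f g n e \<longleftrightarrow> (\<forall>i<n. germ_at s (e i)) \<and>
     (\<forall>c. (\<lambda>z. \<Sum>i<n. c i * e i z) \<in> local_ideal s f g \<longrightarrow> (\<forall>i<n. c i = 0))"

lemma local_codim_alt: "local_codim s f g = Sup {enat n |n. \<exists>e. independent_mod_ideal s f g n e}"
  by (simp add: local_codim_def independent_mod_ideal_def)

text \<open>
  If the Jacobian is non-zero, the ideal is the maximal ideal, so that \<open>1\<close> spans the quotient.  If
  it is zero, some linear form is not a combination of the two differentials, and it is independent
  of \<open>1\<close> modulo the ideal.
\<close>

lemma local_codim_eq_1_iff:
  assumes f: "germ_at (0, 0) f" "f (0, 0) = 0" "(f has_derivative (\<lambda>h. a * fst h + b * snd h)) (at (0, 0))"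
    and g: "germ_at (0, 0) g" "g (0, 0) = 0" "(g has_derivative (\<lambda>h. c * fst h + d * snd h)) (at (0, 0))"
  shows "local_codim (0, 0) f g = 1 \<longleftrightarrow> a * d - b * c \<noteq> 0"
proof
  assume det: "a * d - b * c \<noteq> 0"
  have "n \<le> 1" if "independent_mod_ideal (0, 0) f g n e" for n e
  proof (rule ccontr)
    assume n: "\<not> n \<le> 1"
    (* a non-trivial combination of the first two members that vanishes at the origin *)
    define x y where "x = (if e 0 (0, 0) = 0 \<and> e 1 (0, 0) = 0 then 1 else e 1 (0, 0))"
      and "y = (if e 0 (0, 0) = 0 \<and> e 1 (0, 0) = 0 then 0 else - e 0 (0, 0))"
    define w where "w i = (if i = 0 then x else if i = 1 then y else 0)" for i :: nat
    have sum: "(\<Sum>i<n. w i * e i z) = x * e 0 z + y * e 1 z" for z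
    proof -
      have "(\<Sum>i<n. w i * e i z) = (\<Sum>i\<in>{0, 1}. w i * e i z)"
        using n by (intro sum.mono_neutral_right) (auto simp: w_def)
      then show ?thesis by (simp add: w_def)
    qed
    have "germ_at (0, 0) (\<lambda>z. \<Sum>i<n. w i * e i z)"
      using that by (intro germ_at_sum germ_at_mult germ_at_const) (auto simp: independent_mod_ideal_def)
    moreover have "(\<Sum>i<n. w i * e i (0, 0)) = 0"
      unfolding sum by (auto simp: x_def y_def)
    ultimately have "(\<lambda>z. \<Sum>i<n. w i * e i z) \<in> local_ideal (0, 0) f g"
      using maximal_ideal_generated[OF f g det] by blast
    then have "w 0 = 0" "w 1 = 0"
      using that n unfolding independent_mod_ideal_def by (meson not_le_imp_less less_trans zero_less_one)+
    then show False
      by (auto simp: w_def x_def y_def split: if_splits)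
  qed
  moreover have "independent_mod_ideal (0, 0) f g 1 (\<lambda>_ _. 1)"
    unfolding independent_mod_ideal_def
  proof (intro conjI allI impI)
    fix w :: "nat \<Rightarrow> complex" and i :: nat
    assume w: "(\<lambda>z. \<Sum>i<1. w i * 1) \<in> local_ideal (0, 0) f g" and i: "i < 1"
    show "w i = 0"
      using local_ideal_vanishes[OF w f(2) g(2)] i by simp
  qed (rule germ_at_const)
  ultimately show "local_codim (0, 0) f g = 1"
    unfolding local_codim_alt one_enat_def
    by (intro antisym Sup_least Sup_upper) auto
next
  assume 1: "local_codim (0, 0) f g = 1"
  show "a * d - b * c \<noteq> 0"
  proof
    assume det: "a * d - b * c = 0"
    obtain p q where pq: "\<not> (\<exists>x y. p = x * a + y * c \<and> q = x * b + y * d)"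
    proof (cases "a = 0 \<and> b = 0 \<and> c = 0 \<and> d = 0")
      case True
      then show ?thesis using that[of 1 0] by auto
    next
      case False
      show ?thesis
      proof (cases "a = 0 \<and> c = 0")
        case True
        then show ?thesis using that[of 1 0] by auto
      next
        case False
        have "\<not> (\<exists>x y. 0 = x * a + y * c \<and> 1 = x * b + y * d)"
        proof clarify
          fix x y assume *: "0 = x * a + y * c" "1 = x * b + y * d"
          have "a = a * (x * b + y * d) - b * (x * a + y * c)" "c = c * (x * b + y * d) - d * (x * a + y * c)"
            using * by auto
          moreover have "a * (x * b + y * d) - b * (x * a + y * c) = y * (a * d - b * c)"
            "c * (x * b + y * d) - d * (x * a + y * c) = - x * (a * d - b * c)"
            by (simp_all add: algebra_simps)
          ultimately show False
            using False det by simp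
        qed
        then show ?thesis using that by blast
      qed
    qed
    define e where "e i = (if i = (0::nat) then (\<lambda>z. 1) else (\<lambda>z. p * fst z + q * snd z))" for i
    have "independent_mod_ideal (0, 0) f g 2 e"
      unfolding independent_mod_ideal_def
    proof (intro conjI allI impI)
      fix i show "germ_at (0, 0) (e i)"
        by (auto simp: e_def germ_at_const germ_at_linear)
    next
      fix w :: "nat \<Rightarrow> complex" and i :: nat
      assume w: "(\<lambda>z. \<Sum>i<2. w i * e i z) \<in> local_ideal (0, 0) f g" and i: "i < 2"
      have sum: "(\<lambda>z. \<Sum>i<2. w i * e i z) = (\<lambda>z. w 0 + w 1 * (p * fst z + q * snd z))"
        by (auto simp: e_def numeral_2_eq_2)
      have w0: "w 0 = 0"
        using local_ideal_vanishes[OF w f(2) g(2)] fun_cong[OF sum, of "(0, 0)"] by simp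
      obtain x y where xy: "germ_at (0, 0) x" "germ_at (0, 0) y"
        "\<forall>\<^sub>F z in nhds (0, 0). w 1 * (p * fst z + q * snd z) = x z * f z + y z * g z"
        using w w0 unfolding sum local_ideal_def by auto
      have "((\<lambda>z. w 1 * (p * fst z + q * snd z)) has_derivative
          (\<lambda>h. (w 1 * p) * fst h + (w 1 * q) * snd h)) (at (0, 0))"
        by (auto intro!: derivative_eq_intros simp: algebra_simps)
      from derivative_at_combination[OF f(2,3) g(2,3) xy this]
      have *: "w 1 * p = x (0, 0) * a + y (0, 0) * c" "w 1 * q = x (0, 0) * b + y (0, 0) * d" .
      have "w 1 = 0"
      proof (rule ccontr)
        assume "w 1 \<noteq> 0"
        then have "p = (x (0, 0) / w 1) * a + (y (0, 0) / w 1) * c" "q = (x (0, 0) / w 1) * b + (y (0, 0) / w 1) * d"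
          using * by (simp_all add: field_simps)
        with pq show False by blast
      qed
      with w0 i show "w i = 0"
        by (cases i) auto
    qed
    then have "enat 2 \<le> local_codim (0, 0) f g"
      unfolding local_codim_alt by (intro Sup_upper) auto
    then show False
      using 1 by (simp add: one_enat_def)
  qed
qed

section \<open>Curvature in families of webs\<close>

text \<open>
  Holomorphic functions of a point that depend on a parameter only continuously.  This is the class
  in which limits are taken: it is stable under derivatives in the point, so that a differential
  expression in a member can be evaluated at a limiting parameter.
\<close>

definition holo_family :: "'p::t2_space set \<Rightarrow> (complex \<times> complex) set \<Rightarrow> ('p \<Rightarrow> complex \<times> complex \<Rightarrow> complex) \<Rightarrow> bool"
  where "holo_family E V f \<longleftrightarrow>
     continuous_on (E \<times> V) (\<lambda>(e, z). f e z) \<and> (\<forall>e\<in>E. holomorphic2_on (f e) V)"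

lemma holo_family_const: "holo_family E V (\<lambda>e z. c)"
  by (auto simp: holo_family_def split_beta intro: holomorphic2_intros)

lemma holo_family_of_fun: "holomorphic2_on f V \<Longrightarrow> holo_family E V (\<lambda>e. f)"
  by (auto simp: holo_family_def split_beta
      intro!: continuous_on_compose2[OF holomorphic2_on_imp_continuous_on] continuous_intros)

lemma holo_family_of_param: "continuous_on E f \<Longrightarrow> holo_family E V (\<lambda>e z. f e)"
  by (auto simp: holo_family_def split_beta holomorphic2_on_const
      intro!: continuous_on_compose2[of E f] continuous_intros)

lemma holo_family_add: "holo_family E V f \<Longrightarrow> holo_family E V g \<Longrightarrow> holo_family E V (\<lambda>e z. f e z + g e z)"
  by (auto simp: holo_family_def split_beta intro!: continuous_intros holomorphic2_on_add)

lemma holo_family_mult: "holo_family E V f \<Longrightarrow> holo_family E V g \<Longrightarrow> holo_family E V (\<lambda>e z. f e z * g e z)"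
  by (auto simp: holo_family_def split_beta intro!: continuous_intros holomorphic2_on_mult)

lemma holo_family_diff: "holo_family E V f \<Longrightarrow> holo_family E V g \<Longrightarrow> holo_family E V (\<lambda>e z. f e z - g e z)"
  by (auto simp: holo_family_def split_beta intro!: continuous_intros holomorphic2_on_diff)

lemma holo_family_uminus: "holo_family E V f \<Longrightarrow> holo_family E V (\<lambda>e z. - f e z)"
  by (auto simp: holo_family_def split_beta intro!: continuous_intros holomorphic2_on_uminus)

lemma holo_family_divide:
  "holo_family E V f \<Longrightarrow> holo_family E V g \<Longrightarrow> (\<And>e z. e \<in> E \<Longrightarrow> z \<in> V \<Longrightarrow> g e z \<noteq> 0) \<Longrightarrow>
    holo_family E V (\<lambda>e z. f e z / g e z)"
  by (auto simp: holo_family_def split_beta intro!: continuous_intros holomorphic2_on_divide)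

lemma holo_family_sum:
  "(\<And>i. i \<in> I \<Longrightarrow> holo_family E V (f i)) \<Longrightarrow> holo_family E V (\<lambda>e z. \<Sum>i\<in>I. f i e z)"
  by (induction I rule: infinite_finite_induct) (auto intro: holo_family_const holo_family_add)

lemma holo_family_power: "holo_family E V f \<Longrightarrow> holo_family E V (\<lambda>e z. f e z ^ n)"
  by (induction n) (auto intro: holo_family_const holo_family_mult)

lemmas holo_family_intros = holo_family_const holo_family_add holo_family_mult holo_family_diff
  holo_family_uminus holo_family_divide holo_family_sum holo_family_power

lemma holo_family_subset: "holo_family E V f \<Longrightarrow> E' \<subseteq> E \<Longrightarrow> V' \<subseteq> V \<Longrightarrow> holo_family E' V' f"
  unfolding holo_family_def
  by (meson Sigma_mono continuous_on_subset holomorphic2_on_subset subsetD)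

lemma holo_family_cong:
  assumes "open V" "\<And>e z. e \<in> E \<Longrightarrow> z \<in> V \<Longrightarrow> f e z = g e z" "holo_family E V f"
  shows "holo_family E V g"
  unfolding holo_family_def
proof (intro conjI ballI)
  have "continuous_on (E \<times> V) (\<lambda>(e, z). f e z)"
    using assms(3) by (simp add: holo_family_def)
  then show "continuous_on (E \<times> V) (\<lambda>(e, z). g e z)"
    by (rule continuous_on_eq) (use assms(2) in auto)
  fix e assume "e \<in> E"
  then show "holomorphic2_on (g e) V"
    using assms holomorphic2_on_cong[OF assms(1), of "f e" "g e"] by (auto simp: holo_family_def)
qed

text \<open>
  By \<open>continuous_on_deriv_param\<close>, with the pair of the parameter and the other coordinate in the role
  of the parameter.
\<close>

lemma holo_family_partial1:
  assumes "open V" "holo_family E V f"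
  shows "holo_family E V (\<lambda>e z. deriv (\<lambda>u. f e (u, snd z)) (fst z))"
  unfolding holo_family_def
proof (intro conjI ballI)
  fix e assume "e \<in> E"
  then show "holomorphic2_on (\<lambda>z. deriv (\<lambda>u. f e (u, snd z)) (fst z)) V"
    using assms holomorphic2_on_partial1 by (auto simp: holo_family_def)
next
  have cont: "continuous_on (E \<times> V) (\<lambda>(e, z). f e z)" and hol: "\<And>e. e \<in> E \<Longrightarrow> holomorphic2_on (f e) V"
    using assms(2) by (auto simp: holo_family_def)
  show "continuous_on (E \<times> V) (\<lambda>(e, z). deriv (\<lambda>u. f e (u, snd z)) (fst z))"
    unfolding continuous_on_eq_continuous_within
  proof clarify
    fix e0 c d assume e0: "e0 \<in> E" and cd: "(c, d) \<in> V"
    obtain r where r: "r > 0" "cball c r \<times> cball d r \<subseteq> V"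
      using open_contains_polydisc[OF assms(1) cd] by blast
    have sub: "(u, v) \<in> V" if "u \<in> ball c r" "v \<in> ball d r" for u v
      using r that by auto
    have "continuous_on ((E \<times> ball d r) \<times> ball c r) (\<lambda>(t, u). deriv ((\<lambda>(e, v) u. f e (u, v)) t) u)"
    proof (rule continuous_on_deriv_param)
      show "continuous_on ((E \<times> ball d r) \<times> ball c r) (\<lambda>(t, u). (case t of (e, v) \<Rightarrow> \<lambda>u. f e (u, v)) u)"
        unfolding split_beta
        by (intro continuous_on_compose2[OF cont[unfolded split_beta], where f = "\<lambda>p. (fst (fst p), (snd p, snd (fst p)))",
              unfolded fst_conv snd_conv])
          (auto intro!: continuous_intros sub)
    qed (use sub in \<open>auto intro!: holomorphic2_on_slice1[OF hol]\<close>)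
    moreover have "continuous_on (E \<times> (ball c r \<times> ball d r)) (\<lambda>p. ((fst p, snd (snd p)), fst (snd p)))"
      by (intro continuous_intros)
    moreover have "(\<lambda>p. ((fst p, snd (snd p)), fst (snd p))) ` (E \<times> (ball c r \<times> ball d r)) \<subseteq> (E \<times> ball d r) \<times> ball c r"
      by auto
    ultimately have "continuous_on (E \<times> (ball c r \<times> ball d r))
        (\<lambda>p. (\<lambda>(t, u). deriv ((\<lambda>(e, v) u. f e (u, v)) t) u) ((fst p, snd (snd p)), fst (snd p)))"
      by (rule continuous_on_compose2)
    then have "continuous (at (e0, (c, d)) within E \<times> (ball c r \<times> ball d r))
        (\<lambda>(e, z). deriv (\<lambda>u. f e (u, snd z)) (fst z))"
      using e0 r(1) by (simp add: continuous_on_eq_continuous_within case_prod_unfold)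
    moreover have "at (e0, (c, d)) within E \<times> (ball c r \<times> ball d r) = at (e0, (c, d)) within E \<times> V"
      by (rule at_within_nhd[where S = "UNIV \<times> (ball c r \<times> ball d r)"])
        (use r sub in \<open>auto intro!: open_Times\<close>)
    ultimately show "continuous (at (e0, (c, d)) within E \<times> V) (\<lambda>(e, z). deriv (\<lambda>u. f e (u, snd z)) (fst z))"
      by simp
  qed
qed

lemma holo_family_swap:
  assumes "holo_family E V f"
  shows "holo_family E {z. (snd z, fst z) \<in> V} (\<lambda>e z. f e (snd z, fst z))"
  unfolding holo_family_def
proof (intro conjI ballI)
  have "continuous_on (E \<times> V) (\<lambda>(e, z). f e z)"
    using assms by (simp add: holo_family_def)
  moreover have "continuous_on (E \<times> {z. (snd z, fst z) \<in> V}) (\<lambda>p. (fst p, (snd (snd p), fst (snd p))))"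
    by (intro continuous_intros)
  moreover have "(\<lambda>p. (fst p, (snd (snd p), fst (snd p)))) ` (E \<times> {z. (snd z, fst z) \<in> V}) \<subseteq> E \<times> V"
    by auto
  ultimately have "continuous_on (E \<times> {z. (snd z, fst z) \<in> V})
      (\<lambda>p. (\<lambda>(e, z). f e z) (fst p, (snd (snd p), fst (snd p))))"
    by (rule continuous_on_compose2)
  then show "continuous_on (E \<times> {z. (snd z, fst z) \<in> V}) (\<lambda>(e, z). f e (snd z, fst z))"
    by (simp add: split_beta)
  fix e assume "e \<in> E"
  then show "holomorphic2_on (\<lambda>z. f e (snd z, fst z)) {z. (snd z, fst z) \<in> V}"
    using assms holomorphic2_on_swap by (auto simp: holo_family_def)
qed

lemma open_swap:
  assumes "open (U :: (complex \<times> complex) set)" shows "open {z. (snd z, fst z) \<in> U}"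
proof -
  have "continuous_on UNIV (\<lambda>z :: complex \<times> complex. (snd z, fst z))"
    by (intro continuous_intros)
  then show ?thesis
    using open_vimage[OF assms] by (auto simp: vimage_def)
qed

lemma holo_family_partial2:
  assumes "open V" "holo_family E V f"
  shows "holo_family E V (\<lambda>e z. deriv (\<lambda>v. f e (fst z, v)) (snd z))"
  using holo_family_swap[OF holo_family_partial1[OF open_swap[OF assms(1)] holo_family_swap[OF assms(2)]]]
  by simp

definition holo_family_form :: "'p::t2_space set \<Rightarrow> (complex \<times> complex) set \<Rightarrow> ('p \<Rightarrow> form1) \<Rightarrow> bool"
  where "holo_family_form E V \<theta> \<longleftrightarrow>
     holo_family E V (\<lambda>e z. fst (\<theta> e z)) \<and> holo_family E V (\<lambda>e z. snd (\<theta> e z))"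

lemma holo_family_ext_deriv:
  assumes "open V" "holo_family_form E V \<theta>"
  shows "holo_family E V (\<lambda>e. ext_deriv (\<theta> e))"
  unfolding ext_deriv_def
  using assms holo_family_partial1[OF assms(1), of E "\<lambda>e z. snd (\<theta> e z)"]
    holo_family_partial2[OF assms(1), of E "\<lambda>e z. fst (\<theta> e z)"]
  by (intro holo_family_diff) (auto simp: holo_family_form_def)

lemma holo_family_wdelta:
  assumes "holo_family_form E V \<theta>" "holo_family_form E V \<theta>'"
  shows "holo_family E V (\<lambda>e. wdelta (\<theta> e) (\<theta>' e))"
  using assms unfolding wdelta_def wedge_def holo_family_form_def by (intro holo_family_intros) auto

lemma holo_family_fscale:
  assumes "holo_family E V f" "holo_family_form E V \<theta>"
  shows "holo_family_form E V (\<lambda>e. fscale (f e) (\<theta> e))"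
  using assms unfolding fscale_def holo_family_form_def by (auto intro: holo_family_mult)

definition holo_form_on :: "form1 \<Rightarrow> (complex \<times> complex) set \<Rightarrow> bool"
  where "holo_form_on \<theta> V \<longleftrightarrow> holomorphic2_on (\<lambda>z. fst (\<theta> z)) V \<and> holomorphic2_on (\<lambda>z. snd (\<theta> z)) V"

lemma slices_differentiable:
  assumes "open V" "holomorphic2_on f V" "z \<in> V"
  shows "(\<lambda>u. f (u, snd z)) field_differentiable (at (fst z))"
    and "(\<lambda>v. f (fst z, v)) field_differentiable (at (snd z))"
proof -
  obtain r where r: "r > 0" "cball (fst z) r \<times> cball (snd z) r \<subseteq> V"
    using open_contains_polydisc[OF assms(1), of "fst z" "snd z"] assms(3) by auto
  have "(\<lambda>u. f (u, snd z)) holomorphic_on ball (fst z) r"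
    using r by (intro holomorphic2_on_slice1[OF assms(2)]) auto
  then show "(\<lambda>u. f (u, snd z)) field_differentiable (at (fst z))"
    using r(1) holomorphic_on_imp_differentiable_at by (metis centre_in_ball open_ball)
  have "(\<lambda>v. f (fst z, v)) holomorphic_on ball (snd z) r"
    using r by (intro holomorphic2_on_slice2[OF assms(2)]) auto
  then show "(\<lambda>v. f (fst z, v)) field_differentiable (at (snd z))"
    using r(1) holomorphic_on_imp_differentiable_at by (metis centre_in_ball open_ball)
qed

lemma ext_deriv_add:
  assumes "open V" "holo_form_on \<alpha> V" "holo_form_on \<beta> V" "z \<in> V"
  shows "ext_deriv (\<lambda>z. (fst (\<alpha> z) + fst (\<beta> z), snd (\<alpha> z) + snd (\<beta> z))) z = ext_deriv \<alpha> z + ext_deriv \<beta> z"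
proof -
  have h: "holomorphic2_on (\<lambda>z. fst (\<alpha> z)) V" "holomorphic2_on (\<lambda>z. snd (\<alpha> z)) V"
    "holomorphic2_on (\<lambda>z. fst (\<beta> z)) V" "holomorphic2_on (\<lambda>z. snd (\<beta> z)) V"
    using assms by (auto simp: holo_form_on_def)
  note sd = slices_differentiable[OF assms(1) _ assms(4)]
  show ?thesis
    using deriv_add[OF sd(1)[OF h(2)] sd(1)[OF h(4)]] deriv_add[OF sd(2)[OF h(1)] sd(2)[OF h(3)]]
    by (simp add: ext_deriv_def)
qed

lemma ext_deriv_uminus:
  assumes "open V" "holo_form_on \<alpha> V" "z \<in> V"
  shows "ext_deriv (\<lambda>z. (- fst (\<alpha> z), - snd (\<alpha> z))) z = - ext_deriv \<alpha> z"
proof -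
  have h: "holomorphic2_on (\<lambda>z. fst (\<alpha> z)) V" "holomorphic2_on (\<lambda>z. snd (\<alpha> z)) V"
    using assms by (auto simp: holo_form_on_def)
  note sd = slices_differentiable[OF assms(1) _ assms(3)]
  show ?thesis
    using deriv_minus[OF sd(1)[OF h(2)]] deriv_minus[OF sd(2)[OF h(1)]]
    by (simp add: ext_deriv_def)
qed

lemma fscale_cyclic_sum:
  "fscale (wdelta r s) t = (\<lambda>z. (- (fst (fscale (wdelta s t) r z) + fst (fscale (wdelta t r) s z)),
      - (snd (fscale (wdelta s t) r z) + snd (fscale (wdelta t r) s z))))"
  by (simp add: fun_eq_iff fscale_def wdelta_def wedge_def algebra_simps)

lemma holo_form_on_fscale_wdelta:
  assumes "holo_form_on r V" "holo_form_on s V" "holo_form_on t V"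
  shows "holo_form_on (fscale (wdelta r s) t) V"
  using assms unfolding holo_form_on_def fscale_def wdelta_def wedge_def
  by (auto intro!: holomorphic2_intros)

text \<open>
  Cramer's rule for the first two of the three equations that define \<open>\<eta>\<close>; the third one is their
  sum up to sign.  The determinant of the system is the product of the three transversality
  factors.  The explicit formula shows that \<open>\<eta>\<close> inherits regularity from the foliations.
\<close>

lemma web_eta_formula:
  assumes V: "open V" and hol: "holo_form_on r V" "holo_form_on s V" "holo_form_on t V" and z: "z \<in> V"
    and ne: "wdelta s t z \<noteq> 0" "wdelta t r z \<noteq> 0" "wdelta r s z \<noteq> 0"
  defines "\<alpha> \<equiv> fscale (wdelta s t) r" and "\<beta> \<equiv> fscale (wdelta t r) s"
  shows "web_eta r s t z =
    ((ext_deriv \<beta> z * fst (\<alpha> z) - ext_deriv \<alpha> z * fst (\<beta> z)) / (wdelta s t z * wdelta t r z * wdelta r s z),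
     (ext_deriv \<beta> z * snd (\<alpha> z) - ext_deriv \<alpha> z * snd (\<beta> z)) / (wdelta s t z * wdelta t r z * wdelta r s z))"
    (is "_ = ?w")
proof -
  define \<gamma> where "\<gamma> = fscale (wdelta r s) t"
  define D where "D = wdelta s t z * wdelta t r z * wdelta r s z"
  have D: "D = fst (\<alpha> z) * snd (\<beta> z) - snd (\<alpha> z) * fst (\<beta> z)" "D \<noteq> 0"
    subgoal by (simp add: D_def \<alpha>_def \<beta>_def fscale_def wdelta_def wedge_def algebra_simps)
    subgoal using ne by (simp add: D_def)
    done
  have hab: "holo_form_on \<alpha> V" "holo_form_on \<beta> V"
    unfolding \<alpha>_def \<beta>_def using hol holo_form_on_fscale_wdelta by blast+
  have \<gamma>: "\<gamma> = (\<lambda>z. (- (fst (\<alpha> z) + fst (\<beta> z)), - (snd (\<alpha> z) + snd (\<beta> z))))"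
    unfolding \<gamma>_def \<alpha>_def \<beta>_def by (rule fscale_cyclic_sum)
  have "holo_form_on (\<lambda>z. (fst (\<alpha> z) + fst (\<beta> z), snd (\<alpha> z) + snd (\<beta> z))) V"
    using hab by (auto simp: holo_form_on_def intro: holomorphic2_intros)
  from ext_deriv_uminus[OF V this z] ext_deriv_add[OF V hab z]
  have E: "ext_deriv \<gamma> z = - (ext_deriv \<alpha> z + ext_deriv \<beta> z)"
    by (simp add: \<gamma>)
  have *: "(ext_deriv \<alpha> z = wedge w (\<alpha> z) \<and> ext_deriv \<beta> z = wedge w (\<beta> z) \<and> ext_deriv \<gamma> z = wedge w (\<gamma> z))
      \<longleftrightarrow> w = ?w" for w
  proof
    assume w: "w = ?w"
    have "wedge w (\<alpha> z) * D = ext_deriv \<alpha> z * D" "wedge w (\<beta> z) * D = ext_deriv \<beta> z * D"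
      unfolding w wedge_def D_def[symmetric] fst_conv snd_conv using D(2)
      by (simp_all add: field_simps) (simp_all add: D(1) algebra_simps)
    then have 1: "wedge w (\<alpha> z) = ext_deriv \<alpha> z" "wedge w (\<beta> z) = ext_deriv \<beta> z"
      using D(2) by auto
    moreover have "wedge w (\<gamma> z) = - (wedge w (\<alpha> z) + wedge w (\<beta> z))"
      by (simp add: \<gamma> wedge_def algebra_simps)
    ultimately show "ext_deriv \<alpha> z = wedge w (\<alpha> z) \<and> ext_deriv \<beta> z = wedge w (\<beta> z) \<and> ext_deriv \<gamma> z = wedge w (\<gamma> z)"
      using E by simp
  next
    assume "ext_deriv \<alpha> z = wedge w (\<alpha> z) \<and> ext_deriv \<beta> z = wedge w (\<beta> z) \<and> ext_deriv \<gamma> z = wedge w (\<gamma> z)"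
    then have AB: "ext_deriv \<alpha> z = fst w * snd (\<alpha> z) - snd w * fst (\<alpha> z)"
      "ext_deriv \<beta> z = fst w * snd (\<beta> z) - snd w * fst (\<beta> z)"
      by (simp_all add: wedge_def)
    have "fst w * D = ext_deriv \<beta> z * fst (\<alpha> z) - ext_deriv \<alpha> z * fst (\<beta> z)"
      "snd w * D = ext_deriv \<beta> z * snd (\<alpha> z) - ext_deriv \<alpha> z * snd (\<beta> z)"
      by (simp_all add: AB D(1) algebra_simps)
    then show "w = ?w"
      unfolding D_def[symmetric] using D(2) by (simp add: prod_eq_iff eq_divide_eq)
  qed
  show ?thesis
    unfolding web_eta_def \<alpha>_def[symmetric] \<beta>_def[symmetric] \<gamma>_def[symmetric] *
    by simp
qed

lemma holo_family_web_eta: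
  assumes V: "open V" and hol: "holo_family_form E V r" "holo_family_form E V s" "holo_family_form E V t"
    and ne: "\<And>e z. e \<in> E \<Longrightarrow> z \<in> V \<Longrightarrow> wdelta (s e) (t e) z \<noteq> 0"
      "\<And>e z. e \<in> E \<Longrightarrow> z \<in> V \<Longrightarrow> wdelta (t e) (r e) z \<noteq> 0"
      "\<And>e z. e \<in> E \<Longrightarrow> z \<in> V \<Longrightarrow> wdelta (r e) (s e) z \<noteq> 0"
  shows "holo_family_form E V (\<lambda>e. web_eta (r e) (s e) (t e))"
proof -
  define \<alpha> where "\<alpha> e = fscale (wdelta (s e) (t e)) (r e)" for e
  define \<beta> where "\<beta> e = fscale (wdelta (t e) (r e)) (s e)" for e
  have \<alpha>\<beta>: "holo_family_form E V \<alpha>" "holo_family_form E V \<beta>"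
    unfolding \<alpha>_def \<beta>_def using hol by (intro holo_family_fscale holo_family_wdelta; simp)+
  have d: "holo_family E V (\<lambda>e z. wdelta (s e) (t e) z * wdelta (t e) (r e) z * wdelta (r e) (s e) z)"
    using hol by (intro holo_family_mult holo_family_wdelta)
  have form: "holo_form_on (\<theta> e) V" if "holo_family_form E V \<theta>" "e \<in> E" for \<theta> e
    using that by (simp add: holo_family_form_def holo_form_on_def holo_family_def)
  have eq: "web_eta (r e) (s e) (t e) z =
    ((ext_deriv (\<beta> e) z * fst (\<alpha> e z) - ext_deriv (\<alpha> e) z * fst (\<beta> e z)) / (wdelta (s e) (t e) z * wdelta (t e) (r e) z * wdelta (r e) (s e) z),
     (ext_deriv (\<beta> e) z * snd (\<alpha> e z) - ext_deriv (\<alpha> e) z * snd (\<beta> e z)) / (wdelta (s e) (t e) z * wdelta (t e) (r e) z * wdelta (r e) (s e) z))"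
    if "e \<in> E" "z \<in> V" for e z
    unfolding \<alpha>_def \<beta>_def using that by (intro web_eta_formula[OF V] form hol ne)
  have "holo_family E V (\<lambda>e z. (ext_deriv (\<beta> e) z * fst (\<alpha> e z) - ext_deriv (\<alpha> e) z * fst (\<beta> e z))
      / (wdelta (s e) (t e) z * wdelta (t e) (r e) z * wdelta (r e) (s e) z))"
    "holo_family E V (\<lambda>e z. (ext_deriv (\<beta> e) z * snd (\<alpha> e z) - ext_deriv (\<alpha> e) z * snd (\<beta> e z))
      / (wdelta (s e) (t e) z * wdelta (t e) (r e) z * wdelta (r e) (s e) z))"
    using \<alpha>\<beta> ne
    by (intro holo_family_divide[OF _ d] holo_family_diff holo_family_mult holo_family_ext_deriv[OF V];
        simp add: holo_family_form_def)+
  from holo_family_cong[OF V _ this(1)] holo_family_cong[OF V _ this(2)] eq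
  show ?thesis
    unfolding holo_family_form_def by simp
qed

lemma holo_family_web_curvature:
  assumes V: "open V" and hol: "\<And>i. i < k \<Longrightarrow> holo_family_form E V (\<lambda>e. \<theta> e i)"
    and ne: "\<And>e z i j. e \<in> E \<Longrightarrow> z \<in> V \<Longrightarrow> i < k \<Longrightarrow> j < k \<Longrightarrow> i \<noteq> j \<Longrightarrow> wdelta (\<theta> e i) (\<theta> e j) z \<noteq> 0"
  shows "holo_family E V (\<lambda>e. web_curvature k (\<theta> e))"
  unfolding web_curvature_def
proof (rule holo_family_ext_deriv[OF V])
  define T where "T = {(r, s, t). r < s \<and> s < t \<and> t < k}"
  have eta: "holo_family_form E V (\<lambda>e. web_eta (\<theta> e (fst x)) (\<theta> e (fst (snd x))) (\<theta> e (snd (snd x))))" if "x \<in> T" for x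
    using that by (intro holo_family_web_eta[OF V] hol ne) (auto simp: T_def)
  then show "holo_family_form E V (\<lambda>e z. \<Sum>(r, s, t)\<in>{(r, s, t). r < s \<and> s < t \<and> t < k}.
      web_eta (\<theta> e r) (\<theta> e s) (\<theta> e t) z)"
    unfolding T_def[symmetric] holo_family_form_def split_beta fst_sum snd_sum
    by (auto intro!: holo_family_sum)
qed

section \<open>Simple roots in families of polynomials\<close>

text \<open>
  A factor that vanishes at the point lets the other factor be merely continuous there.  Roots of a
  polynomial with varying coefficients are differentiated in this way.
\<close>

lemma has_derivative_zero_times_continuous:
  fixes f Q :: "'a::real_normed_vector \<Rightarrow> complex"
  assumes f: "(f has_derivative f') (at z)" "f z = 0" and Q: "isCont Q z"
  shows "((\<lambda>w. f w * Q w) has_derivative (\<lambda>h. f' h * Q z)) (at z)"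
  unfolding has_derivative_at_alt
proof (intro conjI allI impI)
  have lin: "bounded_linear f'"
    using f(1) by (rule has_derivative_bounded_linear)
  then show "bounded_linear (\<lambda>h. f' h * Q z)"
    by (rule bounded_linear_mult_const)
  obtain K where K: "K > 0" "\<And>h. norm (f' h) \<le> norm h * K"
    using bounded_linear.pos_bounded[OF lin] by blast
  fix e :: real assume e: "e > 0"
  have alt: "\<exists>d>0. \<forall>y. norm (y - z) < d \<longrightarrow> norm (f y - f' (y - z)) \<le> e * norm (y - z)" if "e > 0" for e
    using f(1) that unfolding has_derivative_at_alt f(2) by simp
  obtain d1 where d1: "d1 > 0" "\<And>y. norm (y - z) < d1 \<Longrightarrow> norm (f y - f' (y - z)) \<le> 1 * norm (y - z)"
    using alt[of 1] by auto
  (* the tolerances e2 and e3 make the two halves of the error at most e / 2 each *)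
  define e2 where "e2 = e / (2 * (norm (Q z) + 1))"
  have nQ: "norm (Q z) + 1 > 0"
    using norm_ge_zero[of "Q z"] by linarith
  have e2: "e2 > 0" "e2 * norm (Q z) \<le> e / 2"
    using e nQ by (auto simp: e2_def field_simps)
  obtain d2 where d2: "d2 > 0" "\<And>y. norm (y - z) < d2 \<Longrightarrow> norm (f y - f' (y - z)) \<le> e2 * norm (y - z)"
    using alt[OF e2(1)] by auto
  define e3 where "e3 = e / (2 * (K + 1))"
  have e3: "e3 > 0" "e3 * (K + 1) = e / 2"
    using e K by (auto simp: e3_def field_simps)
  obtain d3 where d3: "d3 > 0" "\<And>y. norm (y - z) < d3 \<Longrightarrow> norm (Q y - Q z) < e3"
    using Q e3(1) unfolding continuous_at_eps_delta dist_norm by meson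
  show "\<exists>d>0. \<forall>y. norm (y - z) < d \<longrightarrow>
      norm (f y * Q y - f z * Q z - f' (y - z) * Q z) \<le> e * norm (y - z)"
  proof (intro exI[of _ "min d1 (min d2 d3)"] conjI allI impI)
    fix y assume y: "norm (y - z) < min d1 (min d2 d3)"
    have "norm (f y) \<le> norm (f y - f' (y - z)) + norm (f' (y - z))"
      by (metis diff_add_cancel norm_triangle_ineq)
    then have fy: "norm (f y) \<le> (K + 1) * norm (y - z)"
      using d1(2)[of y] K(2)[of "y - z"] y by (auto simp: algebra_simps)
    have "f y * Q y - f z * Q z - f' (y - z) * Q z = f y * (Q y - Q z) + (f y - f' (y - z)) * Q z"
      by (simp add: f(2) algebra_simps)
    then have "norm (f y * Q y - f z * Q z - f' (y - z) * Q z)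
        \<le> norm (f y) * norm (Q y - Q z) + norm (f y - f' (y - z)) * norm (Q z)"
      by (metis norm_mult norm_triangle_ineq)
    also have "\<dots> \<le> ((K + 1) * norm (y - z)) * e3 + (e2 * norm (y - z)) * norm (Q z)"
      using fy d3(2)[of y] d2(2)[of y] y K(1) e2(1) by (intro add_mono mult_mono) auto
    also have "\<dots> = (e3 * (K + 1)) * norm (y - z) + (e2 * norm (Q z)) * norm (y - z)"
      by (simp add: algebra_simps)
    also have "\<dots> \<le> (e / 2) * norm (y - z) + (e / 2) * norm (y - z)"
      unfolding e3(2) using e2(2) by (intro add_mono mult_right_mono) auto
    finally show "norm (f y * Q y - f z * Q z - f' (y - z) * Q z) \<le> e * norm (y - z)"
      by (simp add: algebra_simps)
  qed (use d1 d2 d3 in auto)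
qed

text \<open>
  The absolute value of a polynomial is that of its leading coefficient times the product of the distances
  to the roots; this is small only if one of the distances is.
\<close>

lemma poly_root_near:
  fixes p :: "complex poly"
  assumes "degree p = d" "norm (poly p x) < norm (lead_coeff p) * \<delta> ^ d" "\<delta> > 0"
  shows "\<exists>y. norm (y - x) < \<delta> \<and> poly p y = 0"
proof (rule ccontr)
  assume far: "\<not> ?thesis"
  obtain root where root: "smult (lead_coeff p) (\<Prod>i<degree p. [:-root i, 1:]) = p"
    using complex_poly_decompose' by blast
  have p: "poly p y = lead_coeff p * (\<Prod>i<d. y - root i)" for y
    using arg_cong[OF root, of "\<lambda>q. poly q y"] by (simp add: poly_prod assms(1))
  have "\<delta> \<le> norm (x - root i)" if "i < d" for i
  proof -
    have "poly p (root i) = 0"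
      using that unfolding p by auto
    then show ?thesis
      using far by (metis not_le norm_minus_commute)
  qed
  then have "(\<Prod>i<d. \<delta>) \<le> (\<Prod>i<d. norm (x - root i))"
    using assms(3) by (intro prod_mono) auto
  then have "norm (lead_coeff p) * \<delta> ^ d \<le> norm (poly p x)"
    unfolding p by (simp add: norm_mult prod_norm mult_left_mono)
  with assms(2) show False by linarith
qed

lemma poly_eq_prod_of_distinct_roots:
  fixes p :: "complex poly"
  assumes "degree p \<le> d" "inj_on x {..<d}" "\<And>i. i < d \<Longrightarrow> poly p (x i) = 0"
  shows "p = smult (coeff p d) (\<Prod>i<d. [:- x i, 1:])"
proof (rule poly_eqI_degree_lead_coeff[where n = d and A = "x ` {..<d}"])
  have deg: "degree (\<Prod>i<d. [:- x i, 1:]) = d"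
    by (subst degree_prod_eq_sum_degree) auto
  then show "degree (smult (coeff p d) (\<Prod>i<d. [:- x i, 1:])) \<le> d"
    by simp
  have "coeff (\<Prod>i<d. [:- x i, 1:]) d = 1"
    using lead_coeff_prod[of "\<lambda>i. [:- x i, 1:]" "{..<d}"] deg by simp
  then show "coeff p d = coeff (smult (coeff p d) (\<Prod>i<d. [:- x i, 1:])) d"
    by simp
  show "poly p z = poly (smult (coeff p d) (\<Prod>i<d. [:- x i, 1:])) z" if z: "z \<in> x ` {..<d}" for z
  proof -
    have "(\<Prod>j<d. z - x j) = 0"
      using z by auto
    then show ?thesis
      using assms(3) z by (auto simp: poly_prod)
  qed
qed (use assms in \<open>auto simp: card_image\<close>)

lemma finite_family_separated:
  fixes \<rho> :: "nat \<Rightarrow> complex"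
  assumes "inj_on \<rho> {..<d}"
  obtains \<delta> where "\<delta> > 0" "\<And>i j. i < d \<Longrightarrow> j < d \<Longrightarrow> i \<noteq> j \<Longrightarrow> 3 * \<delta> \<le> norm (\<rho> i - \<rho> j)"
proof -
  define D where "D = insert 1 ((\<lambda>(i, j). norm (\<rho> i - \<rho> j)) ` {(i, j). i < d \<and> j < d \<and> i \<noteq> j})"
  have "{(i, j). i < d \<and> j < d \<and> i \<noteq> j} \<subseteq> {..<d} \<times> {..<d}"
    by auto
  then have fin: "finite D"
    unfolding D_def using finite_subset by blast
  have "\<forall>x\<in>D. x > 0"
    using assms by (auto simp: D_def inj_on_def)
  then have pos: "Min D > 0"
    using fin by (simp add: D_def)
  show ?thesis
  proof (rule that[of "Min D / 3"])
    fix i j assume "i < d" "j < d" "i \<noteq> j"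
    then have "norm (\<rho> i - \<rho> j) \<in> D"
      by (auto simp: D_def)
    then show "3 * (Min D / 3) \<le> norm (\<rho> i - \<rho> j)"
      using fin by simp
  qed (use pos in auto)
qed

text \<open>
  Small discs around the distinct roots of \<open>P e0 z0\<close> each contain a root of \<open>P e z\<close> for nearby
  \<open>(e, z)\<close>, and by the degree there is exactly one in each.  All regularity comes from the
  factorisation evaluated at a fixed \<open>x\<close> close to the \<open>i\<close>-th root,
  \<open>poly (P e z) x = lead * (x - r i e z) * (\<Prod>j \<noteq> i. x - r j e z)\<close>, where the factors other than
  \<open>x - r i e z\<close> are bounded away from zero.  It bounds the displacement of the root by the value
  of the polynomial, which gives continuity, and when \<open>x\<close> is the root at a given point, it
  exhibits the displacement as a differentiable function vanishing at that point times a continuous one.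
\<close>

lemma simple_roots_holo_family:
  fixes P :: "'p::metric_space \<Rightarrow> complex \<times> complex \<Rightarrow> complex poly" and \<rho> :: "nat \<Rightarrow> complex"
  assumes U: "open U" "z0 \<in> U"
    and co: "\<And>j. holo_family UNIV U (\<lambda>e z. coeff (P e z) j)" and deg: "\<And>e z. degree (P e z) \<le> d"
    and lead: "coeff (P e0 z0) d \<noteq> 0" and inj: "inj_on \<rho> {..<d}"
    and root: "\<And>i. i < d \<Longrightarrow> poly (P e0 z0) (\<rho> i) = 0"
  obtains E V r \<delta> where "open E" "e0 \<in> E" "open V" "z0 \<in> V" "V \<subseteq> U" "\<delta> > 0"
    "\<And>e z. e \<in> E \<Longrightarrow> z \<in> V \<Longrightarrow> coeff (P e z) d \<noteq> 0"
    "\<And>e z. e \<in> E \<Longrightarrow> z \<in> V \<Longrightarrow> P e z = smult (coeff (P e z) d) (\<Prod>i<d. [:- r i e z, 1:])"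
    "\<And>e z. e \<in> E \<Longrightarrow> z \<in> V \<Longrightarrow> inj_on (\<lambda>i. r i e z) {..<d}"
    "\<And>i. i < d \<Longrightarrow> holo_family E V (r i)"
    "\<And>i e z x. i < d \<Longrightarrow> e \<in> E \<Longrightarrow> z \<in> V \<Longrightarrow> norm (x - \<rho> i) < \<delta> \<Longrightarrow> poly (P e z) x = 0 \<Longrightarrow> x = r i e z"
proof -
  obtain \<delta> where \<delta>: "\<delta> > 0" "\<And>i j. i < d \<Longrightarrow> j < d \<Longrightarrow> i \<noteq> j \<Longrightarrow> 3 * \<delta> \<le> norm (\<rho> i - \<rho> j)"
    using finite_family_separated[OF inj] by blast
  (* a lower bound for the leading coefficient near the base point *)
  define c where "c = norm (coeff (P e0 z0) d) / 2"
  have c: "c > 0" using lead by (simp add: c_def)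
  have ev: "holo_family UNIV U (\<lambda>e z. poly (P e z) x)" for x
  proof -
    have "poly (P e z) x = (\<Sum>j\<le>d. coeff (P e z) j * x ^ j)" for e z
      unfolding poly_altdef using deg[of e z]
      by (intro sum.mono_neutral_left) (auto simp: coeff_eq_0)
    then show ?thesis
      using co by (auto intro!: holo_family_intros)
  qed
  define A where "A = ({p \<in> UNIV \<times> U. c < norm (coeff (P (fst p) (snd p)) d)}
      \<inter> (\<Inter>i<d. {p \<in> UNIV \<times> U. norm (poly (P (fst p) (snd p)) (\<rho> i)) < c * \<delta> ^ d})) \<inter> UNIV \<times> U"
  have UU: "open (UNIV \<times> U :: ('p \<times> complex \<times> complex) set)"
    using U by (intro open_Times) auto
  have "open A"
    unfolding A_def
  proof (intro open_Int open_INT UU ballI finite_lessThan)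
    have "continuous_on (UNIV \<times> U) (\<lambda>p. norm (coeff (P (fst p) (snd p)) d))"
      using co[of d] by (auto simp: holo_family_def split_beta intro: continuous_on_norm)
    from continuous_open_preimage[OF this UU, of "{c<..}"]
    show "open {p \<in> UNIV \<times> U. c < norm (coeff (P (fst p) (snd p)) d)}"
      by (rule back_subst) auto
    fix i
    have "continuous_on (UNIV \<times> U) (\<lambda>p. norm (poly (P (fst p) (snd p)) (\<rho> i)))"
      using ev[of "\<rho> i"] by (auto simp: holo_family_def split_beta intro: continuous_on_norm)
    from continuous_open_preimage[OF this UU, of "{..<c * \<delta> ^ d}"]
    show "open {p \<in> UNIV \<times> U. norm (poly (P (fst p) (snd p)) (\<rho> i)) < c * \<delta> ^ d}"
      by (rule back_subst) auto
  qed
  moreover have "(e0, z0) \<in> A"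
    using U root c lead \<delta>(1) by (auto simp: A_def c_def)
  ultimately obtain E V where EV: "open E" "open V" "(e0, z0) \<in> E \<times> V" "E \<times> V \<subseteq> A"
    using open_prod_elim by blast
  have L: "c < norm (coeff (P e z) d)" and small: "\<And>i. i < d \<Longrightarrow> norm (poly (P e z) (\<rho> i)) < c * \<delta> ^ d"
    and inU: "z \<in> U" if "e \<in> E" "z \<in> V" for e z
    using EV(4) that by (auto simp: A_def)
  have VU: "V \<subseteq> U" using inU EV(3) by auto
  have ex: "\<exists>x. norm (x - \<rho> i) < \<delta> \<and> poly (P e z) x = 0" if "i < d" "e \<in> E" "z \<in> V" for i e z
  proof (rule poly_root_near[where d = d])
    have "coeff (P e z) d \<noteq> 0"
      using L[OF that(2,3)] c by auto
    then show deg': "degree (P e z) = d"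
      using deg[of e z] le_degree[of "P e z" d] by simp
    have "c * \<delta> ^ d \<le> norm (coeff (P e z) d) * \<delta> ^ d"
      using L[OF that(2,3)] \<delta>(1) by (intro mult_right_mono) auto
    then show "norm (poly (P e z) (\<rho> i)) < norm (lead_coeff (P e z)) * \<delta> ^ d"
      using small[OF that(2,3,1)] deg' by simp
  qed (rule \<delta>)
  define r where "r i e z = (SOME x. norm (x - \<rho> i) < \<delta> \<and> poly (P e z) x = 0)" for i e z
  have r: "norm (r i e z - \<rho> i) < \<delta>" "poly (P e z) (r i e z) = 0" if "i < d" "e \<in> E" "z \<in> V" for i e z
    using someI_ex[OF ex[OF that]] unfolding r_def by auto
  (* the discs of radius \<delta> have centres at distance at least 3 \<delta> *)
  have sep: "\<delta> \<le> norm (x - r j e z)" if "i < d" "j < d" "i \<noteq> j" "e \<in> E" "z \<in> V" "norm (x - \<rho> i) < \<delta>" for i j e z x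
  proof -
    have "3 * \<delta> \<le> norm (\<rho> i - \<rho> j)" using \<delta>(2) that by blast
    also have "\<rho> i - \<rho> j = (x - r j e z) + (r j e z - \<rho> j) - (x - \<rho> i)" by simp
    also have "norm \<dots> \<le> norm (x - r j e z + (r j e z - \<rho> j)) + norm (x - \<rho> i)"
      by (rule norm_triangle_ineq4)
    also have "\<dots> \<le> norm (x - r j e z) + norm (r j e z - \<rho> j) + norm (x - \<rho> i)"
      by (intro add_right_mono norm_triangle_ineq)
    finally show ?thesis
      using that r(1)[OF that(2,4,5)] by linarith
  qed
  have inj': "inj_on (\<lambda>i. r i e z) {..<d}" if "e \<in> E" "z \<in> V" for e z
  proof (rule inj_onI, rule ccontr)
    fix i j assume *: "i \<in> {..<d}" "j \<in> {..<d}" "r i e z = r j e z" "i \<noteq> j"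
    then have "\<delta> \<le> norm (r i e z - r j e z)"
      using that r(1)[of i e z] by (intro sep[of i j]) auto
    with * \<delta>(1) show False by simp
  qed
  have fac: "P e z = smult (coeff (P e z) d) (\<Prod>i<d. [:- r i e z, 1:])" if "e \<in> E" "z \<in> V" for e z
    using that deg inj' r(2) by (intro poly_eq_prod_of_distinct_roots) auto
  have val: "poly (P e z) x = coeff (P e z) d * ((x - r i e z) * (\<Prod>j\<in>{..<d} - {i}. x - r j e z))"
    if "i < d" "e \<in> E" "z \<in> V" for i e z x
  proof -
    have "poly (P e z) x = coeff (P e z) d * (\<Prod>j<d. x - r j e z)"
      using arg_cong[OF fac[OF that(2,3)], of "\<lambda>p. poly p x"] by (simp add: poly_prod)
    then show ?thesis
      using prod.remove[of "{..<d}" i "\<lambda>j. x - r j e z"] that(1) by simp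
  qed
  have uniq: "x = r i e z" if "i < d" "e \<in> E" "z \<in> V" "norm (x - \<rho> i) < \<delta>" "poly (P e z) x = 0" for i e z x
  proof -
    have "(\<Prod>j\<in>{..<d} - {i}. x - r j e z) \<noteq> 0"
    proof
      assume "(\<Prod>j\<in>{..<d} - {i}. x - r j e z) = 0"
      then obtain j where "j < d" "j \<noteq> i" "x = r j e z" by auto
      then show False using sep[of i j e z x] that \<delta>(1) by auto
    qed
    moreover have "coeff (P e z) d \<noteq> 0" using L[OF that(2,3)] c by auto
    ultimately show ?thesis using val[OF that(1-3), of x] that(5) by simp
  qed
  have lip: "norm (x - r i e z) * (c * \<delta> ^ (d - 1)) \<le> norm (poly (P e z) x)"
    if "i < d" "e \<in> E" "z \<in> V" "norm (x - \<rho> i) < \<delta>" for i e z x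
  proof -
    have "(\<Prod>j\<in>{..<d} - {i}. \<delta>) \<le> (\<Prod>j\<in>{..<d} - {i}. norm (x - r j e z))"
      using sep[of i _ e z x] that \<delta>(1) by (intro prod_mono) auto
    then have "\<delta> ^ (d - 1) \<le> norm (\<Prod>j\<in>{..<d} - {i}. x - r j e z)"
      using that(1) by (simp add: prod_norm)
    then have "c * \<delta> ^ (d - 1) \<le> norm (coeff (P e z) d) * norm (\<Prod>j\<in>{..<d} - {i}. x - r j e z)"
      using L[OF that(2,3)] c \<delta>(1) by (intro mult_mono) auto
    from mult_left_mono[OF this, of "norm (x - r i e z)"] show ?thesis
      unfolding val[OF that(1-3)] norm_mult by (simp add: algebra_simps)
  qed
  have cont: "continuous_on (E \<times> V) (\<lambda>(e, z). r i e z)" if i: "i < d" for i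
    unfolding continuous_on_def
  proof clarify
    fix e1 z1 assume ez: "e1 \<in> E" "z1 \<in> V"
    define x where "x = r i e1 z1"
    have x: "norm (x - \<rho> i) < \<delta>" "poly (P e1 z1) x = 0"
      using r[OF i ez] by (auto simp: x_def)
    have "continuous_on (E \<times> V) (\<lambda>(e, z). poly (P e z) x)"
      using ev[of x] VU by (auto simp: holo_family_def intro: continuous_on_subset)
    then have "((\<lambda>(e, z). poly (P e z) x) \<longlongrightarrow> poly (P e1 z1) x) (at (e1, z1) within E \<times> V)"
      using ez unfolding continuous_on_def by fastforce
    then have lim: "((\<lambda>(e, z). poly (P e z) x) \<longlongrightarrow> 0) (at (e1, z1) within E \<times> V)"
      by (simp add: x(2))
    have C: "c * \<delta> ^ (d - 1) > 0" using c \<delta>(1) by simp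
    have "((\<lambda>p. r i (fst p) (snd p) - x) \<longlongrightarrow> 0) (at (e1, z1) within E \<times> V)"
    proof (rule Lim_null_comparison)
      show "\<forall>\<^sub>F p in at (e1, z1) within E \<times> V. norm (r i (fst p) (snd p) - x)
          \<le> norm (poly (P (fst p) (snd p)) x) / (c * \<delta> ^ (d - 1))"
        unfolding eventually_at_topological using lip[OF i _ _ x(1)] C
        by (intro exI[of _ UNIV]) (auto simp: pos_le_divide_eq norm_minus_commute)
      show "((\<lambda>p. norm (poly (P (fst p) (snd p)) x) / (c * \<delta> ^ (d - 1))) \<longlongrightarrow> 0) (at (e1, z1) within E \<times> V)"
        using tendsto_divide[OF tendsto_norm[OF lim] tendsto_const[of "c * \<delta> ^ (d - 1)"]] c \<delta>(1)
        by (simp add: split_beta)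
    qed
    then show "((\<lambda>(e, z). r i e z) \<longlongrightarrow> r i e1 z1) (at (e1, z1) within E \<times> V)"
      by (simp add: case_prod_unfold x_def LIM_zero_iff)
  qed
  have hol: "holomorphic2_on (r i e) V" if i: "i < d" and e: "e \<in> E" for i e
    unfolding holomorphic2_on_def
  proof
    fix z1 assume z1: "z1 \<in> V"
    define x where "x = r i e z1"
    have x: "norm (x - \<rho> i) < \<delta>" "poly (P e z1) x = 0"
      using r[OF i e z1] by (auto simp: x_def)
    define Q where "Q z = inverse (coeff (P e z) d * (\<Prod>j\<in>{..<d} - {i}. x - r j e z))" for z
    have nz: "coeff (P e z) d * (\<Prod>j\<in>{..<d} - {i}. x - r j e z) \<noteq> 0" if "z \<in> V" for z
    proof -
      have "x \<noteq> r j e z" if "j < d" "j \<noteq> i" for j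
        using sep[of i j e z x] i e \<open>z \<in> V\<close> x(1) that \<delta>(1) by auto
      moreover have "coeff (P e z) d \<noteq> 0" using L[OF e \<open>z \<in> V\<close>] c by auto
      ultimately show ?thesis by auto
    qed
    have cr: "continuous_on V (r j e)" if "j < d" for j
    proof -
      have "continuous_on V (\<lambda>z. (e, z))" "(\<lambda>z. (e, z)) ` V \<subseteq> E \<times> V"
        using e by (auto intro!: continuous_intros)
      from continuous_on_compose2[OF cont[OF that] this] show ?thesis
        by simp
    qed
    have "holomorphic2_on (\<lambda>z. coeff (P e z) d) U"
      using co[of d] by (simp add: holo_family_def)
    then have cL: "continuous_on V (\<lambda>z. coeff (P e z) d)"
      using VU holomorphic2_on_imp_continuous_on continuous_on_subset by blast
    have "continuous_on V Q"
      unfolding Q_def using nz cr cL by (intro continuous_on_inverse continuous_on_mult continuous_on_prod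
          continuous_on_diff continuous_on_const) auto
    then have "isCont Q z1"
      using EV(2) z1 by (simp add: continuous_on_eq_continuous_at)
    obtain a b where "((\<lambda>z. poly (P e z) x) has_derivative (\<lambda>h. a * fst h + b * snd h)) (at z1)"
      using ev[of x] z1 VU unfolding holo_family_def holomorphic2_on_def by blast
    from has_derivative_diff[OF has_derivative_const[of x]
        has_derivative_zero_times_continuous[OF this x(2) \<open>isCont Q z1\<close>]]
    have "((\<lambda>z. x - poly (P e z) x * Q z) has_derivative (\<lambda>h. (- a * Q z1) * fst h + (- b * Q z1) * snd h)) (at z1)"
      by (simp add: algebra_simps)
    moreover have "x - poly (P e z) x * Q z = r i e z" if "z \<in> V" for z
      unfolding Q_def val[OF i e that] using nz[OF that] by (simp add: field_simps)
    ultimately have "(r i e has_derivative (\<lambda>h. (- a * Q z1) * fst h + (- b * Q z1) * snd h)) (at z1)"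
      using has_derivative_transform_within_open[OF _ EV(2) z1] by blast
    then show "\<exists>a b. (r i e has_derivative (\<lambda>h. a * fst h + b * snd h)) (at z1)"
      by blast
  qed
  show ?thesis
  proof (rule that[of E V \<delta> r])
    show "coeff (P e z) d \<noteq> 0" if "e \<in> E" "z \<in> V" for e z
      using L[OF that] c by auto
    show "holo_family E V (r i)" if "i < d" for i
      using cont[OF that] hol[OF that] by (auto simp: holo_family_def)
    show "open E" "e0 \<in> E" "open V" "z0 \<in> V" "V \<subseteq> U" "\<delta> > 0"
      using EV VU \<delta>(1) by auto
  qed (fact fac inj' uniq)+
qed

section \<open>Limits of flat webs\<close>

lemma ext_deriv_cong:
  assumes V: "open V" "z \<in> V" and eq: "\<And>z. z \<in> V \<Longrightarrow> \<alpha> z = \<beta> z"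
  shows "ext_deriv \<alpha> z = ext_deriv \<beta> z"
proof -
  obtain r where r: "r > 0" "cball (fst z) r \<times> cball (snd z) r \<subseteq> V"
    using open_contains_polydisc[of V "fst z" "snd z"] V by auto
  have "\<forall>\<^sub>F u in nhds (fst z). snd (\<alpha> (u, snd z)) = snd (\<beta> (u, snd z))"
    unfolding eventually_nhds using r by (intro exI[of _ "ball (fst z) r"]) (auto intro!: arg_cong[OF eq])
  moreover have "\<forall>\<^sub>F v in nhds (snd z). fst (\<alpha> (fst z, v)) = fst (\<beta> (fst z, v))"
    unfolding eventually_nhds using r by (intro exI[of _ "ball (snd z) r"]) (auto intro!: arg_cong[OF eq])
  ultimately show ?thesis
    unfolding ext_deriv_def by (simp add: deriv_cong_ev)
qed

lemma web_eta_cong: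
  assumes V: "open V" "z \<in> V"
    and eq: "\<And>z. z \<in> V \<Longrightarrow> r z = r' z" "\<And>z. z \<in> V \<Longrightarrow> s z = s' z" "\<And>z. z \<in> V \<Longrightarrow> t z = t' z"
  shows "web_eta r s t z = web_eta r' s' t' z"
proof -
  have fs: "fscale (wdelta s t) r w = fscale (wdelta s' t') r' w"
    "fscale (wdelta t r) s w = fscale (wdelta t' r') s' w"
    "fscale (wdelta r s) t w = fscale (wdelta r' s') t' w" if "w \<in> V" for w
    using eq that by (simp_all add: fscale_def wdelta_def)
  then show ?thesis
    unfolding web_eta_def using fs[OF V(2)] ext_deriv_cong[OF V fs(1)] ext_deriv_cong[OF V fs(2)]
      ext_deriv_cong[OF V fs(3)] by simp
qed

lemma web_curvature_cong:
  assumes V: "open V" "z \<in> V" and eq: "\<And>i z. i < k \<Longrightarrow> z \<in> V \<Longrightarrow> \<theta> i z = \<theta>' i z"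
  shows "web_curvature k \<theta> z = web_curvature k \<theta>' z"
  unfolding web_curvature_def
proof (rule ext_deriv_cong[OF V], rule sum.cong[OF refl], clarify)
  fix w r s t assume "w \<in> V" "r < s" "s < t" "t < k"
  then show "web_eta (\<theta> r) (\<theta> s) (\<theta> t) w = web_eta (\<theta>' r) (\<theta>' s) (\<theta>' t) w"
    by (intro web_eta_cong[OF V(1)] eq) auto
qed

lemma flat_web_few:
  assumes "d < 3"
  shows "flat_web d S"
proof -
  have "{(r, s, t). r < s \<and> s < t \<and> t < d} = {}"
    using assms by auto
  then have "web_curvature d \<theta> z = 0" for \<theta> z
    by (simp only: web_curvature_def sum.empty) (simp add: ext_deriv_def)
  then show ?thesis
    by (simp add: flat_web_def)
qed

lemma zero_at_limit_param:
  fixes K :: "complex \<Rightarrow> complex"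
  assumes "open E" "0 \<in> E" "continuous_on E K" "\<And>e. e \<in> E \<Longrightarrow> e \<noteq> 0 \<Longrightarrow> K e = 0"
  shows "K 0 = 0"
proof -
  have "isCont K 0"
    using assms continuous_on_eq_continuous_at by blast
  then have "(K \<longlongrightarrow> K 0) (at 0)"
    by (simp add: isCont_def)
  moreover have "\<forall>\<^sub>F e in at 0. K e = 0"
    unfolding eventually_at_topological using assms by blast
  then have "(K \<longlongrightarrow> 0) (at 0)"
    by (rule tendsto_eventually)
  ultimately show ?thesis
    using tendsto_unique[OF trivial_limit_at] by blast
qed

text \<open>
  Each of the finitely many non-zero forms excludes at most one slope.
\<close>

lemma transverse_direction:
  fixes a b :: "nat \<Rightarrow> complex"
  assumes "\<And>i. i < d \<Longrightarrow> a i \<noteq> 0 \<or> b i \<noteq> 0"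
  obtains s where "\<And>i. i < d \<Longrightarrow> a i * s + b i \<noteq> 0"
proof -
  have "finite (\<Union>i<d. {s. a i * s + b i = 0})"
  proof (intro finite_UN_I finite_lessThan)
    fix i assume "i \<in> {..<d}"
    then have "{s. a i * s + b i = 0} \<subseteq> {- b i / a i}"
      using assms[of i] by (cases "a i = 0") (auto simp: eq_divide_eq add_eq_0_iff mult.commute)
    then show "finite {s. a i * s + b i = 0}"
      using finite_subset by blast
  qed
  from ex_new_if_finite[OF infinite_UNIV_char_0 this] show ?thesis
    using that by auto
qed

text \<open>
  Around a point off the discriminant, a given splitting of the limit web is extended to splittings of
  the nearby webs.  On vectors written in a basis whose first vector \<open>(s, 1)\<close> is transverse to the limit web,
  the symmetric forms become polynomials of degree exactly \<open>d\<close> in one variable with simple roots; the roots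
  vary in a holomorphic family and give back factors of the symmetric forms.  At the parameter \<open>0\<close> these
  are the given factors, so the curvature of the given splitting is a limit of zeros.
\<close>

theorem flat_web_limit:
  fixes C :: "nat \<Rightarrow> complex \<Rightarrow> complex \<times> complex \<Rightarrow> complex"
  assumes co: "\<And>j. holo_family UNIV UNIV (C j)"
    and S: "\<And>e z \<xi>. S e z \<xi> = (\<Sum>j\<le>d. C j e z * fst \<xi> ^ (d - j) * snd \<xi> ^ j)"
    and flat: "\<And>e. e \<noteq> 0 \<Longrightarrow> flat_web d (S e)"
  shows "flat_web d (S 0)"
proof (cases "d < 3")
  case False
  then have d: "0 < d" "1 < d" by auto
  show ?thesis
    unfolding flat_web_def
  proof (intro allI impI ballI)
    fix U \<theta> z0 assume split: "web_splitting d (S 0) U \<theta>" and z0: "z0 \<in> U"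
    define a where "a i z = fst (\<theta> i z)" for i z
    define b where "b i z = snd (\<theta> i z)" for i z
    have U: "open U" and hola: "\<And>i. i < d \<Longrightarrow> holomorphic2_on (a i) U" and holb: "\<And>i. i < d \<Longrightarrow> holomorphic2_on (b i) U"
      and trans: "\<And>z i j. z \<in> U \<Longrightarrow> i < d \<Longrightarrow> j < d \<Longrightarrow> i \<noteq> j \<Longrightarrow> a i z * b j z \<noteq> b i z * a j z"
      and prod0: "\<And>z \<xi>. z \<in> U \<Longrightarrow> S 0 z \<xi> = (\<Prod>i<d. a i z * fst \<xi> + b i z * snd \<xi>)"
      using split unfolding web_splitting_def a_def b_def wdelta_def wedge_def by auto
    have "a i z0 \<noteq> 0 \<or> b i z0 \<noteq> 0" if "i < d" for i
    proof -
      have "(if i = 0 then 1 else 0) < d" "i \<noteq> (if i = 0 then 1 else 0)"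
        using d by auto
      then obtain j where "j < d" "i \<noteq> j"
        by blast
      then show ?thesis
        using trans[OF z0 that, of j] by auto
    qed
    then obtain s where s: "\<And>i. i < d \<Longrightarrow> a i z0 * s + b i z0 \<noteq> 0"
      using transverse_direction[of d "\<lambda>i. a i z0" "\<lambda>i. b i z0"] by blast
    (* m i is the i-th factor evaluated on the transverse vector (s, 1) *)
    define m where "m i z = a i z * s + b i z" for i z
    (* the values of the symmetric form on (1, 0) + x (s, 1), as a polynomial in x *)
    define P where "P e z = (\<Sum>j\<le>d. smult (C j e z) (monom 1 j * [:1, s:] ^ (d - j)))" for e z
    have evP: "poly (P e z) x = S e z (1 + s * x, x)" for e z x
      by (simp add: P_def S poly_sum poly_monom algebra_simps)
    have degP: "degree (P e z) \<le> d" for e z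
      unfolding P_def
    proof (intro degree_sum_le)
      fix j assume "j \<in> {..d}"
      have "degree (monom (1::complex) j * [:1, s:] ^ (d - j)) \<le> j + 1 * (d - j)"
        by (intro order_trans[OF degree_mult_le] add_mono degree_monom_le
            order_trans[OF degree_power_le] mult_right_mono) auto
      then show "degree (smult (C j e z) (monom 1 j * [:1, s:] ^ (d - j))) \<le> d"
        using \<open>j \<in> {..d}\<close> by (intro order_trans[OF degree_smult_le]) auto
    qed auto
    have coP: "holo_family UNIV U (\<lambda>e z. coeff (P e z) j)" for j
      unfolding P_def coeff_sum coeff_smult
      by (intro holo_family_sum holo_family_mult holo_family_const holo_family_subset[OF co]) auto
    have leadP: "coeff (P e z) d = S e z (s, 1)" for e z
      unfolding P_def S coeff_sum coeff_smult
      by (intro sum.cong) (auto simp: coeff_monom_mult coeff_linear_poly_power)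
    have lead0: "coeff (P 0 z) d = (\<Prod>i<d. m i z)" if "z \<in> U" for z
      unfolding leadP prod0[OF that] m_def by simp
    define \<rho> where "\<rho> i = - a i z0 / m i z0" for i
    have m0: "m i z0 \<noteq> 0" if "i < d" for i
      using s[OF that] by (simp add: m_def)
    have inj: "inj_on \<rho> {..<d}"
    proof (rule inj_onI, rule ccontr)
      fix i j assume *: "i \<in> {..<d}" "j \<in> {..<d}" "\<rho> i = \<rho> j" "i \<noteq> j"
      then have "a i z0 * m j z0 = a j z0 * m i z0"
        using m0[of i] m0[of j] by (simp add: \<rho>_def frac_eq_eq)
      then have "a i z0 * b j z0 = b i z0 * a j z0"
        by (simp add: m_def algebra_simps)
      with trans[OF z0, of i j] * show False by simp
    qed
    have lead: "coeff (P 0 z0) d \<noteq> 0"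
      unfolding lead0[OF z0] using m0 by simp
    have root: "poly (P 0 z0) (\<rho> i) = 0" if "i < d" for i
    proof -
      have "a i z0 * (1 + s * \<rho> i) + b i z0 * \<rho> i = a i z0 + m i z0 * \<rho> i"
        by (simp add: m_def algebra_simps)
      also have "\<dots> = 0"
        using m0[OF that] by (simp add: \<rho>_def)
      finally show ?thesis
        unfolding evP prod0[OF z0] using that by auto
    qed
    obtain E V \<delta> r where EV: "open E" "0 \<in> E" "open V" "z0 \<in> V" "V \<subseteq> U" and \<delta>: "\<delta> > 0"
      and L: "\<And>e z. e \<in> E \<Longrightarrow> z \<in> V \<Longrightarrow> coeff (P e z) d \<noteq> 0"
      and fac: "\<And>e z. e \<in> E \<Longrightarrow> z \<in> V \<Longrightarrow> P e z = smult (coeff (P e z) d) (\<Prod>i<d. [:- r i e z, 1:])"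
      and injr: "\<And>e z. e \<in> E \<Longrightarrow> z \<in> V \<Longrightarrow> inj_on (\<lambda>i. r i e z) {..<d}"
      and holr: "\<And>i. i < d \<Longrightarrow> holo_family E V (r i)"
      and uniq: "\<And>i e z x. i < d \<Longrightarrow> e \<in> E \<Longrightarrow> z \<in> V \<Longrightarrow> norm (x - \<rho> i) < \<delta> \<Longrightarrow> poly (P e z) x = 0 \<Longrightarrow> x = r i e z"
      proof (rule simple_roots_holo_family[OF U z0 coP degP lead inj root])
        fix E V r \<delta>
        assume *: "open E" "0 \<in> E" "open V" "z0 \<in> V" "V \<subseteq> U" "\<delta> > 0"
          "\<And>e z. e \<in> E \<Longrightarrow> z \<in> V \<Longrightarrow> coeff (P e z) d \<noteq> 0"
          "\<And>e z. e \<in> E \<Longrightarrow> z \<in> V \<Longrightarrow> P e z = smult (coeff (P e z) d) (\<Prod>i<d. [:- r i e z, 1:])"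
          "\<And>e z. e \<in> E \<Longrightarrow> z \<in> V \<Longrightarrow> inj_on (\<lambda>i. r i e z) {..<d}"
          "\<And>i. i < d \<Longrightarrow> holo_family E V (r i)"
          "\<And>i e z x. i < d \<Longrightarrow> e \<in> E \<Longrightarrow> z \<in> V \<Longrightarrow> norm (x - \<rho> i) < \<delta> \<Longrightarrow> poly (P e z) x = 0 \<Longrightarrow> x = r i e z"
        show thesis
          by (rule that[OF *])
      qed
    have mV: "m i z \<noteq> 0" if "i < d" "z \<in> V" for i z
      using L[OF EV(2) that(2)] lead0[of z] EV(5) that by auto
    have holm: "holomorphic2_on (m i) V" if "i < d" for i
      using hola[OF that] holb[OF that] EV(5) unfolding m_def
      by (intro holomorphic2_intros) (auto intro: holomorphic2_on_subset)
    (* on W the root of the i-th given factor stays in the i-th disc, so that it is r i 0 *)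
    define W where "W = V \<inter> (\<Inter>i<d. V \<inter> (\<lambda>z. - a i z / m i z) -` ball (\<rho> i) \<delta>)"
    have W: "open W" "z0 \<in> W" "W \<subseteq> V"
    proof -
      have "open (V \<inter> (\<lambda>z. - a i z / m i z) -` ball (\<rho> i) \<delta>)" if "i < d" for i
      proof (rule continuous_open_preimage[OF _ EV(3) open_ball])
        show "continuous_on V (\<lambda>z. - a i z / m i z)"
          using holomorphic2_on_imp_continuous_on[OF holm[OF that]]
            continuous_on_subset[OF holomorphic2_on_imp_continuous_on[OF hola[OF that]] EV(5)] mV[OF that]
          by (intro continuous_intros) auto
      qed
      then show "open W"
        unfolding W_def using EV(3) by (intro open_Int open_INT) auto
      show "z0 \<in> W" "W \<subseteq> V"
        using EV(4) \<delta> by (auto simp: W_def \<rho>_def)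
    qed
    have r0: "r i 0 z = - a i z / m i z" if "i < d" "z \<in> W" for i z
    proof (rule uniq[symmetric])
      show "z \<in> V" using that W by auto
      have "- a i z / m i z \<in> ball (\<rho> i) \<delta>"
        using that unfolding W_def by blast
      then show "norm (- a i z / m i z - \<rho> i) < \<delta>"
        unfolding mem_ball dist_norm by (subst norm_minus_commute)
      have "a i z * (1 + s * x) + b i z * x = a i z + m i z * x" for x
        by (simp add: m_def algebra_simps)
      from this[of "- a i z / m i z"]
      have "a i z * (1 + s * (- a i z / m i z)) + b i z * (- a i z / m i z) = a i z + m i z * (- a i z / m i z)" .
      also have "\<dots> = 0"
        using mV[OF that(1) \<open>z \<in> V\<close>] by simp
      finally have "\<exists>i\<in>{..<d}. a i z * (1 + s * (- a k z / m k z)) + b i z * (- a k z / m k z) = 0" if "k = i" for k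
        using \<open>i < d\<close> that by blast
      moreover have "z \<in> U"
        using EV(5) \<open>z \<in> V\<close> by blast
      ultimately show "poly (P 0 z) (- a i z / m i z) = 0"
        unfolding evP by (simp only: prod0 fst_conv snd_conv prod_zero finite_lessThan)
    qed (use that EV in auto)
    (* the first factor absorbs the change of the leading coefficient *)
    define f where "f e i z = (if i = 0 then coeff (P e z) d / coeff (P 0 z) d else 1) * m i z" for e and i :: nat and z
    define \<theta>' where "\<theta>' e i z = (- f e i z * r i e z, f e i z * (1 + s * r i e z))" for e i z
    have holf: "holo_family E W (\<lambda>e. f e i)" if "i < d" for i
    proof -
      have "holo_family E W (\<lambda>e. m i)"
        using holm[OF that] W(3) by (intro holo_family_of_fun) (auto intro: holomorphic2_on_subset)
      moreover have "holo_family E W (\<lambda>e z. coeff (P e z) d / coeff (P 0 z) d)"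
      proof (intro holo_family_divide)
        show "holo_family E W (\<lambda>e z. coeff (P e z) d)"
          using W(3) EV(5) by (intro holo_family_subset[OF coP[of d]]) auto
        have "holomorphic2_on (\<lambda>z. coeff (P 0 z) d) W"
          using coP[of d] W(3) EV(5) unfolding holo_family_def by (auto intro: holomorphic2_on_subset)
        then show "holo_family E W (\<lambda>e z. coeff (P 0 z) d)"
          by (rule holo_family_of_fun)
      qed (use L EV W in auto)
      ultimately show ?thesis
        unfolding f_def using holo_family_mult[of E W "\<lambda>e z. coeff (P e z) d / coeff (P 0 z) d" "\<lambda>e. m i"]
        by (cases "i = 0") simp_all
    qed
    have hol\<theta>': "holo_family_form E W (\<lambda>e. \<theta>' e i)" if "i < d" for i
    proof -
      have "holo_family E W (r i)"
        using W(3) by (intro holo_family_subset[OF holr[OF that]]) auto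
      then show ?thesis
        using holf[OF that] unfolding holo_family_form_def \<theta>'_def fst_conv snd_conv
        by (intro conjI holo_family_intros)
    qed
    have WV: "z \<in> V" if "z \<in> W" for z
      using that W(3) by blast
    have fne: "f e i z \<noteq> 0" if "e \<in> E" "z \<in> W" "i < d" for e i z
      using L[OF that(1) WV[OF that(2)]] L[OF EV(2) WV[OF that(2)]] mV[OF that(3) WV[OF that(2)]]
      by (simp add: f_def)
    have trans': "wdelta (\<theta>' e i) (\<theta>' e j) z \<noteq> 0" if "e \<in> E" "z \<in> W" "i < d" "j < d" "i \<noteq> j" for e z i j
    proof -
      have "wdelta (\<theta>' e i) (\<theta>' e j) z = f e i z * f e j z * (r j e z - r i e z)"
        by (simp add: wdelta_def wedge_def \<theta>'_def algebra_simps)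
      moreover have "r i e z \<noteq> r j e z"
        using injr[OF that(1) WV[OF that(2)]] that(3-5) by (auto simp: inj_on_def)
      ultimately show ?thesis
        using fne that by auto
    qed
    have prodf: "(\<Prod>i<d. f e i z) = coeff (P e z) d" if "e \<in> E" "z \<in> W" for e z
    proof -
      have "(\<Prod>i<d. f e i z) = (\<Prod>i<d. if i = 0 then coeff (P e z) d / coeff (P 0 z) d else 1) * (\<Prod>i<d. m i z)"
        by (simp add: f_def prod.distrib)
      also have "(\<Prod>i<d. if i = 0 then coeff (P e z) d / coeff (P 0 z) d else 1) = coeff (P e z) d / coeff (P 0 z) d"
        using d by (simp add: prod.delta)
      also have "(\<Prod>i<d. m i z) = coeff (P 0 z) d"
        using lead0[of z] WV[OF that(2)] EV(5) by auto
      finally show ?thesis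
        using L[OF EV(2) WV[OF that(2)]] by simp
    qed
    have factor: "S e z \<xi> = (\<Prod>i<d. fst (\<theta>' e i z) * fst \<xi> + snd (\<theta>' e i z) * snd \<xi>)"
      if ez: "e \<in> E" "z \<in> W" for e z \<xi>
    proof -
      define y where "y = fst \<xi> - s * snd \<xi>"
      have "(\<Prod>i<d. fst (\<theta>' e i z) * fst \<xi> + snd (\<theta>' e i z) * snd \<xi>) = (\<Prod>i<d. f e i z * (snd \<xi> - r i e z * y))"
        by (intro prod.cong) (auto simp: \<theta>'_def y_def algebra_simps)
      also have "\<dots> = coeff (P e z) d * (\<Prod>i<d. snd \<xi> - r i e z * y)"
        by (simp add: prod.distrib prodf[OF ez])
      also have "\<dots> = S e z \<xi>"
      proof (cases "y = 0")
        case True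
        then have \<xi>: "fst \<xi> = s * snd \<xi>" by (simp add: y_def)
        have "S e z \<xi> = snd \<xi> ^ d * S e z (s, 1)"
          unfolding S sum_distrib_left
          by (intro sum.cong) (auto simp: \<xi> power_mult_distrib algebra_simps simp flip: power_add)
        then show ?thesis
          using True by (simp add: leadP)
      next
        case False
        (* \<xi> is y times the vector (1, 0) + x (s, 1) on which P is defined *)
        define x where "x = snd \<xi> / y"
        have \<xi>: "fst \<xi> = y * (1 + s * x)" "snd \<xi> = y * x"
          using False by (auto simp: x_def y_def field_simps)
        have "S e z \<xi> = y ^ d * S e z (1 + s * x, x)"
          unfolding S sum_distrib_left
        proof (rule sum.cong)
          fix j assume "j \<in> {..d}"
          then have "y ^ d = y ^ (d - j) * y ^ j"
            by (simp flip: power_add)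
          then show "C j e z * fst \<xi> ^ (d - j) * snd \<xi> ^ j
              = y ^ d * (C j e z * fst (1 + s * x, x) ^ (d - j) * snd (1 + s * x, x) ^ j)"
            by (simp only: \<xi> power_mult_distrib fst_conv snd_conv mult_ac)
        qed simp
        also have "S e z (1 + s * x, x) = coeff (P e z) d * (\<Prod>i<d. x - r i e z)"
          using arg_cong[OF fac[OF ez(1) WV[OF ez(2)]], of "\<lambda>p. poly p x"] by (simp add: evP poly_prod)
        also have "y ^ d * (coeff (P e z) d * (\<Prod>i<d. x - r i e z)) = coeff (P e z) d * (\<Prod>i<d. y * (x - r i e z))"
          by (simp add: prod.distrib)
        finally show ?thesis
          by (simp add: \<xi> algebra_simps)
      qed
      finally show ?thesis by simp
    qed
    have "web_splitting d (S e) W (\<theta>' e)" if "e \<in> E" for e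
      unfolding web_splitting_def
    proof (intro conjI ballI allI impI)
      fix i assume "i < d"
      then show "holomorphic2_on (\<lambda>z. fst (\<theta>' e i z)) W" "holomorphic2_on (\<lambda>z. snd (\<theta>' e i z)) W"
        using hol\<theta>' that by (auto simp: holo_family_form_def holo_family_def)
    qed (use W(1) trans' factor that in auto)
    then have "web_curvature d (\<theta>' e) z0 = 0" if "e \<in> E" "e \<noteq> 0" for e
      using flat[OF that(2)] that(1) W(2) unfolding flat_web_def by blast
    moreover have "continuous_on E (\<lambda>e. web_curvature d (\<theta>' e) z0)"
    proof -
      have "holo_family E W (\<lambda>e. web_curvature d (\<theta>' e))"
        using W(1) hol\<theta>' trans' by (intro holo_family_web_curvature) auto
      then have *: "continuous_on (E \<times> W) (\<lambda>p. web_curvature d (\<theta>' (fst p)) (snd p))"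
        by (simp add: holo_family_def split_beta)
      show ?thesis
        using W(2) by (auto intro!: continuous_on_compose2[OF *, where f = "\<lambda>e. (e, z0)", unfolded fst_conv snd_conv]
            continuous_intros)
    qed
    ultimately have "web_curvature d (\<theta>' 0) z0 = 0"
      using zero_at_limit_param[OF EV(1,2)] by blast
    moreover have "\<theta>' 0 i z = \<theta> i z" if "i < d" "z \<in> W" for i z
    proof -
      have f0: "f 0 i z = m i z"
        using L[OF EV(2) WV[OF that(2)]] by (simp add: f_def)
      have m: "m i z \<noteq> 0"
        using mV[OF that(1) WV[OF that(2)]] .
      have fr: "f 0 i z * r i 0 z = - a i z"
        using m by (simp add: f0 r0[OF that])
      have "\<theta>' 0 i z = (- (f 0 i z * r i 0 z), f 0 i z + s * (f 0 i z * r i 0 z))"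
        by (simp add: \<theta>'_def algebra_simps)
      also have "\<dots> = (a i z, b i z)"
        unfolding fr unfolding f0 by (simp add: m_def)
      finally show ?thesis
        by (simp add: a_def b_def)
    qed
    ultimately show "web_curvature d \<theta> z0 = 0"
      using web_curvature_cong[OF W(1,2), of d "\<theta>' 0" \<theta>] by auto
  qed
qed (rule flat_web_few)

section \<open>Homogeneous polynomials\<close>

text \<open>
  Sums of monomials of a fixed degree, as an induction principle; this is \<^const>\<open>homog_poly3\<close> by
  \<open>homog_poly3_iff_hpoly\<close>.
\<close>

inductive hpoly :: "nat \<Rightarrow> (complex^3 \<Rightarrow> complex) \<Rightarrow> bool" where
  monomial: "i + j + k = n \<Longrightarrow> hpoly n (\<lambda>v. c * (v $ 1) ^ i * (v $ 2) ^ j * (v $ 3) ^ k)"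
| add: "hpoly n f \<Longrightarrow> hpoly n g \<Longrightarrow> hpoly n (\<lambda>v. f v + g v)"

lemma hpoly_zero: "hpoly n (\<lambda>v. 0)"
  using hpoly.monomial[of n 0 0 n 0] by simp

lemma hpoly_scale: "hpoly n f \<Longrightarrow> hpoly n (\<lambda>v. c * f v)"
proof (induction rule: hpoly.induct)
  case (monomial i j k n a)
  then show ?case
    using hpoly.monomial[of i j k n "c * a"] by (simp add: algebra_simps)
next
  case (add n f g)
  then show ?case
    using hpoly.add[of n "\<lambda>v. c * f v" "\<lambda>v. c * g v"] by (simp add: algebra_simps)
qed

lemma hpoly_sum: "(\<And>i. i \<in> I \<Longrightarrow> hpoly n (f i)) \<Longrightarrow> hpoly n (\<lambda>v. \<Sum>i\<in>I. f i v)"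
  by (induction I rule: infinite_finite_induct) (auto intro: hpoly_zero hpoly.add)

lemma hpoly_mult:
  assumes "hpoly m f" "hpoly n g"
  shows "hpoly (m + n) (\<lambda>v. f v * g v)"
  using assms
proof (induction arbitrary: n g rule: hpoly.induct)
  case (monomial i j k m a)
  from monomial(2,1) show ?case
  proof (induction arbitrary: rule: hpoly.induct)
    case (monomial i' j' k' n b)
    then show ?case
      using hpoly.monomial[of "i + i'" "j + j'" "k + k'" "m + n" "a * b"]
      by (simp add: algebra_simps power_add)
  next
    case (add n f g)
    then show ?case
      using hpoly.add[OF add.IH] by (simp add: algebra_simps)
  qed
next
  case (add m f1 f2)
  then show ?case
    using hpoly.add[OF add.IH(1)[OF add.prems] add.IH(2)[OF add.prems]] by (simp add: algebra_simps)
qed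

lemma hpoly_const: "hpoly 0 (\<lambda>v. c)"
  using hpoly.monomial[of 0 0 0 0 c] by simp

lemma hpoly_coord: "hpoly 1 (\<lambda>v. v $ i)"
proof -
  have "i = 1 \<or> i = 2 \<or> i = 3" by (rule exhaust_3)
  then show ?thesis
    using hpoly.monomial[of 1 0 0 1 1] hpoly.monomial[of 0 1 0 1 1] hpoly.monomial[of 0 0 1 1 1] by auto
qed

lemma hpoly_power: "hpoly n f \<Longrightarrow> hpoly (k * n) (\<lambda>v. f v ^ k)"
  by (induction k) (auto intro: hpoly_const hpoly_mult)

lemma hpoly_linear_subst:
  assumes "hpoly n f"
  shows "hpoly n (\<lambda>v. f (g *v v))"
  using assms
proof (induction rule: hpoly.induct)
  case (monomial i j k n c)
  have lin: "hpoly 1 (\<lambda>v. (g *v v) $ i)" for i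
    unfolding matrix_vector_mult_def vec_lambda_beta
    by (intro hpoly_sum hpoly_scale hpoly_coord)
  have "hpoly (0 + i * 1 + j * 1 + k * 1) (\<lambda>v. c * (g *v v) $ 1 ^ i * (g *v v) $ 2 ^ j * (g *v v) $ 3 ^ k)"
    by (intro hpoly_mult hpoly_power hpoly_const lin)
  with monomial show ?case by simp
qed (rule hpoly.add)

lemma homog_poly3_iff_hpoly: "homog_poly3 n f \<longleftrightarrow> hpoly n f"
proof
  assume "homog_poly3 n f"
  then obtain c where c: "\<And>v. f v =
     (\<Sum>i\<le>n. \<Sum>j\<le>n - i. c i j * (v $ 1) ^ i * (v $ 2) ^ j * (v $ 3) ^ (n - i - j))"
    unfolding homog_poly3_def by blast
  have "hpoly n (\<lambda>v. \<Sum>i\<le>n. \<Sum>j\<le>n - i. c i j * (v $ 1) ^ i * (v $ 2) ^ j * (v $ 3) ^ (n - i - j))"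
    by (intro hpoly_sum hpoly.monomial) auto
  then show "hpoly n f"
    using c by presburger
next
  assume "hpoly n f"
  then show "homog_poly3 n f"
  proof (induction rule: hpoly.induct)
    case (monomial i j k n c)
    define a where "a i' j' = (if i' = i \<and> j' = j then c else 0)" for i' j'
    have "c * (v $ 1) ^ i * (v $ 2) ^ j * (v $ 3) ^ k =
      (\<Sum>i'\<le>n. \<Sum>j'\<le>n - i'. a i' j' * (v $ 1) ^ i' * (v $ 2) ^ j' * (v $ 3) ^ (n - i' - j'))" for v :: "complex^3"
    proof -
      have "(\<Sum>i'\<le>n. \<Sum>j'\<le>n - i'. a i' j' * (v $ 1) ^ i' * (v $ 2) ^ j' * (v $ 3) ^ (n - i' - j'))
        = (\<Sum>i'\<le>n. if i' = i then c * (v $ 1) ^ i * (v $ 2) ^ j * (v $ 3) ^ k else 0)"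
      proof (rule sum.cong[OF refl])
        fix i' assume "i' \<in> {..n}"
        show "(\<Sum>j'\<le>n - i'. a i' j' * (v $ 1) ^ i' * (v $ 2) ^ j' * (v $ 3) ^ (n - i' - j'))
          = (if i' = i then c * (v $ 1) ^ i * (v $ 2) ^ j * (v $ 3) ^ k else 0)"
        proof (cases "i' = i")
          case True
          have k: "k = n - i - j" "j \<le> n - i"
            using monomial by auto
          have "(\<Sum>j'\<le>n - i'. a i' j' * (v $ 1) ^ i' * (v $ 2) ^ j' * (v $ 3) ^ (n - i' - j'))
            = (\<Sum>j'\<le>n - i. if j' = j then c * (v $ 1) ^ i * (v $ 2) ^ j * (v $ 3) ^ k else 0)"
            using True by (intro sum.cong) (auto simp: a_def k(1))
          then show ?thesis
            using True k(2) by simp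
        qed (simp add: a_def)
      qed
      also have "\<dots> = c * (v $ 1) ^ i * (v $ 2) ^ j * (v $ 3) ^ k"
        using monomial by simp
      finally show ?thesis by simp
    qed
    then show ?case
      unfolding homog_poly3_def by blast
  next
    case (add n f g)
    obtain a b where
      "\<And>v. f v = (\<Sum>i\<le>n. \<Sum>j\<le>n - i. a i j * (v $ 1) ^ i * (v $ 2) ^ j * (v $ 3) ^ (n - i - j))"
      "\<And>v. g v = (\<Sum>i\<le>n. \<Sum>j\<le>n - i. b i j * (v $ 1) ^ i * (v $ 2) ^ j * (v $ 3) ^ (n - i - j))"
      using add.IH unfolding homog_poly3_def by blast
    then have "\<And>v. f v + g v =
        (\<Sum>i\<le>n. \<Sum>j\<le>n - i. (a i j + b i j) * (v $ 1) ^ i * (v $ 2) ^ j * (v $ 3) ^ (n - i - j))"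
      by (simp add: sum.distrib algebra_simps)
    then show ?case
      unfolding homog_poly3_def by (intro exI[of _ "\<lambda>i j. a i j + b i j"]) blast
  qed
qed

lemma hpoly_homogeneous: "hpoly n f \<Longrightarrow> f (c *s v) = c ^ n * f v"
  by (induction rule: hpoly.induct) (auto simp: power_mult_distrib power_add algebra_simps)

lemma dot_add_left: "dot (a + b) v = dot a v + dot b v"
  by (simp add: dot_def algebra_simps sum.distrib)

lemma dot_scale_left: "dot (c *s a) v = c * dot a v"
  by (simp add: dot_def algebra_simps sum_distrib_left)

lemma dot_axis: "dot (axis i c) v = c * v $ i"
proof -
  have "dot (axis i c) v = (\<Sum>j\<in>UNIV. if j = i then c * v $ i else 0)"
    unfolding dot_def by (intro sum.cong) (auto simp: axis_def)
  then show ?thesis by simp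
qed

definition complex_differentiable_at :: "(complex^3 \<Rightarrow> complex) \<Rightarrow> complex^3 \<Rightarrow> bool"
  where "complex_differentiable_at f v \<longleftrightarrow> (\<exists>a. (f has_derivative dot a) (at v))"

lemma complex_differentiable_const: "complex_differentiable_at (\<lambda>v. c) v"
proof -
  have "((\<lambda>v. c) has_derivative dot 0) (at v)"
    by (simp add: dot_def[abs_def])
  then show ?thesis unfolding complex_differentiable_at_def by blast
qed

lemma complex_differentiable_coord: "complex_differentiable_at (\<lambda>v. v $ i) v"
proof -
  have "((\<lambda>v. v $ i) has_derivative (\<lambda>v. v $ i)) (at v)"
    by (rule bounded_linear_imp_has_derivative[OF bounded_linear_vec_nth])
  moreover have "(\<lambda>v. v $ i) = dot (axis i 1)"
    by (simp add: fun_eq_iff dot_axis)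
  ultimately show ?thesis unfolding complex_differentiable_at_def by metis
qed

lemma complex_differentiable_add:
  assumes "complex_differentiable_at f v" "complex_differentiable_at g v"
  shows "complex_differentiable_at (\<lambda>v. f v + g v) v"
proof -
  obtain a b where "(f has_derivative dot a) (at v)" "(g has_derivative dot b) (at v)"
    using assms unfolding complex_differentiable_at_def by blast
  from has_derivative_add[OF this] have "((\<lambda>v. f v + g v) has_derivative dot (a + b)) (at v)"
    by (simp add: dot_add_left[abs_def])
  then show ?thesis unfolding complex_differentiable_at_def by blast
qed

lemma complex_differentiable_mult:
  assumes "complex_differentiable_at f v" "complex_differentiable_at g v"
  shows "complex_differentiable_at (\<lambda>v. f v * g v) v"
proof -
  obtain a b where "(f has_derivative dot a) (at v)" "(g has_derivative dot b) (at v)"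
    using assms unfolding complex_differentiable_at_def by blast
  from has_derivative_mult[OF this]
  have "((\<lambda>v. f v * g v) has_derivative dot (f v *s b + g v *s a)) (at v)"
    by (simp add: dot_add_left[abs_def] dot_scale_left[abs_def] mult.commute)
  then show ?thesis unfolding complex_differentiable_at_def by blast
qed

lemma complex_differentiable_power:
  "complex_differentiable_at f v \<Longrightarrow> complex_differentiable_at (\<lambda>v. f v ^ k) v"
  by (induction k) (auto intro: complex_differentiable_const complex_differentiable_mult)

lemma hpoly_complex_differentiable: "hpoly n f \<Longrightarrow> complex_differentiable_at f v"
  by (induction rule: hpoly.induct)
    (auto intro!: complex_differentiable_const complex_differentiable_coord complex_differentiable_add
      complex_differentiable_mult complex_differentiable_power)

text \<open>
  On the line \<open>y = p x - q\<close> a polynomial becomes a polynomial in \<open>x\<close> whose coefficients are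
  polynomials in \<open>(p, q)\<close>.
\<close>

section \<open>Coefficients of the Legendre transform\<close>

lemma hpoly_restrict_line_family:
  assumes "hpoly n f"
  shows "\<exists>\<Phi>. (\<forall>j. holomorphic2_on (\<lambda>z. coeff (\<Phi> z) j) UNIV) \<and>
    (\<forall>z x. poly (\<Phi> z) x = f (vector [x, fst z * x - snd z, 1]))"
  using assms
proof (induction rule: hpoly.induct)
  case (monomial i j k n c)
  have mult: "\<forall>j. holomorphic2_on (\<lambda>z. coeff (\<Phi> z * \<Psi> z) j) UNIV"
    if "\<forall>j. holomorphic2_on (\<lambda>z. coeff (\<Phi> z) j) UNIV" "\<forall>j. holomorphic2_on (\<lambda>z. coeff (\<Psi> z) j) UNIV"
    for \<Phi> \<Psi> :: "complex \<times> complex \<Rightarrow> complex poly"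
    using that by (auto simp: coeff_mult intro!: holomorphic2_intros)
  have lin: "\<forall>j. holomorphic2_on (\<lambda>z. coeff [:- snd z, fst z:] j) UNIV"
  proof
    fix j
    show "holomorphic2_on (\<lambda>z. coeff [:- snd z, fst z:] j) UNIV"
    proof (cases j)
      case 0
      then show ?thesis by (simp add: holomorphic2_on_uminus holomorphic2_on_snd)
    next
      case (Suc k)
      then show ?thesis
        by (cases k) (simp_all add: holomorphic2_on_fst holomorphic2_on_const)
    qed
  qed
  have const: "\<forall>j. holomorphic2_on (\<lambda>z. coeff p j) UNIV" for p :: "complex poly"
    by (auto intro: holomorphic2_on_const)
  have pow: "\<forall>k. holomorphic2_on (\<lambda>z. coeff ([:- snd z, fst z:] ^ j) k) UNIV" for j
  proof (induction j)
    case 0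
    show ?case using const[of 1] by simp
  next
    case (Suc j)
    show ?case unfolding power_Suc by (rule mult[OF lin Suc])
  qed
  show ?case
    by (rule exI[of _ "\<lambda>z. monom c i * [:- snd z, fst z:] ^ j"])
      (use mult[OF const[of "monom c i"] pow[of j]] in \<open>auto simp: poly_monom algebra_simps\<close>)
next
  case (add n f g)
  then obtain \<Phi> \<Psi> where
    "\<forall>j. holomorphic2_on (\<lambda>z. coeff (\<Phi> z) j) UNIV" "\<forall>z x. poly (\<Phi> z) x = f (vector [x, fst z * x - snd z, 1])"
    "\<forall>j. holomorphic2_on (\<lambda>z. coeff (\<Psi> z) j) UNIV" "\<forall>z x. poly (\<Psi> z) x = g (vector [x, fst z * x - snd z, 1])"
    by blast
  then show ?case
    by (intro exI[of _ "\<lambda>z. \<Phi> z + \<Psi> z"]) (auto intro: holomorphic2_intros)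
qed

text \<open>
  The Legendre polynomial is linear in the form, hence polynomial in a parameter on which the form depends
  polynomially.
\<close>

lemma holo_family_legendre_coeff:
  assumes hp: "\<And>k i. k \<in> K \<Longrightarrow> hpoly n (\<lambda>v. G k v $ i)"
  shows "holo_family UNIV UNIV (\<lambda>t z. coeff (legendre_poly (\<lambda>v. \<Sum>k\<in>K. t ^ m k *s G k v) (fst z) (snd z)) j)"
proof -
  have "\<forall>k\<in>K. \<exists>\<Phi>. (\<forall>j. holomorphic2_on (\<lambda>z. coeff (\<Phi> z) j) UNIV) \<and>
    (\<forall>z x. poly (\<Phi> z) x = G k (vector [x, fst z * x - snd z, 1]) $ i)" for i
    using hpoly_restrict_line_family[OF hp] by blast
  then have "\<exists>\<Phi>. \<forall>k\<in>K. (\<forall>j. holomorphic2_on (\<lambda>z. coeff (\<Phi> k z) j) UNIV) \<and>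
    (\<forall>z x. poly (\<Phi> k z) x = G k (vector [x, fst z * x - snd z, 1]) $ i)" for i
    by (rule bchoice)
  then obtain \<Phi> \<Psi> where
    \<Phi>: "\<And>k j. k \<in> K \<Longrightarrow> holomorphic2_on (\<lambda>z. coeff (\<Phi> k z) j) UNIV"
      "\<And>k z x. k \<in> K \<Longrightarrow> poly (\<Phi> k z) x = G k (vector [x, fst z * x - snd z, 1]) $ 1" and
    \<Psi>: "\<And>k j. k \<in> K \<Longrightarrow> holomorphic2_on (\<lambda>z. coeff (\<Psi> k z) j) UNIV"
      "\<And>k z x. k \<in> K \<Longrightarrow> poly (\<Psi> k z) x = G k (vector [x, fst z * x - snd z, 1]) $ 2"
    by metis
  have leg: "legendre_poly (\<lambda>v. \<Sum>k\<in>K. t ^ m k *s G k v) (fst z) (snd z) =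
      (\<Sum>k\<in>K. smult (t ^ m k) (\<Phi> k z + smult (fst z) (\<Psi> k z)))" (is "_ = ?P") for t z
    unfolding legendre_poly_def
  proof (rule the_equality)
    have ev: "poly ?P x = affA (\<lambda>v. \<Sum>k\<in>K. t ^ m k *s G k v) (x, fst z * x - snd z)
        + fst z * affB (\<lambda>v. \<Sum>k\<in>K. t ^ m k *s G k v) (x, fst z * x - snd z)" for x
      by (simp add: affA_def affB_def poly_sum \<Phi>(2) \<Psi>(2) sum_distrib_left algebra_simps flip: sum.distrib
          cong: sum.cong)
    then show "\<forall>x. poly ?P x = affA (\<lambda>v. \<Sum>k\<in>K. t ^ m k *s G k v) (x, fst z * x - snd z)
        + fst z * affB (\<lambda>v. \<Sum>k\<in>K. t ^ m k *s G k v) (x, fst z * x - snd z)"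
      by blast
    fix P assume "\<forall>x. poly P x = affA (\<lambda>v. \<Sum>k\<in>K. t ^ m k *s G k v) (x, fst z * x - snd z)
        + fst z * affB (\<lambda>v. \<Sum>k\<in>K. t ^ m k *s G k v) (x, fst z * x - snd z)"
    then show "P = ?P"
      using ev by (simp add: poly_eq_poly_eq_iff[symmetric] fun_eq_iff)
  qed
  show ?thesis
    unfolding leg coeff_sum coeff_smult coeff_add
    by (intro holo_family_sum holo_family_mult holo_family_add holo_family_of_param holo_family_of_fun
        holomorphic2_on_fst \<Phi>(1) \<Psi>(1) continuous_intros)
qed

section \<open>Weights and degeneration along a line\<close>

definition hform :: "nat \<Rightarrow> (complex^3 \<Rightarrow> complex^3) \<Rightarrow> bool"
  where "hform n \<omega> \<longleftrightarrow> (\<forall>i. hpoly n (\<lambda>v. \<omega> v $ i))"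

lemma hform_pullback: "hform n \<omega> \<Longrightarrow> hform n (pullback g \<omega>)"
  unfolding hform_def pullback_def matrix_vector_mult_def[of "transpose g"] vec_lambda_beta
  by (intro allI hpoly_sum hpoly_scale hpoly_linear_subst) auto

lemma hform_homogeneous: "hform n \<omega> \<Longrightarrow> \<omega> (c *s v) = c ^ n *s \<omega> v"
  unfolding hform_def vec_eq_iff by (metis hpoly_homogeneous vector_smult_component)

lemma dot_commute: "dot u v = dot v u"
  by (simp add: dot_def mult.commute)

lemma dot_transpose: "dot u (transpose g *v a) = dot (g *v u) a"
proof -
  have "dot u (transpose g *v a) = (\<Sum>i\<in>UNIV. \<Sum>j\<in>UNIV. u $ i * (g $ j $ i * a $ j))"
    by (simp add: dot_def matrix_vector_mult_def transpose_def sum_distrib_left)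
  also have "\<dots> = (\<Sum>j\<in>UNIV. \<Sum>i\<in>UNIV. u $ i * (g $ j $ i * a $ j))"
    by (rule sum.swap)
  also have "\<dots> = dot (g *v u) a"
    by (simp add: dot_def matrix_vector_mult_def sum_distrib_left sum_distrib_right mult_ac)
  finally show ?thesis .
qed

lemma dot_sum_left: "dot (\<Sum>k\<in>K. f k) v = (\<Sum>k\<in>K. dot (f k) v)"
  by (simp add: dot_def sum_component sum_distrib_right) (rule sum.swap)

lemma dot_pullback: "dot u (pullback g \<omega> v) = dot (g *v u) (\<omega> (g *v v))"
  unfolding pullback_def by (rule dot_transpose)

lemma pullback_compose: "pullback g (pullback h \<omega>) = pullback (h ** g) \<omega>"
  by (simp only: fun_eq_iff pullback_def matrix_vector_mul_assoc matrix_transpose_mul) simp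

lemma pullback_sum: "pullback g (\<lambda>v. \<Sum>k\<in>K. c k *s G k v) = (\<lambda>v. \<Sum>k\<in>K. c k *s pullback g (G k) v)"
  by (simp add: fun_eq_iff pullback_def vec_eq_iff matrix_vector_mult_def sum_distrib_left mult_ac)
    (intro allI sum.swap)

lemma pullback_mat_1: "pullback (mat 1) \<omega> = \<omega>"
  by (simp add: fun_eq_iff pullback_def)

lemma dot_eq_0_all: "(\<And>w. dot w a = 0) \<Longrightarrow> a = 0"
  by (simp add: vec_eq_iff) (metis dot_axis mult_1)

definition diag3 :: "complex \<Rightarrow> complex \<Rightarrow> complex^3^3"
  where "diag3 a b = (\<chi> i j. if i \<noteq> j then 0 else if i = 3 then b else a)"

lemma homothety_eq_diag3: "homothety t = diag3 t 1"
  by (simp add: homothety_def diag3_def)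

lemma transpose_diag3: "transpose (diag3 a b) = diag3 a b"
  by (simp add: transpose_def diag3_def vec_eq_iff)

lemma diag3_mult_vec: "(diag3 a b *v v) $ i = (if i = 3 then b else a) * v $ i"
proof -
  have "(diag3 a b *v v) $ i = (\<Sum>j\<in>UNIV. if j = i then (if i = 3 then b else a) * v $ i else 0)"
    unfolding matrix_vector_mult_def diag3_def vec_lambda_beta by (intro sum.cong) auto
  then show ?thesis by simp
qed

lemma pullback_diag3: "pullback (diag3 a b) \<omega> v $ i = (if i = 3 then b else a) * \<omega> (diag3 a b *v v) $ i"
  by (simp add: pullback_def transpose_diag3 diag3_mult_vec)

lemma diag3_scale: "diag3 a (a * e) *v v = a *s (diag3 1 e *v v)"
  by (simp add: vec_eq_iff diag3_mult_vec)

lemma invertible_diag3: "a \<noteq> 0 \<Longrightarrow> b \<noteq> 0 \<Longrightarrow> invertible (diag3 a b)"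
  unfolding invertible_def
  by (intro exI[of _ "diag3 (1 / a) (1 / b)"])
    (auto simp: matrix_eq matrix_vector_mul_assoc[symmetric] vec_eq_iff diag3_mult_vec)

text \<open>
  The factor by which a function is multiplied when the third coordinate is multiplied by \<open>e\<close>; for
  polynomials, \<open>k\<close> is the exponent of \<open>z\<close>.
\<close>

definition sweight :: "nat \<Rightarrow> (complex^3 \<Rightarrow> complex) \<Rightarrow> bool"
  where "sweight k f \<longleftrightarrow> (\<forall>e v. f (diag3 1 e *v v) = e ^ k * f v)"

text \<open>
  The weight of \<open>a dx + b dy + c dz\<close>, where \<open>dz\<close> counts once.  There is no form of weight \<open>0\<close>
  with a \<open>dz\<close> part.
\<close>

definition fweight :: "nat \<Rightarrow> (complex^3 \<Rightarrow> complex^3) \<Rightarrow> bool"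
  where "fweight k \<omega> \<longleftrightarrow> sweight k (\<lambda>v. \<omega> v $ 1) \<and> sweight k (\<lambda>v. \<omega> v $ 2) \<and>
     (if k = 0 then \<forall>v. \<omega> v $ 3 = 0 else sweight (k - 1) (\<lambda>v. \<omega> v $ 3))"

lemma pullback_fweight: "fweight k \<omega> \<Longrightarrow> pullback (diag3 1 e) \<omega> v = e ^ k *s \<omega> v"
  unfolding vec_eq_iff forall_3 pullback_diag3
  by (cases k) (auto simp: fweight_def sweight_def)

lemma pullback_fweight_scaled:
  assumes "fweight k \<omega>" "hform n \<omega>"
  shows "pullback (diag3 a (a * e)) \<omega> v = (a ^ (n + 1) * e ^ k) *s \<omega> v"
proof -
  have "pullback (diag3 a (a * e)) \<omega> v = a ^ (n + 1) *s pullback (diag3 1 e) \<omega> v"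
    by (simp add: vec_eq_iff pullback_diag3 diag3_scale hform_homogeneous[OF assms(2)])
  then show ?thesis
    by (simp add: pullback_fweight[OF assms(1)])
qed

lemma sweight_decomposition:
  assumes "hpoly n f"
  shows "\<exists>F. (\<forall>k. hpoly n (F k) \<and> sweight k (F k)) \<and> (\<forall>v. f v = (\<Sum>k\<le>n. F k v))"
  using assms
proof (induction rule: hpoly.induct)
  case (monomial i j k n c)
  define m where "m v = c * (v $ 1) ^ i * (v $ 2) ^ j * (v $ 3) ^ k" for v :: "complex^3"
  have "hpoly n m"
    unfolding m_def[abs_def] using monomial by (rule hpoly.monomial)
  moreover have "sweight k m"
    by (simp add: sweight_def m_def diag3_mult_vec power_mult_distrib)
  ultimately have "hpoly n (if l = k then m else (\<lambda>v. 0)) \<and> sweight l (if l = k then m else (\<lambda>v. 0))" for l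
    by (auto simp: hpoly_zero sweight_def)
  moreover have "m v = (\<Sum>l\<le>n. (if l = k then m else (\<lambda>v. 0)) v)" for v
  proof -
    have "(\<Sum>l\<le>n. (if l = k then m else (\<lambda>v. 0)) v) = (\<Sum>l\<le>n. if l = k then m v else 0)"
      by (intro sum.cong) auto
    then show ?thesis using monomial by simp
  qed
  ultimately show ?case
    unfolding m_def[symmetric] by (intro exI[of _ "\<lambda>l. if l = k then m else (\<lambda>v. 0)"]) blast
next
  case (add n f g)
  then obtain F G where
    "\<forall>k. hpoly n (F k) \<and> sweight k (F k)" "\<forall>v. f v = (\<Sum>k\<le>n. F k v)"
    "\<forall>k. hpoly n (G k) \<and> sweight k (G k)" "\<forall>v. g v = (\<Sum>k\<le>n. G k v)"
    by blast
  then show ?case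
    by (intro exI[of _ "\<lambda>k v. F k v + G k v"])
      (auto simp: sweight_def sum.distrib algebra_simps intro: hpoly.add)
qed

lemma fweight_decomposition:
  assumes "hform n \<omega>"
  obtains G where "\<And>k. hform n (G k)" "\<And>k. fweight k (G k)" "\<And>v. \<omega> v = (\<Sum>k\<le>n + 1. G k v)"
proof -
  obtain A where A: "\<And>k. hpoly n (A k)" "\<And>k. sweight k (A k)" "\<And>v. \<omega> v $ 1 = (\<Sum>k\<le>n. A k v)"
    using sweight_decomposition[of n "\<lambda>v. \<omega> v $ 1"] assms unfolding hform_def by blast
  obtain B where B: "\<And>k. hpoly n (B k)" "\<And>k. sweight k (B k)" "\<And>v. \<omega> v $ 2 = (\<Sum>k\<le>n. B k v)"
    using sweight_decomposition[of n "\<lambda>v. \<omega> v $ 2"] assms unfolding hform_def by blast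
  obtain C where C: "\<And>k. hpoly n (C k)" "\<And>k. sweight k (C k)" "\<And>v. \<omega> v $ 3 = (\<Sum>k\<le>n. C k v)"
    using sweight_decomposition[of n "\<lambda>v. \<omega> v $ 3"] assms unfolding hform_def by blast
  define G :: "nat \<Rightarrow> complex^3 \<Rightarrow> complex^3" where
    "G k v = vector [if k \<le> n then A k v else 0, if k \<le> n then B k v else 0, if k = 0 then 0 else C (k - 1) v]" for k v
  show ?thesis
  proof (rule that)
    show "hform n (G k)" for k
      unfolding hform_def forall_3 G_def vector_3 using A(1) B(1) C(1)
      by (cases "k \<le> n"; cases "k = 0") (auto simp: hpoly_zero)
    show "fweight k (G k)" for k
      unfolding fweight_def G_def vector_3 using A(2) B(2) C(2)
      by (auto simp: sweight_def)
    show "\<omega> v = (\<Sum>k\<le>n + 1. G k v)" for v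
    proof -
      have "(\<Sum>k\<le>n + 1. if k = 0 then 0 else C (k - 1) v) = (\<Sum>k\<le>n. C k v)"
        unfolding Suc_eq_plus1[symmetric] by (subst sum.atMost_Suc_shift) simp
      then show ?thesis
        unfolding vec_eq_iff forall_3 sum_component G_def vector_3 A(3) B(3) C(3) by simp
    qed
  qed
qed

text \<open>
  The part of weight \<open>0\<close> is the pull-back of \<open>F\<close> by the projection \<open>diag3 1 0\<close> onto the line \<open>z = 0\<close>,
  which is zero by invariance; the remaining parts are numbered from \<open>0\<close>.  The relation
  \<open>dot v (F v) = 0\<close> holds for all pull-backs by \<open>diag3 1 e\<close>, hence for each coefficient of the powers of
  \<open>e\<close>.
\<close>

lemma degeneration_normalised:
  assumes F: "hform (d + 1) F" "\<And>v. dot v (F v) = 0" and inv: "invariant_line F (axis 3 1)"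
  obtains G where "\<And>k. hform (d + 1) (G k)" "\<And>k. fweight (Suc k) (G k)"
    "\<And>v. F v = (\<Sum>k\<le>d + 1. G k v)" "\<And>v. dot v (G 0 v) = 0"
proof -
  obtain G where G: "\<And>k. hform (d + 1) (G k)" "\<And>k. fweight k (G k)" "\<And>v. F v = (\<Sum>k\<le>d + 2. G k v)"
    using fweight_decomposition[OF F(1)] by (auto simp: numeral_2_eq_2)
  have pb: "pullback (diag3 1 e) F v = (\<Sum>k\<le>d + 2. e ^ k *s G k v)" for e v
    using pullback_sum[of "diag3 1 e" "\<lambda>_. 1" G "{..d + 2}"] by (simp add: G(3)[abs_def] pullback_fweight[OF G(2)])
  have G0: "G 0 v = 0" for v
  proof (rule dot_eq_0_all)
    fix w
    have "pullback (diag3 1 0) F v = (\<Sum>k\<le>d + 2. if k = 0 then G 0 v else 0)"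
      unfolding pb by (intro sum.cong) (auto simp: vec_eq_iff)
    then have "dot w (G 0 v) = dot (diag3 1 0 *v w) (F (diag3 1 0 *v v))"
      by (simp add: dot_pullback[symmetric])
    also have "\<dots> = 0"
      using inv unfolding invariant_line_def dot_axis by (simp add: dot_commute diag3_mult_vec)
    finally show "dot w (G 0 v) = 0" .
  qed
  have dotG: "dot v (G 1 v) = 0" for v
  proof -
    have "(\<Sum>k\<le>d + 2. dot v (G k v) * e ^ k) = 0" for e
    proof -
      have "dot v (pullback (diag3 1 e) F v) = 0"
        by (simp add: dot_pullback F(2))
      then have "dot (\<Sum>k\<le>d + 2. e ^ k *s G k v) v = 0"
        unfolding pb by (simp add: dot_commute)
      then have "(\<Sum>k\<le>d + 2. e ^ k * dot (G k v) v) = 0"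
        by (simp only: dot_sum_left dot_scale_left)
      then show ?thesis
        by (simp only: dot_commute[of v] mult.commute)
    qed
    then show ?thesis
      using polyfun_eq_0[of "\<lambda>k. dot v (G k v)" "d + 2"] by auto
  qed
  show ?thesis
  proof (rule that[of "\<lambda>k. G (Suc k)"])
    show "F v = (\<Sum>k\<le>d + 1. G (Suc k) v)" for v
      unfolding G(3) using sum.atMost_Suc_shift[of "\<lambda>k. G k v" "d + 1"] G0 by simp
  qed (use G dotG in auto)
qed

text \<open>
  Some two coordinate forms complete \<open>l\<close> to a basis of the linear forms; \<open>g\<close> is the inverse of the matrix
  with this basis as rows.
\<close>

lemma coordinates_adapted_to_line:
  assumes "l \<noteq> (0 :: complex^3)"
  obtains g :: "complex^3^3" where "invertible g" "transpose g *v l = axis 3 1"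
proof -
  have "\<exists>M :: complex^3^3. invertible M \<and> M $ 3 = l"
  proof -
    have "l $ 1 \<noteq> 0 \<or> l $ 2 \<noteq> 0 \<or> l $ 3 \<noteq> 0"
      using assms unfolding vec_eq_iff forall_3 by simp
    then consider "l $ 3 \<noteq> 0" | "l $ 2 \<noteq> 0" | "l $ 1 \<noteq> 0" by blast
    then show ?thesis
    proof cases
      case 1
      then have "det (vector [vector [1, 0, 0], vector [0, 1, 0], l] :: complex^3^3) \<noteq> 0"
        by (simp add: det_3)
      then show ?thesis unfolding invertible_det_nz[symmetric] by (metis vector_3(3))
    next
      case 2
      then have "det (vector [vector [1, 0, 0], vector [0, 0, 1], l] :: complex^3^3) \<noteq> 0"
        by (simp add: det_3)
      then show ?thesis unfolding invertible_det_nz[symmetric] by (metis vector_3(3))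
    next
      case 3
      then have "det (vector [vector [0, 1, 0], vector [0, 0, 1], l] :: complex^3^3) \<noteq> 0"
        by (simp add: det_3)
      then show ?thesis unfolding invertible_det_nz[symmetric] by (metis vector_3(3))
    qed
  qed
  then obtain M :: "complex^3^3" where M: "invertible M" "M $ 3 = l" by blast
  then obtain g where g: "M ** g = mat 1" "g ** M = mat 1"
    unfolding invertible_def by blast
  show ?thesis
  proof (rule that)
    show "invertible g"
      unfolding invertible_def using g by blast
    have dot_g: "dot l (g *v w) = w $ 3" for w
    proof -
      have "dot l (g *v w) = (M *v (g *v w)) $ 3"
        by (simp add: dot_def matrix_vector_mult_def[of M] M(2))
      then show ?thesis
        by (simp add: matrix_vector_mul_assoc g)
    qed
    have "dot w (transpose g *v l - axis 3 1) = 0" for w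
    proof -
      have "dot w (transpose g *v l - axis 3 1) = dot w (transpose g *v l) - dot w (axis 3 1)"
        by (simp add: dot_def algebra_simps sum_subtractf)
      also have "\<dots> = dot l (g *v w) - dot (axis 3 1) w"
        unfolding dot_transpose by (simp only: dot_commute[of "g *v w"] dot_commute[of w])
      finally show ?thesis
        by (simp add: dot_g dot_axis)
    qed
    then have "transpose g *v l - axis 3 1 = 0"
      by (rule dot_eq_0_all)
    then show "transpose g *v l = axis 3 1" by simp
  qed
qed

section \<open>Singularities on an invariant line\<close>

lemma has_derivative_along_line:
  assumes "(f has_derivative dot a) (at s)"
  shows "((\<lambda>t. f (s + t *s w)) has_field_derivative dot a w) (at 0)"
proof -
  have "linear (\<lambda>t::complex. t *s w)"
    by (rule linearI) (simp_all add: vec_eq_iff algebra_simps)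
  then have "bounded_linear (\<lambda>t::complex. t *s w)"
    by (simp add: linear_conv_bounded_linear)
  then have line: "((\<lambda>t. s + t *s w) has_derivative (\<lambda>t. t *s w)) (at 0)"
    by (auto intro!: derivative_eq_intros bounded_linear_imp_has_derivative)
  have "(f has_derivative dot a) (at (s + 0 *s w))"
    using assms by simp
  from has_derivative_compose[OF line this]
  have "((\<lambda>t. f (s + t *s w)) has_derivative (\<lambda>t. dot a (t *s w))) (at 0)" .
  moreover have "(\<lambda>t. dot a (t *s w)) = (*) (dot a w)"
    by (simp add: fun_eq_iff dot_commute[of a] dot_scale_left mult.commute)
  ultimately show ?thesis
    by (simp add: has_field_derivative_def)
qed

lemma vanishing_direction:
  assumes "(f has_derivative dot a) (at s)" "\<And>t. t \<in> T \<Longrightarrow> f (s + t *s w) = 0" "open T" "0 \<in> T"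
  shows "dot a w = 0"
proof -
  have "((\<lambda>t. f (s + t *s w)) has_field_derivative 0) (at 0)"
    by (rule has_field_derivative_transform_within_open[OF DERIV_const assms(3,4)]) (use assms(2) in auto)
  then show ?thesis
    by (rule DERIV_unique[OF has_derivative_along_line[OF assms(1)]])
qed

text \<open>
  A function of weight \<open>k \<ge> 1\<close> vanishes on the plane \<open>z = 0\<close>, so only its derivative across the
  plane can survive; along the third axis the function is \<open>t ^ k\<close> times a constant.
\<close>

lemma sweight_derivative:
  assumes f: "sweight k f" "(f has_derivative dot a) (at s)" and s: "s $ 3 = 0"
  shows "k \<ge> 1 \<Longrightarrow> f s = 0 \<and> a $ 1 = 0 \<and> a $ 2 = 0" and "k \<ge> 2 \<Longrightarrow> a $ 3 = 0"
proof -
  have van: "f v = 0" if "v $ 3 = 0" "k \<ge> 1" for v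
  proof -
    have "v = diag3 1 0 *v v"
      using that(1) by (simp add: vec_eq_iff forall_3 diag3_mult_vec)
    then have "f v = f (diag3 1 0 *v v)"
      by (rule arg_cong)
    also have "\<dots> = 0 ^ k * f v"
      using f(1) unfolding sweight_def by blast
    finally have "f v = 0 ^ k * f v" .
    then show ?thesis using that(2) by (cases k) auto
  qed
  show "f s = 0 \<and> a $ 1 = 0 \<and> a $ 2 = 0" if "k \<ge> 1"
  proof -
    have "dot a (axis i 1) = 0" if "i \<noteq> 3" for i
      using vanishing_direction[OF f(2), of UNIV "axis i 1"] van[OF _ \<open>k \<ge> 1\<close>] s that
      by (simp add: axis_def)
    from this[of 1] this[of 2] van[OF s that] show ?thesis
      by (simp add: dot_commute[of a] dot_axis)
  qed
  show "a $ 3 = 0" if "k \<ge> 2"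
  proof -
    have "s + t *s axis 3 1 = diag3 1 t *v (s + axis 3 1)" for t
      using s by (simp add: vec_eq_iff forall_3 diag3_mult_vec axis_def)
    then have "f (s + t *s axis 3 1) = t ^ k * f (s + axis 3 1)" for t
      using f(1) unfolding sweight_def by simp
    then have "((\<lambda>t. t ^ k * f (s + axis 3 1)) has_field_derivative dot a (axis 3 1)) (at 0)"
      using has_derivative_along_line[OF f(2), of "axis 3 1"] by simp
    moreover have "((\<lambda>t. t ^ k * f (s + axis 3 1)) has_field_derivative 0) (at 0)"
      using that by (auto intro!: derivative_eq_intros)
    ultimately have "dot a (axis 3 1) = 0"
      by (rule DERIV_unique)
    then show ?thesis
      by (simp add: dot_commute[of a] dot_axis)
  qed
qed

text \<open>
  To first order at \<open>v\<close> the form is \<open>c\<close> times the equation of the line \<open>l\<close> times the constant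
  form \<open>l\<close>.  In coordinates with \<open>l = dz\<close> this is \<open>c z dz\<close>, the shape of \<open>F - H\<close>.
\<close>

definition conormal_contact :: "complex \<Rightarrow> complex^3 \<Rightarrow> (complex^3 \<Rightarrow> complex^3) \<Rightarrow> complex^3 \<Rightarrow> bool"
  where "conormal_contact c l \<omega> v \<longleftrightarrow> \<omega> v = 0 \<and> (\<forall>i. ((\<lambda>v. \<omega> v $ i) has_derivative dot ((c * l $ i) *s l)) (at v))"

lemma hform_derivative:
  assumes "hform n \<omega>"
  shows "\<exists>a. \<forall>i. ((\<lambda>v. \<omega> v $ i) has_derivative dot (a i)) (at s)"
proof (rule choice)
  show "\<forall>i. \<exists>a. ((\<lambda>v. \<omega> v $ i) has_derivative dot a) (at s)"
  proof
    fix i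
    have "hpoly n (\<lambda>v. \<omega> v $ i)"
      using assms by (simp add: hform_def)
    from hpoly_complex_differentiable[OF this, of s]
    show "\<exists>a. ((\<lambda>v. \<omega> v $ i) has_derivative dot a) (at s)"
      by (simp only: complex_differentiable_at_def)
  qed
qed

text \<open>
  A form of weight \<open>k + 1\<close> has \<open>dx\<close> and \<open>dy\<close> coefficients divisible by \<open>z ^ (k + 1)\<close>, which
  vanish to second order along the line, while its \<open>dz\<close> coefficient is divisible by \<open>z ^ k\<close>.
\<close>

lemma conormal_contact_fweight:
  assumes "hform n \<omega>" "fweight (Suc k) \<omega>" "k \<ge> 1" "s $ 3 = 0"
  shows "\<exists>c. conormal_contact c (axis 3 1) \<omega> s"
proof -
  obtain a where "\<forall>i. ((\<lambda>v. \<omega> v $ i) has_derivative dot (a i)) (at s)"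
    using hform_derivative[OF assms(1)] ..
  then have a: "((\<lambda>v. \<omega> v $ i) has_derivative dot (a i)) (at s)" for i
    by (rule spec)
  have w: "sweight (Suc k) (\<lambda>v. \<omega> v $ 1)" "sweight (Suc k) (\<lambda>v. \<omega> v $ 2)" "sweight k (\<lambda>v. \<omega> v $ 3)"
    using assms(2) by (auto simp: fweight_def)
  have "\<omega> s = 0"
    using sweight_derivative(1)[OF w(1) a assms(4)] sweight_derivative(1)[OF w(2) a assms(4)]
      sweight_derivative(1)[OF w(3) a assms(4)] assms(3)
    by (simp add: vec_eq_iff forall_3)
  moreover have eq: "a i = (a 3 $ 3 * axis 3 1 $ i) *s axis 3 1" for i
  proof -
    have *: "a 1 $ 1 = 0" "a 1 $ 2 = 0" "a 1 $ 3 = 0" "a 2 $ 1 = 0" "a 2 $ 2 = 0" "a 2 $ 3 = 0"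
      "a 3 $ 1 = 0" "a 3 $ 2 = 0"
      using sweight_derivative[OF w(1) a assms(4)] sweight_derivative[OF w(2) a assms(4)]
        sweight_derivative(1)[OF w(3) a assms(4)] assms(3) by simp_all
    have "i = 1 \<or> i = 2 \<or> i = 3"
      by (rule exhaust_3)
    then show ?thesis
      using * by (elim disjE) (simp_all add: vec_eq_iff forall_3 axis_def)
  qed
  moreover have "((\<lambda>v. \<omega> v $ i) has_derivative dot ((a 3 $ 3 * axis 3 1 $ i) *s axis 3 1)) (at s)" for i
    using a[of i] by (simp only: eq[of i])
  ultimately show ?thesis
    unfolding conormal_contact_def by blast
qed

lemma conormal_contact_sum:
  assumes "finite K" "\<And>k. k \<in> K \<Longrightarrow> \<exists>c. conormal_contact c l (G k) s"
  shows "\<exists>c. conormal_contact c l (\<lambda>v. \<Sum>k\<in>K. G k v) s"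
  using assms
proof (induction K rule: finite_induct)
  case empty
  have "dot ((0 * l $ i) *s l) = (\<lambda>v. 0)" for i
    by (simp add: fun_eq_iff dot_def)
  then show ?case
    by (intro exI[of _ 0]) (simp add: conormal_contact_def)
next
  case (insert k K)
  obtain c where c1: "conormal_contact c l (G k) s"
    using insert.prems[of k] by auto
  have "\<exists>c'. conormal_contact c' l (\<lambda>v. \<Sum>k\<in>K. G k v) s"
    by (rule insert.IH) (rule insert.prems, simp)
  then obtain c' where c2: "conormal_contact c' l (\<lambda>v. \<Sum>k\<in>K. G k v) s" ..
  note c = c1 c2
  have "(\<lambda>h. dot ((c * l $ i) *s l) h + dot ((c' * l $ i) *s l) h) = dot (((c + c') * l $ i) *s l)" for i
    unfolding fun_eq_iff dot_scale_left by (simp add: algebra_simps)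
  then have "((\<lambda>v. G k v $ i + (\<Sum>k\<in>K. G k v) $ i) has_derivative dot (((c + c') * l $ i) *s l)) (at s)" for i
    using has_derivative_add[of "\<lambda>v. G k v $ i" "dot ((c * l $ i) *s l)" "at s"
        "\<lambda>v. (\<Sum>k\<in>K. G k v) $ i" "dot ((c' * l $ i) *s l)"] c
    by (simp only: conormal_contact_def)
  then show ?case
    using insert(1,2) c by (intro exI[of _ "c + c'"]) (simp add: conormal_contact_def)
qed

lemma conormal_contact_pullback:
  assumes "conormal_contact c l \<omega> (g *v v)"
  shows "conormal_contact c (transpose g *v l) (pullback g \<omega>) v"
  unfolding conormal_contact_def
proof (intro conjI allI)
  show "pullback g \<omega> v = 0"
    using assms by (simp add: conormal_contact_def pullback_def)
  fix i
  have "linear ((*v) g)"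
    by (rule linearI, rule matrix_vector_right_distrib)
      (simp add: vec_eq_iff matrix_vector_mult_def scaleR_sum_right)
  then have g: "((*v) g has_derivative (*v) g) (at v)"
    by (intro bounded_linear_imp_has_derivative) (simp add: linear_conv_bounded_linear)
  have "((\<lambda>v. \<omega> (g *v v) $ j) has_derivative (\<lambda>w. dot ((c * l $ j) *s l) (g *v w))) (at v)" for j
    using has_derivative_compose[OF g, of "\<lambda>v. \<omega> v $ j"] assms by (simp add: conormal_contact_def)
  then have D: "((\<lambda>v. \<Sum>j\<in>UNIV. g $ j $ i * \<omega> (g *v v) $ j) has_derivative
      (\<lambda>w. \<Sum>j\<in>UNIV. g $ j $ i * dot ((c * l $ j) *s l) (g *v w))) (at v)"
    by (intro has_derivative_sum has_derivative_mult_right)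
  have E1: "(\<lambda>v. \<Sum>j\<in>UNIV. g $ j $ i * \<omega> (g *v v) $ j) = (\<lambda>v. pullback g \<omega> v $ i)"
    by (simp only: pullback_def matrix_vector_mult_def[of "transpose g"] vec_lambda_beta)
      (simp only: transpose_def vec_lambda_beta)
  have E2: "(\<lambda>w. \<Sum>j\<in>UNIV. g $ j $ i * dot ((c * l $ j) *s l) (g *v w))
      = dot ((c * (transpose g *v l) $ i) *s (transpose g *v l))"
  proof
    fix w
    have "(\<Sum>j\<in>UNIV. g $ j $ i * dot ((c * l $ j) *s l) (g *v w))
        = (\<Sum>j\<in>UNIV. c * (g $ j $ i * l $ j) * dot l (g *v w))"
      by (intro sum.cong) (auto simp: dot_scale_left)
    also have "\<dots> = c * (\<Sum>j\<in>UNIV. g $ j $ i * l $ j) * dot l (g *v w)"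
      by (simp only: sum_distrib_left sum_distrib_right mult.assoc)
    also have "(\<Sum>j\<in>UNIV. g $ j $ i * l $ j) = (transpose g *v l) $ i"
      by (simp only: matrix_vector_mult_def[of "transpose g"] vec_lambda_beta)
        (simp only: transpose_def vec_lambda_beta)
    also have "dot l (g *v w) = dot (transpose g *v l) w"
      unfolding dot_commute[of "transpose g *v l"] dot_transpose by (rule dot_commute)
    finally show "(\<Sum>j\<in>UNIV. g $ j $ i * dot ((c * l $ j) *s l) (g *v w))
      = dot ((c * (transpose g *v l) $ i) *s (transpose g *v l)) w"
      by (simp only: dot_scale_left)
  qed
  show "((\<lambda>v. pullback g \<omega> v $ i) has_derivative
      dot ((c * (transpose g *v l) $ i) *s (transpose g *v l))) (at v)"
    using D unfolding E1 E2 .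
qed

lemma has_derivative_affine_chart:
  assumes "(f has_derivative dot a) (at (vector [fst z, snd z, 1]))"
  shows "((\<lambda>z. f (vector [fst z, snd z, 1])) has_derivative (\<lambda>h. a $ 1 * fst h + a $ 2 * snd h)) (at z)"
proof -
  define L :: "complex \<times> complex \<Rightarrow> complex^3" where "L h = vector [fst h, snd h, 0]" for h
  have "linear L"
    by (rule linearI) (simp_all add: L_def vec_eq_iff forall_3)
  then have "bounded_linear L"
    by (simp add: linear_conv_bounded_linear)
  then have "((\<lambda>h. L h + axis 3 1) has_derivative L) (at z)"
    by (auto intro!: derivative_eq_intros bounded_linear_imp_has_derivative)
  moreover have "(\<lambda>h. L h + axis 3 1) = (\<lambda>h. vector [fst h, snd h, 1])"
    by (simp add: fun_eq_iff L_def vec_eq_iff forall_3 axis_def)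
  ultimately have "((\<lambda>h. vector [fst h, snd h, 1]) has_derivative L) (at z)"
    by simp
  from has_derivative_compose[OF this assms]
  have "((\<lambda>z. f (vector [fst z, snd z, 1])) has_derivative (\<lambda>h. dot a (L h))) (at z)" .
  moreover have "(\<lambda>h. dot a (L h)) = (\<lambda>h. a $ 1 * fst h + a $ 2 * snd h)"
    by (simp add: fun_eq_iff L_def dot_def sum_3)
  ultimately show ?thesis by simp
qed

lemma axis_3_vector: "vector [0, 0, 1] = (axis 3 1 :: complex^3)"
  by (simp add: vec_eq_iff forall_3 axis_def)

lemma linear_part_eq:
  assumes "((\<lambda>v. pullback (chart_at s) \<omega> v $ 1) has_derivative dot a) (at (axis 3 1))"
    "((\<lambda>v. pullback (chart_at s) \<omega> v $ 2) has_derivative dot b) (at (axis 3 1))"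
  shows "linear_part \<omega> s = (\<lambda>h. (b $ 1 * fst h + b $ 2 * snd h, - (a $ 1 * fst h + a $ 2 * snd h)))"
proof -
  have "((\<lambda>z. pullback (chart_at s) \<omega> (vector [fst z, snd z, 1]) $ 1) has_derivative
      (\<lambda>h. a $ 1 * fst h + a $ 2 * snd h)) (at (0, 0))"
    "((\<lambda>z. pullback (chart_at s) \<omega> (vector [fst z, snd z, 1]) $ 2) has_derivative
      (\<lambda>h. b $ 1 * fst h + b $ 2 * snd h)) (at (0, 0))"
    using assms by (auto intro!: has_derivative_affine_chart simp: axis_3_vector)
  from has_derivative_Pair[OF this(2) has_derivative_minus[OF this(1)]]
  have "(vfield (pullback (chart_at s) \<omega>) has_derivative
      (\<lambda>h. (b $ 1 * fst h + b $ 2 * snd h, - (a $ 1 * fst h + a $ 2 * snd h)))) (at (0, 0))"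
    by (simp add: vfield_def[abs_def] affA_def affB_def)
  from frechet_derivative_at[OF this] show ?thesis
    unfolding linear_part_def by (rule sym)
qed

lemma hpoly_affine_chart_holomorphic:
  assumes "hpoly n f"
  shows "holomorphic2_on (\<lambda>z. f (vector [fst z, snd z, 1])) U"
  unfolding holomorphic2_on_def
  using has_derivative_affine_chart hpoly_complex_differentiable[OF assms]
  unfolding complex_differentiable_at_def by blast

text \<open>
  The vector field is \<open>B \<partial>x - A \<partial>y\<close>, and \<open>a\<close>, \<open>b\<close> are the differentials of \<open>A\<close>, \<open>B\<close>, so the Jacobian
  of the vector field is the determinant on the right.
\<close>

lemma milnor_eq_1_iff:
  assumes \<omega>: "hform n \<omega>" "\<omega> s = 0" and s: "chart_at s *v axis 3 1 = s"
    and a: "((\<lambda>v. pullback (chart_at s) \<omega> v $ 1) has_derivative dot a) (at (axis 3 1))"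
    and b: "((\<lambda>v. pullback (chart_at s) \<omega> v $ 2) has_derivative dot b) (at (axis 3 1))"
  shows "milnor \<omega> s = 1 \<longleftrightarrow> a $ 1 * b $ 2 - a $ 2 * b $ 1 \<noteq> 0"
proof -
  define \<omega>' where "\<omega>' = pullback (chart_at s) \<omega>"
  have hp: "hpoly n (\<lambda>v. \<omega>' v $ i)" for i
    using hform_pullback[OF \<omega>(1)] by (simp add: hform_def \<omega>'_def)
  have 0: "\<omega>' (axis 3 1) = 0"
    by (simp add: \<omega>'_def pullback_def s \<omega>(2))
  have germ: "germ_at (0, 0) (\<lambda>z. \<omega>' (vector [fst z, snd z, 1]) $ i)" for i
    by (rule germ_atI[of UNIV]) (auto intro: hpoly_affine_chart_holomorphic[OF hp])
  have "((\<lambda>z. \<omega>' (vector [fst z, snd z, 1]) $ 1) has_derivative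
      (\<lambda>h. a $ 1 * fst h + a $ 2 * snd h)) (at (0, 0))"
    and db: "((\<lambda>z. \<omega>' (vector [fst z, snd z, 1]) $ 2) has_derivative
      (\<lambda>h. b $ 1 * fst h + b $ 2 * snd h)) (at (0, 0))"
    using a b by (auto intro!: has_derivative_affine_chart simp: axis_3_vector \<omega>'_def)
  from has_derivative_minus[OF this(1)]
  have da: "((\<lambda>z. - \<omega>' (vector [fst z, snd z, 1]) $ 1) has_derivative
      (\<lambda>h. (- a $ 1) * fst h + (- a $ 2) * snd h)) (at (0, 0))"
    by (simp add: algebra_simps)
  have "germ_at (0, 0) (\<lambda>z. - \<omega>' (vector [fst z, snd z, 1]) $ 1)"
    using germ_at_mult[OF germ_at_const[of _ "-1"] germ[of 1]] by simp
  from local_codim_eq_1_iff[OF germ _ db this _ da]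
  have "local_codim (0, 0) (\<lambda>z. \<omega>' (vector [fst z, snd z, 1]) $ 2) (\<lambda>z. - \<omega>' (vector [fst z, snd z, 1]) $ 1) = 1
      \<longleftrightarrow> b $ 1 * (- a $ 2) - b $ 2 * (- a $ 1) \<noteq> 0"
    by (simp add: axis_3_vector 0)
  also have "b $ 1 * (- a $ 2) - b $ 2 * (- a $ 1) = a $ 1 * b $ 2 - a $ 2 * b $ 1"
    by (simp add: algebra_simps)
  finally show ?thesis
    by (simp add: milnor_def vfield_def affA_def affB_def \<omega>'_def)
qed

text \<open>
  The transposed inverse of coordinates adapted to \<open>s\<close>, seen as a line, sends the third basis vector
  to \<open>s\<close>; so the choice in \<^const>\<open>chart_at\<close> is from a non-empty set.
\<close>

lemma chart_at_point:
  assumes "s \<noteq> 0"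
  shows "invertible (chart_at s)" "chart_at s *v axis 3 1 = s"
proof -
  have "\<exists>g :: complex^3^3. invertible g \<and> g *v axis 3 1 = s"
  proof -
    obtain M :: "complex^3^3" where M: "invertible M" "transpose M *v s = axis 3 1"
      using coordinates_adapted_to_line[OF assms] by blast
    then obtain M' where M': "M ** M' = mat 1" "M' ** M = mat 1"
      unfolding invertible_def by blast
    from M(2) have E: "transpose M' *v (transpose M *v s) = transpose M' *v axis 3 1"
      by (simp only:)
    have T: "transpose M' ** transpose M = mat 1" "transpose M ** transpose M' = mat 1"
      using M' by (simp_all flip: matrix_transpose_mul)
    from E have "transpose M' *v axis 3 1 = s"
      unfolding matrix_vector_mul_assoc T by (simp only: matrix_vector_mul_lid)
    then show ?thesis
      using T unfolding invertible_def by blast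
  qed
  then have "invertible (chart_at s) \<and> chart_at s *v axis 3 1 = s"
    unfolding chart_at_def by (rule someI_ex)
  then show "invertible (chart_at s)" "chart_at s *v axis 3 1 = s"
    by auto
qed

text \<open>
  Differentiating along the line at a singular point: the linear part of the vector field maps the
  tangent direction \<open>(l $ 2, - l $ 1)\<close> of the line into itself.
\<close>

lemma invariant_line_linear_part:
  assumes inv: "invariant_line \<omega> l" and l: "l $ 3 = 0"
    and a: "((\<lambda>v. \<omega> v $ 1) has_derivative dot a) (at (axis 3 1))"
    and b: "((\<lambda>v. \<omega> v $ 2) has_derivative dot b) (at (axis 3 1))"
  shows "l $ 2 * (a $ 1 * l $ 2 - a $ 2 * l $ 1) = l $ 1 * (b $ 1 * l $ 2 - b $ 2 * l $ 1)"
proof -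
  define w :: "complex^3" where "w = vector [l $ 2, - l $ 1, 0]"
  have w: "dot l w = 0" "dot l (axis 3 1 + t *s w) = 0" for t
    using l by (simp_all add: w_def dot_def sum_3 axis_def)
  have "((\<lambda>v. l $ 2 * \<omega> v $ 1 - l $ 1 * \<omega> v $ 2) has_derivative dot (l $ 2 *s a - l $ 1 *s b)) (at (axis 3 1))"
  proof -
    have "dot (l $ 2 *s a - l $ 1 *s b) = (\<lambda>w. l $ 2 * dot a w - l $ 1 * dot b w)"
      by (simp add: fun_eq_iff dot_def algebra_simps sum_subtractf sum_distrib_left)
    then show ?thesis
      using has_derivative_diff[OF has_derivative_mult_right[OF a, of "l $ 2"] has_derivative_mult_right[OF b, of "l $ 1"]]
      by simp
  qed
  moreover have "l $ 2 * \<omega> (axis 3 1 + t *s w) $ 1 - l $ 1 * \<omega> (axis 3 1 + t *s w) $ 2 = 0" for t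
  proof -
    have "dot (\<omega> (axis 3 1 + t *s w)) w = 0"
      using inv w unfolding invariant_line_def by blast
    then show ?thesis
      by (simp add: dot_def sum_3 algebra_simps) (simp add: w_def algebra_simps)
  qed
  ultimately have "dot (l $ 2 *s a - l $ 1 *s b) w = 0"
    using vanishing_direction[of "\<lambda>v. l $ 2 * \<omega> v $ 1 - l $ 1 * \<omega> v $ 2" _ "axis 3 1" UNIV w] by auto
  then show ?thesis
    by (simp add: dot_def sum_3 w_def algebra_simps)
qed

lemma invariant_line_pullback:
  assumes "invariant_line \<omega> l"
  shows "invariant_line (pullback g \<omega>) (transpose g *v l)"
proof -
  have "dot (transpose g *v l) v = dot l (g *v v)" for v
    unfolding dot_commute[of "transpose g *v l"] dot_transpose by (rule dot_commute)
  moreover have "dot (pullback g \<omega> v) w = dot (\<omega> (g *v v)) (g *v w)" for v w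
    unfolding dot_commute[of "pullback g \<omega> v"] dot_pullback by (rule dot_commute)
  ultimately show ?thesis
    using assms unfolding invariant_line_def by simp
qed

text \<open>
  In the chart at \<open>s\<close>, with \<open>m\<close> the equation of the line, the linear parts differ by
  \<open>w \<mapsto> c * m w * (m $ 2, - m $ 1)\<close>.  This vanishes on the kernel of \<open>m\<close> and has its values there, so
  both eigenvalues agree.  The determinants differ by \<open>c\<close> times an expression which is zero by the
  invariance of the line.
\<close>

lemma conormal_contact_same_invariants:
  assumes F: "hform n F" and H: "hform n H" and s: "s \<noteq> 0" "dot l s = 0" "H s = 0"
    and inv: "invariant_line H l" and con: "conormal_contact c l (\<lambda>v. F v - H v) s"
  shows "milnor F s = 1 \<longleftrightarrow> milnor H s = 1" and "camacho_sad F l s = camacho_sad H l s"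
proof -
  define g where "g = chart_at s"
  note gs = chart_at_point(2)[OF s(1), folded g_def]
  define m where "m = transpose g *v l"
  have "F s = 0"
    using con s(3) by (simp add: conormal_contact_def)
  have m3: "m $ 3 = 0"
  proof -
    have "m $ 3 = dot (axis 3 1) m" by (simp add: dot_axis)
    also have "\<dots> = dot s l" unfolding m_def dot_transpose gs ..
    finally show ?thesis using s(2) by (simp add: dot_commute)
  qed
  have pdiff: "pullback g F v = pullback g H v + pullback g (\<lambda>v. F v - H v) v" for v
    by (simp add: pullback_def vec_eq_iff matrix_vector_mult_def algebra_simps sum_subtractf)
  have con': "conormal_contact c m (pullback g (\<lambda>v. F v - H v)) (axis 3 1)"
    unfolding m_def by (rule conormal_contact_pullback) (simp add: gs con)
  obtain D where D: "\<forall>i. ((\<lambda>v. pullback g H v $ i) has_derivative dot (D i)) (at (axis 3 1))"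
    using hform_derivative[OF hform_pullback[OF H]] ..
  define a b where "a = D 1" and "b = D 2"
  have a: "((\<lambda>v. pullback g H v $ 1) has_derivative dot a) (at (axis 3 1))"
    and b: "((\<lambda>v. pullback g H v $ 2) has_derivative dot b) (at (axis 3 1))"
    unfolding a_def b_def by (rule D[rule_format])+
  have dF: "((\<lambda>v. pullback g F v $ i) has_derivative dot (x + (c * m $ i) *s m)) (at (axis 3 1))"
    if "((\<lambda>v. pullback g H v $ i) has_derivative dot x) (at (axis 3 1))" for i x
  proof -
    have "((\<lambda>v. pullback g (\<lambda>v. F v - H v) v $ i) has_derivative dot ((c * m $ i) *s m)) (at (axis 3 1))"
      using con' by (simp add: conormal_contact_def)
    from has_derivative_add[OF that this] show ?thesis
      by (simp add: pdiff dot_add_left[abs_def])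
  qed
  have I: "m $ 2 * (a $ 1 * m $ 2 - a $ 2 * m $ 1) = m $ 1 * (b $ 1 * m $ 2 - b $ 2 * m $ 1)"
    using invariant_line_linear_part[OF invariant_line_pullback[OF inv, of g, folded m_def] m3 a b] .
  have "(a + (c * m $ 1) *s m) $ 1 * (b + (c * m $ 2) *s m) $ 2 - (a + (c * m $ 1) *s m) $ 2 * (b + (c * m $ 2) *s m) $ 1
    = a $ 1 * b $ 2 - a $ 2 * b $ 1
      + c * (m $ 2 * (a $ 1 * m $ 2 - a $ 2 * m $ 1) - m $ 1 * (b $ 1 * m $ 2 - b $ 2 * m $ 1))"
    by (simp add: algebra_simps)
  then have det: "(a + (c * m $ 1) *s m) $ 1 * (b + (c * m $ 2) *s m) $ 2
      - (a + (c * m $ 1) *s m) $ 2 * (b + (c * m $ 2) *s m) $ 1 = a $ 1 * b $ 2 - a $ 2 * b $ 1"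
    using I by simp
  show "milnor F s = 1 \<longleftrightarrow> milnor H s = 1"
    unfolding milnor_eq_1_iff[OF F \<open>F s = 0\<close> gs[unfolded g_def] dF[OF a, unfolded g_def] dF[OF b, unfolded g_def]]
      milnor_eq_1_iff[OF H s(3) gs[unfolded g_def] a[unfolded g_def] b[unfolded g_def]] det ..
  have con_eq: "conormal l s w = m $ 1 * fst w + m $ 2 * snd w" for w
  proof -
    have "conormal l s w = dot (vector [fst w, snd w, 0]) m"
      unfolding conormal_def m_def g_def dot_transpose by (rule dot_commute)
    then show ?thesis
      by (simp add: dot_def sum_3 mult.commute)
  qed
  have lin: "linear_part F s w = (fst (linear_part H s w) + c * conormal l s w * m $ 2,
      snd (linear_part H s w) - c * conormal l s w * m $ 1)" for w
    unfolding linear_part_eq[OF dF[OF a, unfolded g_def] dF[OF b, unfolded g_def]]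
      linear_part_eq[OF a[unfolded g_def] b[unfolded g_def]] con_eq
    by (simp add: algebra_simps)
  have "conormal l s (linear_part F s w) = conormal l s (linear_part H s w)" for w
    unfolding con_eq[of "linear_part F s w"] con_eq[of "linear_part H s w"] unfolding lin
    by (simp add: algebra_simps)
  then have "normal_eigenvalue F l s = normal_eigenvalue H l s"
    by (simp add: normal_eigenvalue_def)
  moreover have "conormal l s w = 0 \<Longrightarrow> linear_part F s w = linear_part H s w" for w
    by (simp add: lin)
  then have "tangent_eigenvalue F l s = tangent_eigenvalue H l s"
    unfolding tangent_eigenvalue_def by (simp cong: imp_cong)
  ultimately show "camacho_sad F l s = camacho_sad H l s"
    by (simp add: camacho_sad_def)
qed

text \<open>
  If the form vanishes along the line joining \<open>s\<close> to \<open>t\<close>, the linear part at \<open>s\<close> kills the direction of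
  that line, which must then be zero.
\<close>

lemma nondegenerate_isolated_direction:
  assumes H: "hform n H" and s: "s \<noteq> 0" "H s = 0" and mil: "milnor H s = 1"
    and van: "\<And>a b. a \<noteq> 0 \<Longrightarrow> H (a *s s + b *s t) = 0"
  shows "\<exists>c. t = c *s s"
proof -
  define g where "g = chart_at s"
  note gs = chart_at_point(2)[OF s(1), folded g_def]
  obtain g' where g': "g ** g' = mat 1"
    using chart_at_point(1)[OF s(1), folded g_def] unfolding invertible_def by blast
  define u where "u = g' *v t"
  have gu: "g *v u = t"
    by (simp add: u_def matrix_vector_mul_assoc g')
  define w where "w = u - u $ 3 *s axis 3 1"
  obtain D where D: "\<forall>i. ((\<lambda>v. pullback g H v $ i) has_derivative dot (D i)) (at (axis 3 1))"
    using hform_derivative[OF hform_pullback[OF H]] ..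
  define a b where "a = D 1" and "b = D 2"
  have a: "((\<lambda>v. pullback g H v $ 1) has_derivative dot a) (at (axis 3 1))"
    and b: "((\<lambda>v. pullback g H v $ 2) has_derivative dot b) (at (axis 3 1))"
    unfolding a_def b_def by (rule D[rule_format])+
  define T where "T = {x :: complex. 1 - x * u $ 3 \<noteq> 0}"
  have T: "open T" "0 \<in> T"
    unfolding T_def by (auto intro!: open_Collect_neq continuous_intros)
  have "pullback g H (axis 3 1 + x *s w) = 0" if "x \<in> T" for x
  proof -
    have "g *v (axis 3 1 + x *s w) = g *v ((1 - x * u $ 3) *s axis 3 1 + x *s u)"
      by (rule arg_cong[where f = "(*v) g"]) (simp add: w_def vec_eq_iff algebra_simps)
    also have "\<dots> = (1 - x * u $ 3) *s s + x *s t"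
      by (simp only: matrix_vector_right_distrib vector_scalar_commute gs gu)
    finally have "H (g *v (axis 3 1 + x *s w)) = 0"
      using van[of "1 - x * u $ 3" x] that by (simp only: T_def mem_Collect_eq not_False_eq_True simp_thms)
    then show ?thesis
      by (simp add: pullback_def)
  qed
  then have "dot a w = 0" "dot b w = 0"
    using vanishing_direction[OF a _ T] vanishing_direction[OF b _ T] by simp_all
  then have ab: "a $ 1 * u $ 1 + a $ 2 * u $ 2 = 0" "b $ 1 * u $ 1 + b $ 2 * u $ 2 = 0"
    by (simp_all add: dot_def sum_3 w_def axis_def)
  have det: "a $ 1 * b $ 2 - a $ 2 * b $ 1 \<noteq> 0"
    using milnor_eq_1_iff[OF H s(2) gs[unfolded g_def] a[unfolded g_def] b[unfolded g_def]] mil by simp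
  have "(a $ 1 * b $ 2 - a $ 2 * b $ 1) * u $ 1 = b $ 2 * (a $ 1 * u $ 1 + a $ 2 * u $ 2) - a $ 2 * (b $ 1 * u $ 1 + b $ 2 * u $ 2)"
    "(a $ 1 * b $ 2 - a $ 2 * b $ 1) * u $ 2 = a $ 1 * (b $ 1 * u $ 1 + b $ 2 * u $ 2) - b $ 1 * (a $ 1 * u $ 1 + a $ 2 * u $ 2)"
    by (simp_all add: algebra_simps)
  then have "u $ 1 = 0" "u $ 2 = 0"
    unfolding ab using det by simp_all
  then have "g *v u = g *v (u $ 3 *s axis 3 1)"
    by (intro arg_cong[where f = "(*v) g"]) (simp add: vec_eq_iff forall_3 axis_def)
  then have "t = u $ 3 *s s"
    by (simp only: vector_scalar_commute gu gs)
  then show ?thesis ..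
qed

section \<open>Polynomials with few zeros\<close>

definition polynomial_on_lines :: "(complex^3 \<Rightarrow> complex) \<Rightarrow> bool"
  where "polynomial_on_lines f \<longleftrightarrow> (\<forall>v w. \<exists>P. \<forall>t. f (v + t *s w) = poly P t)"

lemma poly3_polynomial_on_lines:
  assumes "poly3 f"
  shows "polynomial_on_lines f"
  unfolding polynomial_on_lines_def
proof (intro allI)
  fix v w :: "complex^3"
  obtain N c where c: "\<And>v. f v =
     (\<Sum>i\<le>N. \<Sum>j\<le>N. \<Sum>k\<le>N. c i j k * (v $ 1) ^ i * (v $ 2) ^ j * (v $ 3) ^ k)"
    using assms unfolding poly3_def by blast
  show "\<exists>P. \<forall>t. f (v + t *s w) = poly P t"
    by (rule exI[of _ "\<Sum>i\<le>N. \<Sum>j\<le>N. \<Sum>k\<le>N. smult (c i j k)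
        ([:v $ 1, w $ 1:] ^ i * [:v $ 2, w $ 2:] ^ j * [:v $ 3, w $ 3:] ^ k)"])
      (simp add: c poly_sum mult.assoc)
qed

lemma polynomial_on_lines_subst:
  assumes "polynomial_on_lines f"
  shows "polynomial_on_lines (\<lambda>v. f (g *v v))"
  using assms unfolding polynomial_on_lines_def matrix_vector_right_distrib vector_scalar_commute by blast

lemma constant_along_zero_free_line:
  assumes "polynomial_on_lines f" "\<And>t. f (v + t *s w) \<noteq> 0"
  shows "f (v + t *s w) = f v"
proof -
  obtain P where P: "\<And>t. f (v + t *s w) = poly P t"
    using assms(1) unfolding polynomial_on_lines_def by blast
  have "\<not> (\<exists>z. poly P z = 0)"
    using assms(2) P by metis
  then have "\<exists>a l. a \<noteq> 0 \<and> l = 0 \<and> P = pCons a l"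
    using fundamental_theorem_of_algebra_alt by blast
  then have "poly P t = poly P 0"
    by auto
  then show ?thesis
    using P[of t] P[of 0] by simp
qed

lemma constant_off_point_of_line:
  assumes "polynomial_on_lines f" "\<And>t. t \<noteq> 0 \<Longrightarrow> f (v + t *s w) = c"
  shows "f v = c"
proof -
  obtain P where P: "\<And>t. f (v + t *s w) = poly P t"
    using assms(1) unfolding polynomial_on_lines_def by blast
  have "poly ([:0, 1:] * (P - [:c:])) t = 0" for t
    using assms(2)[of t] P[of t] by (cases "t = 0") auto
  then have "[:0, 1:] * (P - [:c:]) = 0"
    using poly_all_0_iff_0 by blast
  then have "P - [:c:] = 0"
    by (metis mult_eq_0_iff pCons_eq_0_iff zero_neq_one)
  then show ?thesis
    using P[of 0] by simp
qed

text \<open>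
  A polynomial without zeros on a line is constant on it.  In a plane \<open>z = c\<close> with \<open>c \<noteq> 0\<close>
  the zeros lie on the axis \<open>x = y = 0\<close>, so any two points whose line avoids the axis have equal
  values.  The planes are linked by the line through \<open>u\<close> parallel to the axis, on which there are no
  zeros.  The points left over are reached along lines that are otherwise already covered.
\<close>

lemma constant_of_small_zero_set:
  assumes f: "polynomial_on_lines f"
    and zeros: "\<And>v. f v = 0 \<Longrightarrow> (v $ 1 = 0 \<and> v $ 2 = 0) \<or> (v $ 3 = 0 \<and> v \<in> Z)"
    and u: "u $ 3 = 0" "u \<notin> Z" "u $ 1 \<noteq> 0 \<or> u $ 2 \<noteq> 0"
  shows "f v = f u"
proof -
  have pair: "f v = f w" if "v $ 3 = c" "w $ 3 = c" "c \<noteq> 0" "v $ 1 * w $ 2 \<noteq> v $ 2 * w $ 1" for v w c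
  proof -
    have "f (v + t *s (w - v)) \<noteq> 0" for t
    proof
      assume "f (v + t *s (w - v)) = 0"
      moreover have "(v + t *s (w - v)) $ 3 = c"
        using that by simp
      ultimately have 0: "(v + t *s (w - v)) $ 1 = 0" "(v + t *s (w - v)) $ 2 = 0"
        using zeros[of "v + t *s (w - v)"] that(3) by auto
      have "v $ 1 * w $ 2 - v $ 2 * w $ 1 = (v + t *s (w - v)) $ 1 * (w $ 2 - v $ 2) - (v + t *s (w - v)) $ 2 * (w $ 1 - v $ 1)"
        by (simp add: algebra_simps)
      then show False
        unfolding 0 using that(4) by simp
    qed
    from constant_along_zero_free_line[OF f this, of 1] show ?thesis
      by simp
  qed
  have plane1: "f v = f (vector [1, 0, c])" if "v $ 3 = c" "c \<noteq> 0" "v $ 1 \<noteq> 0 \<or> v $ 2 \<noteq> 0" for v c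
  proof (cases "v $ 2 = 0")
    case True
    then have "f v = f (vector [0, 1, c])"
      using that by (intro pair[of _ c]) auto
    also have "\<dots> = f (vector [1, 0, c])"
      using that by (intro pair[of _ c]) auto
    finally show ?thesis .
  next
    case False
    then show ?thesis
      using that by (intro pair[of _ c]) auto
  qed
  have plane: "f v = f (vector [1, 0, c])" if "v $ 3 = c" "c \<noteq> 0" for v c
  proof (cases "v $ 1 \<noteq> 0 \<or> v $ 2 \<noteq> 0")
    case False
    show ?thesis
    proof (rule constant_off_point_of_line[OF f])
      fix t :: complex assume "t \<noteq> 0"
      then show "f (v + t *s axis 1 1) = f (vector [1, 0, c])"
        using False that by (intro plane1) (auto simp: axis_def)
    qed
  qed (use plane1 that in blast)
  have vertical: "f (u + t *s axis 3 1) = f u" for t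
  proof (rule constant_along_zero_free_line[OF f])
    fix t
    show "f (u + t *s axis 3 1) \<noteq> 0"
    proof
      assume "f (u + t *s axis 3 1) = 0"
      then have "t = 0" "u + t *s axis 3 1 \<in> Z"
        using zeros[of "u + t *s axis 3 1"] u by (auto simp: axis_def)
      then show False
        using u(2) by simp
    qed
  qed
  have off: "f v = f u" if "v $ 3 \<noteq> 0" for v
  proof -
    have "f v = f (vector [1, 0, v $ 3])"
      using that by (intro plane) auto
    also have "\<dots> = f (u + (v $ 3) *s axis 3 1)"
      using that u(1) by (intro plane[symmetric]) (auto simp: axis_def)
    finally show ?thesis
      by (simp add: vertical)
  qed
  show ?thesis
  proof (cases "v $ 3 = 0")
    case True
    show ?thesis
      by (rule constant_off_point_of_line[OF f, of v "axis 3 1"])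
        (use True in \<open>auto intro!: off simp: axis_def\<close>)
  qed (rule off)
qed

section \<open>Degeneration of a foliation along an invariant line\<close>

lemma continuous_limit_in_closure:
  fixes F :: "complex \<Rightarrow> 'a::topological_space"
  assumes "continuous_on UNIV F" "\<And>t. t \<noteq> 0 \<Longrightarrow> F t \<in> S"
  shows "F 0 \<in> closure S"
proof (rule Lim_in_closed_set[OF closed_closure _ trivial_limit_at])
  show "(F \<longlongrightarrow> F 0) (at 0)"
    using assms(1) by (simp add: continuous_on_def)
  show "\<forall>\<^sub>F t in at 0. F t \<in> closure S"
    using assms(2) closure_subset by (auto simp: eventually_at_filter intro!: always_eventually)
qed

theorem proposition3p9:
  fixes d :: nat and F :: "complex^3 \<Rightarrow> complex^3" and l :: "complex^3"
  assumes "d \<ge> 1"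
    and "foliation_form d F"
    and "l \<noteq> 0"
    and "invariant_line F l"
    and "\<forall>s \<in> sing F \<inter> pline l. nondegenerate_sing F s"
  shows "\<exists>H. foliation_form d H \<and> homogeneous_foliation H \<and>
     H \<in> orbit_closure d F \<and>
     invariant_line H l \<and>
     sing H \<inter> pline l = sing F \<inter> pline l \<and>
     (\<forall>s \<in> sing H \<inter> pline l. milnor H s = 1 \<and> camacho_sad H l s = camacho_sad F l s) \<and>
     (flat_legendre d F \<longrightarrow> flat_legendre d H)"
proof -
  have F: "hform (d + 1) F" "\<And>v. dot v (F v) = 0"
    using assms(2) by (auto simp: foliation_form_def hform_def homog_poly3_iff_hpoly)
  obtain g :: "complex^3^3" where g: "invertible g" and tl: "transpose g *v l = axis 3 1"
    using coordinates_adapted_to_line[OF assms(3)] by blast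
  from g obtain g' where g': "g ** g' = mat 1" "g' ** g = mat 1"
    unfolding invertible_def by blast
  then have inv_g': "invertible g'"
    unfolding invertible_def by blast
  have gg': "g *v (g' *v v) = v" "g' *v (g *v v) = v" for v
    by (simp_all add: matrix_vector_mul_assoc g')
  have pb_id: "pullback g' (pullback g \<omega>) = \<omega>" "pullback g (pullback g' \<omega>) = \<omega>" for \<omega>
    by (simp_all add: pullback_compose g' pullback_mat_1)
  have dot_g: "dot l (g *v v) = v $ 3" for v
    using dot_transpose[of v g l] unfolding tl dot_commute[of v] dot_commute[of _ l] by (simp add: dot_axis)
  have l3: "dot l v = (g' *v v) $ 3" for v
    using dot_g[of "g' *v v"] by (simp add: gg')
  have tl': "transpose g' *v axis 3 1 = l"
    using arg_cong[OF tl, of "(*v) (transpose g')"]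
    by (simp only: matrix_vector_mul_assoc matrix_transpose_mul[symmetric] g' transpose_mat matrix_vector_mul_lid)
  define F1 where "F1 = pullback g F"
  have F1: "hform (d + 1) F1" "\<And>v. dot v (F1 v) = 0" "invariant_line F1 (axis 3 1)"
    using hform_pullback[OF F(1)] F(2) invariant_line_pullback[OF assms(4), of g, unfolded tl]
    by (simp_all add: F1_def dot_pullback)
  obtain G1 where G1: "\<And>k. hform (d + 1) (G1 k)" "\<And>k. fweight (Suc k) (G1 k)"
    "\<And>v. F1 v = (\<Sum>k\<le>d + 1. G1 k v)" "\<And>v. dot v (G1 0 v) = 0"
    using degeneration_normalised[OF F1] by blast
  define G where "G k = pullback g' (G1 k)" for k
  define H1 where "H1 = G1 0"
  define H where "H = G 0"
  have pbG: "pullback g (G k) = G1 k" for k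
    by (simp add: G_def pb_id)
  have H1: "hform (d + 1) H1" "fweight 1 H1" "\<And>v. dot v (H1 v) = 0"
    using G1(1,2)[of 0] G1(4) by (simp_all add: H1_def)
  have H: "hform (d + 1) H" "\<And>v. dot v (H v) = 0"
    using hform_pullback[OF H1(1), of g'] H1(3) by (simp_all add: H_def G_def H1_def dot_pullback)
  have pbH: "pullback g H = H1" "H = pullback g' H1"
    using pbG[of 0] by (simp_all add: H_def H1_def G_def)
  have H1_zero: "H1 v = 0 \<longleftrightarrow> H (g *v v) = 0" for v
  proof
    assume "H (g *v v) = 0"
    then show "H1 v = 0"
      by (simp add: pbH(1)[symmetric] pullback_def)
  next
    assume "H1 v = 0"
    then show "H (g *v v) = 0"
      by (simp add: pbH(2) pullback_def gg')
  qed
  have sumF: "F v = (\<Sum>k\<le>d + 1. G k v)" for v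
  proof -
    have "F v = pullback g' F1 v"
      by (simp add: F1_def pb_id)
    also have "F1 = (\<lambda>v. \<Sum>k\<le>d + 1. 1 *s G1 k v)"
      by (simp add: fun_eq_iff G1(3))
    finally show ?thesis
      unfolding pullback_sum G_def by simp
  qed
  (* diag3 (1 / t) (t ^ (d + 1)) is the scalar 1 / t times diag3 1 (t ^ (d + 2)).  As the forms are
     homogeneous of degree d + 1, the scalar divides the pull-back by t ^ (d + 2), which brings the
     part of lowest weight to the exponent 0.  So the members of the degenerating family are themselves
     pull-backs of F, without a constant factor. *)
  define h where "h t = g ** (diag3 (1 / t) (t ^ (d + 1)) ** g')" for t
  have h: "invertible (h t)" if "t \<noteq> 0" for t
    unfolding h_def using that by (intro invertible_mult g inv_g' invertible_diag3) auto
  have deg: "pullback (h t) F = (\<lambda>v. \<Sum>k\<le>d + 1. t ^ ((d + 2) * k) *s G k v)" if "t \<noteq> 0" for t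
  proof -
    have "pullback (h t) F = pullback g' (pullback (diag3 (1 / t) (t ^ (d + 1))) F1)"
      by (simp add: h_def F1_def pullback_compose matrix_mul_assoc)
    also have "F1 = (\<lambda>v. \<Sum>k\<le>d + 1. 1 *s G1 k v)"
      by (simp add: fun_eq_iff G1(3))
    also have "pullback (diag3 (1 / t) (t ^ (d + 1))) (\<lambda>v. \<Sum>k\<le>d + 1. 1 *s G1 k v)
        = (\<lambda>v. \<Sum>k\<le>d + 1. t ^ ((d + 2) * k) *s G1 k v)"
    proof -
      have "t ^ (d + 1) = 1 / t * t ^ (d + 2)"
        using that by simp
      then have "pullback (diag3 (1 / t) (t ^ (d + 1))) (G1 k) v
          = ((1 / t) ^ (d + 1 + 1) * (t ^ (d + 2)) ^ Suc k) *s G1 k v" for k v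
        by (simp only: pullback_fweight_scaled[OF G1(2,1)])
      moreover have "(1 / t) ^ (d + 1 + 1) * (t ^ (d + 2)) ^ Suc k = t ^ ((d + 2) * k)" for k
      proof -
        have "(1 / t) ^ (d + 2) * t ^ (d + 2) = 1"
          unfolding power_mult_distrib[symmetric] using that by simp
        then have "(1 / t) ^ (d + 2) * (t ^ (d + 2) * x) = x" for x
          by (simp only: mult.assoc[symmetric] mult_1)
        then show ?thesis
          by (simp only: power_Suc power_mult) (simp add: power_mult)
      qed
      ultimately show ?thesis
        unfolding pullback_sum by simp
    qed
    also have "pullback g' \<dots> = (\<lambda>v. \<Sum>k\<le>d + 1. t ^ ((d + 2) * k) *s G k v)"
      unfolding pullback_sum G_def ..
    finally show ?thesis .
  qed
  have deg0: "(\<lambda>v. \<Sum>k\<le>d + 1. 0 ^ ((d + 2) * k) *s G k v) = H"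
  proof
    fix v
    have "(\<Sum>k\<le>d + 1. 0 ^ ((d + 2) * k) *s G k v) = (\<Sum>k\<le>d + 1. if k = 0 then G 0 v else 0)"
      by (intro sum.cong) (auto simp: vec_eq_iff)
    then show "(\<Sum>k\<le>d + 1. 0 ^ ((d + 2) * k) *s G k v) = H v"
      by (simp add: H_def)
  qed
  have diff: "F v - H v = (\<Sum>k\<in>{1..d + 1}. G k v)" for v
  proof -
    have "{..d + 1} = insert 0 {1..d + 1}" by auto
    then show ?thesis
      unfolding sumF H_def by simp
  qed
  have contact: "\<exists>c. conormal_contact c l (\<lambda>v. F v - H v) s" if s: "dot l s = 0" for s
    unfolding diff
  proof (rule conormal_contact_sum)
    fix k assume "k \<in> {1..d + 1}"
    then obtain c where "conormal_contact c (axis 3 1) (G1 k) (g' *v s)"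
      using conormal_contact_fweight[OF G1(1,2), of k "g' *v s"] s l3[of s] by auto
    from conormal_contact_pullback[OF this, unfolded tl'] show "\<exists>c. conormal_contact c l (G k) s"
      unfolding G_def ..
  qed simp
  have invH: "invariant_line H l"
  proof -
    have "dot (H1 v) w = 0" if "v $ 3 = 0" "w $ 3 = 0" for v w
    proof -
      have "diag3 1 0 *v w = w" "diag3 1 0 *v v = v"
        using that by (simp_all add: vec_eq_iff forall_3 diag3_mult_vec)
      then have "dot w (H1 v) = dot w (pullback (diag3 1 0) H1 v)"
        by (simp add: dot_pullback)
      also have "\<dots> = 0"
        by (simp add: pullback_fweight[OF H1(2)] dot_def)
      finally show ?thesis
        by (simp add: dot_commute)
    qed
    then have "invariant_line H1 (axis 3 1)"
      by (simp add: invariant_line_def dot_axis)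
    from invariant_line_pullback[OF this, of g', unfolded tl'] show ?thesis
      by (simp add: pbH(2)[symmetric])
  qed
  have sing: "sing H \<inter> pline l = sing F \<inter> pline l"
  proof -
    have "F s = H s" if "dot l s = 0" for s
      using contact[OF that] by (auto simp: conormal_contact_def)
    then show ?thesis
      by (auto simp: sing_def pline_def)
  qed
  have local: "milnor H s = 1 \<and> camacho_sad H l s = camacho_sad F l s" if s: "s \<in> sing H \<inter> pline l" for s
  proof -
    have s': "s \<noteq> 0" "dot l s = 0" "H s = 0"
      using s by (auto simp: sing_def pline_def)
    obtain c where "conormal_contact c l (\<lambda>v. F v - H v) s"
      using contact[OF s'(2)] by blast
    note conormal_contact_same_invariants[OF F(1) H(1) s' invH this]
    moreover have "milnor F s = 1"
      using assms(5) s sing by (auto simp: nondegenerate_sing_def)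
    ultimately show ?thesis by simp
  qed
  (* non-degeneracy on the line, in the adapted coordinates: no line of zeros passes through s *)
  have isolated: "\<exists>c. t = c *s s"
    if "s \<noteq> 0" "s $ 3 = 0" "\<And>a b. a \<noteq> 0 \<Longrightarrow> H1 (a *s s + b *s t) = 0" for s t
  proof -
    have gs: "g *v s \<noteq> 0"
      using that(1) gg'(2)[of s] by auto
    have "H1 s = 0"
      using that(3)[of 1 0] by simp
    then have Hs: "H (g *v s) = 0"
      by (simp only: H1_zero)
    then have "g *v s \<in> sing H \<inter> pline l"
      using gs that(2) by (simp add: sing_def pline_def dot_g)
    then have mil: "milnor H (g *v s) = 1"
      using local by blast
    have van: "H (a *s (g *v s) + b *s (g *v t)) = 0" if "a \<noteq> 0" for a b
    proof -
      have "H (g *v (a *s s + b *s t)) = 0"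
        using \<open>\<And>a b. a \<noteq> 0 \<Longrightarrow> H1 (a *s s + b *s t) = 0\<close>[OF that] by (simp only: H1_zero)
      then show ?thesis
        by (simp only: matrix_vector_right_distrib vector_scalar_commute)
    qed
    obtain c where "g *v t = c *s (g *v s)"
      using nondegenerate_isolated_direction[OF H(1) gs Hs mil van] ..
    then have "g' *v (g *v t) = c *s (g' *v (g *v s))"
      by (simp only: vector_scalar_commute)
    then show ?thesis
      unfolding gg' by blast
  qed
  have zerosH1: "v $ 1 = 0 \<and> v $ 2 = 0" if v: "H1 v = 0" "v $ 3 \<noteq> 0" for v
  proof (rule ccontr)
    assume nz: "\<not> (v $ 1 = 0 \<and> v $ 2 = 0)"
    (* the projection of v to the line; the whole line joining s to the third basis vector consists of zeros *)
    define s where "s = diag3 1 0 *v v"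
    have s: "s \<noteq> 0" "s $ 3 = 0"
      using nz by (simp_all add: s_def vec_eq_iff forall_3 diag3_mult_vec)
    have D: "H1 (diag3 1 e *v v) = 0" for e
    proof -
      have "sweight 1 (\<lambda>v. H1 v $ 1)" "sweight 1 (\<lambda>v. H1 v $ 2)" "sweight 0 (\<lambda>v. H1 v $ 3)"
        using H1(2) by (simp_all add: fweight_def)
      then have "H1 (diag3 1 e *v v) $ 1 = e ^ 1 * H1 v $ 1" "H1 (diag3 1 e *v v) $ 2 = e ^ 1 * H1 v $ 2"
        "H1 (diag3 1 e *v v) $ 3 = e ^ 0 * H1 v $ 3"
        unfolding sweight_def by blast+
      then show ?thesis
        using v(1) by (simp add: vec_eq_iff forall_3)
    qed
    have "H1 (a *s s + b *s axis 3 1) = 0" if "a \<noteq> 0" for a b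
    proof -
      have "a *s s + b *s axis 3 1 = a *s (diag3 1 (b / (a * v $ 3)) *v v)"
        using that v(2) by (simp add: vec_eq_iff forall_3 diag3_mult_vec s_def axis_def)
      then show ?thesis
        by (simp add: hform_homogeneous[OF H1(1)] D)
    qed
    from isolated[OF s this] obtain c where "axis 3 1 = c *s s" ..
    from arg_cong[OF this, of "\<lambda>x. x $ 3"] show False
      using s(2) by (simp add: axis_def)
  qed
  have "\<exists>u. u $ 3 = 0 \<and> H1 u \<noteq> 0"
  proof (rule ccontr)
    assume "\<not> ?thesis"
    then have all0: "H1 u = 0" if "u $ 3 = 0" for u
      using that by blast
    have "\<exists>c. (axis 2 1 :: complex^3) = c *s axis 1 1"
    proof (rule isolated)
      show "axis 1 1 \<noteq> (0 :: complex^3)"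
        by (simp add: axis_eq_0_iff)
      show "H1 (a *s axis 1 1 + b *s axis 2 1) = 0" for a b
        by (rule all0) (simp add: axis_def)
    qed (simp add: axis_def)
    then obtain c where "(axis 2 1 :: complex^3) = c *s axis 1 1" ..
    from arg_cong[OF this, of "\<lambda>x. x $ 2"] show False
      by (simp add: axis_def)
  qed
  then obtain u where u: "u $ 3 = 0" "H1 u \<noteq> 0" by blast
  have u12: "u $ 1 \<noteq> 0 \<or> u $ 2 \<noteq> 0"
  proof (rule ccontr)
    assume "\<not> ?thesis"
    then have "u = 0 *s u"
      using u(1) by (simp add: vec_eq_iff forall_3)
    then have "H1 u = 0 ^ (d + 1) *s H1 u"
      using hform_homogeneous[OF H1(1), of 0 u] by simp
    with u(2) show False by simp
  qed
  have "no_common_factor H"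
    unfolding no_common_factor_def
  proof (intro allI impI)
    fix f \<rho> assume *: "poly3 f \<and> (\<forall>i. poly3 (\<lambda>v. \<rho> v $ i)) \<and> (\<forall>v. H v = f v *s \<rho> v)"
    have "f (g *v v) = f (g *v u)" for v
    proof (rule constant_of_small_zero_set[where Z = "{v. H1 v = 0}" and f = "\<lambda>v. f (g *v v)"])
      show "polynomial_on_lines (\<lambda>v. f (g *v v))"
        using * by (intro polynomial_on_lines_subst poly3_polynomial_on_lines) blast
      fix v assume "f (g *v v) = 0"
      then have "H1 v = 0"
        unfolding H1_zero using * by simp
      then show "v $ 1 = 0 \<and> v $ 2 = 0 \<or> v $ 3 = 0 \<and> v \<in> {v. H1 v = 0}"
        using zerosH1 by blast
    qed (use u u12 in auto)
    from this[of "g' *v _"] show "\<exists>c. \<forall>v. f v = c"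
      unfolding gg' by blast
  qed
  with H have folH: "foliation_form d H"
    by (simp add: foliation_form_def hform_def homog_poly3_iff_hpoly)
  have homog: "homogeneous_foliation H"
    unfolding homogeneous_foliation_def
  proof (intro exI[of _ g] conjI g allI impI)
    fix t :: complex assume t: "t \<noteq> 0"
    have "pullback (homothety t) H1 v = t ^ (d + 1) *s H1 v" for v
      using pullback_fweight_scaled[OF H1(2,1), of t "1 / t" v] t by (simp add: homothety_eq_diag3)
    then show "\<exists>c. c \<noteq> 0 \<and> (\<forall>v. pullback (homothety t) (pullback g H) v = c *s pullback g H v)"
      unfolding pbH(1) using t by (intro exI[of _ "t ^ (d + 1)"]) simp
  qed
  have clos: "H \<in> orbit_closure d F"
  proof -
    define D where "D t v = (\<Sum>k\<le>d + 1. t ^ ((d + 2) * k) *s G k v)" for t v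
    have "continuous_on UNIV D"
    proof (rule continuous_on_coordinatewise_then_product)
      fix v
      show "continuous_on UNIV (\<lambda>t. D t v)"
        unfolding continuous_on_def
      proof (intro ballI vec_tendstoI)
        fix t i
        have "((\<lambda>t. \<Sum>k\<le>d + 1. t ^ ((d + 2) * k) * G k v $ i) \<longlongrightarrow> (\<Sum>k\<le>d + 1. t ^ ((d + 2) * k) * G k v $ i)) (at t)"
          by (intro tendsto_intros)
        then show "((\<lambda>t. D t v $ i) \<longlongrightarrow> D t v $ i) (at t within UNIV)"
          unfolding D_def sum_component vector_smult_component .
      qed
    qed
    moreover have "D t \<in> orbit_forms F" if "t \<noteq> 0" for t
      unfolding orbit_forms_def D_def[abs_def] deg[OF that, symmetric]
      using h[OF that] by (intro CollectI exI[of _ 1] exI[of _ "h t"]) simp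
    ultimately have "D 0 \<in> closure (orbit_forms F)"
      by (rule continuous_limit_in_closure[of D])
    moreover have "D 0 = H"
      unfolding D_def[abs_def] by (rule deg0)
    ultimately show ?thesis
      using folH by (simp add: orbit_closure_def)
  qed
  have flat: "flat_legendre d H" if flatF: "flat_legendre d F"
    unfolding flat_legendre_def
  proof (intro allI impI)
    fix k :: "complex^3^3" assume k: "invertible k"
    define \<omega> where "\<omega> t v = (\<Sum>j\<le>d + 1. t ^ ((d + 2) * j) *s pullback k (G j) v)" for t v
    have \<omega>0: "\<omega> 0 = pullback k H"
      unfolding \<omega>_def[abs_def] deg0[symmetric] pullback_sum ..
    have \<omega>t: "\<omega> t = pullback (h t ** k) F" if "t \<noteq> 0" for t
      unfolding \<omega>_def[abs_def] pullback_compose[symmetric] deg[OF that] pullback_sum ..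
    have "flat_web d (legendre d (\<omega> 0))"
    proof (rule flat_web_limit[where S = "\<lambda>t. legendre d (\<omega> t)"])
      show "holo_family UNIV UNIV (\<lambda>t z. coeff (legendre_poly (\<omega> t) (fst z) (snd z)) j)" for j
        unfolding \<omega>_def[abs_def]
      proof (rule holo_family_legendre_coeff)
        fix j i
        show "hpoly (d + 1) (\<lambda>v. pullback k (G j) v $ i)"
          using hform_pullback[OF hform_pullback[OF G1(1)], of k g' j] by (simp add: hform_def G_def)
      qed
      show "legendre d (\<omega> t) z \<xi> = (\<Sum>j\<le>d. coeff (legendre_poly (\<omega> t) (fst z) (snd z)) j
          * fst \<xi> ^ (d - j) * snd \<xi> ^ j)" for t z \<xi>
        by (rule legendre_def)
      show "flat_web d (legendre d (\<omega> t))" if "t \<noteq> 0" for t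
        unfolding \<omega>t[OF that] using flatF invertible_mult[OF h[OF that] k] by (simp add: flat_legendre_def)
    qed
    then show "flat_web d (legendre d (pullback k H))"
      unfolding \<omega>0 .
  qed
  show ?thesis
    using folH homog clos invH sing local flat by blast
qed

end
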